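(* Let $(\beta,B)\in\Theta_2$, and let $(A_N)_{N\ge2}$ be a sequence of coupling matrices such that $\max_{1\le i\le N}R_i\lesssim1$, $\lim_{N\to\infty}\lambda_1(A_N)=1$, and $\limsup_{N\to\infty}\frac{\lambda_2(A_N)}{\lambda_1(A_N)}<1$. If $\boldsymbol\sigma$ is a random vector from the Ising model $\mathbb P$ with parameters $(A_N,\beta,B)$, then $$d_{KS}\Big(\sqrt N(\overline{\boldsymbol\sigma}-M(\boldsymbol\sigma)),Z_\tau\Big)\lesssim\frac1{\sqrt N}\left(\lVert A_N\rVert_F^2+\sum_{i=1}^N(R_i-1)^2+\Big|\sum_{i=1}^N(R_i-1)\Big|\right),$$ where $Z_\tau\sim N(0,\tau)$ with $\tau=\frac{1-t^2}{1-\beta(1-t^2)}$.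
   Context: A coupling matrix $A_N$ is a symmetric $N\times N$ matrix with non-negative entries and zeros on the diagonal. The Ising model with parameters $(A_N,\beta,B)$, $\beta>0$, $B\in\mathbb R$, is the probability mass function on $\boldsymbol\sigma=(\sigma_1,\dots,\sigma_N)\in\{-1,1\}^N$ given by $\mathbb P(\boldsymbol\sigma)=\frac1{Z_N(\beta,B)}\exp\big(\frac\beta2\boldsymbol\sigma^\top A_N\boldsymbol\sigma+B\sum_{i=1}^N\sigma_i\big)$. Put $\overline{\boldsymbol\sigma}=\frac1N\sum_{i=1}^N\sigma_i$, $R_i=\sum_{j=1}^NA_N(i,j)$, $\lambda_1(A_N)\ge\dots\ge\lambda_N(A_N)$ the eigenvalues, $\lVert\cdot\rVert_F$ the Frobenius norm. $\Theta_2=\{(\beta,0):\beta>1\}$. For $(\beta,B)\in\Theta_2$, $t$ is the unique strictly positive solution of $x=\tanh(\beta x)$, and $M(\boldsymbol\sigma)=t$ if $\overline{\boldsymbol\sigma}\ge0$, $M(\boldsymbol\sigma)=-t$ otherwise. $d_{KS}(X,Y)=\sup_{x\in\mathbb R}|\mathbb P(X\le x)-\mathbb P(Y\le x)|$. $x_N\lesssim y_N$ means there is a finite constant $C$ free of $N$ (it may depend on $\beta,B$ and on the sequence $(A_N)$) with $x_N\le Cy_N$ for all $N$. *)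

theory Defs
  imports
    "HOL-Probability.Probability"
    "Jordan_Normal_Form.Char_Poly"
begin

text \<open>
  Since the dimension \<open>N\<close> varies, the matrices and spin vectors are those of
  \<^theory>\<open>Jordan_Normal_Form.Matrix\<close>, indexed from \<open>0\<close> to \<open>N - 1\<close>.
\<close>

definition coupling_matrix :: "nat \<Rightarrow> real mat \<Rightarrow> bool" where
  "coupling_matrix N A \<longleftrightarrow>
     A \<in> carrier_mat N N \<and>
     (\<forall>i<N. \<forall>j<N. A $$ (i, j) = A $$ (j, i)) \<and>
     (\<forall>i<N. \<forall>j<N. 0 \<le> A $$ (i, j)) \<and>
     (\<forall>i<N. A $$ (i, i) = 0)"

definition row_sum :: "real mat \<Rightarrow> nat \<Rightarrow> real" where
  "row_sum A i = (\<Sum>j<dim_col A. A $$ (i, j))"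

definition frobenius_norm :: "real mat \<Rightarrow> real" where
  "frobenius_norm A = sqrt (\<Sum>i<dim_row A. \<Sum>j<dim_col A. (A $$ (i, j))\<^sup>2)"

text \<open>
  The \<open>k\<close>-th largest eigenvalue for \<open>k = 1, \<dots>, N\<close>, counted with (algebraic) multiplicity. For a
  real symmetric matrix of size \<open>N\<close> the characteristic polynomial splits over the reals, so the
  list below has length \<open>N\<close>.
\<close>

definition eigval :: "real mat \<Rightarrow> nat \<Rightarrow> real" where
  "eigval A k = rev (sorted_list_of_multiset (proots (char_poly A))) ! (k - 1)"

definition spin_configs :: "nat \<Rightarrow> real Matrix.vec set" where
  "spin_configs N = {\<sigma> \<in> carrier_vec N. \<forall>i<N. vec_index \<sigma> i \<in> {-1, 1}}"

definition ising_weight :: "real mat \<Rightarrow> real \<Rightarrow> real \<Rightarrow> real Matrix.vec \<Rightarrow> real" where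
  "ising_weight A \<beta> B \<sigma> =
     exp (\<beta> / 2 * scalar_prod \<sigma> (A *\<^sub>v \<sigma>) + B * (\<Sum>i<dim_vec \<sigma>. vec_index \<sigma> i))"

definition ising_partition :: "real mat \<Rightarrow> real \<Rightarrow> real \<Rightarrow> real" where
  "ising_partition A \<beta> B = (\<Sum>\<sigma>\<in>spin_configs (dim_row A). ising_weight A \<beta> B \<sigma>)"

definition ising_pmf :: "real mat \<Rightarrow> real \<Rightarrow> real \<Rightarrow> real Matrix.vec pmf" where
  "ising_pmf A \<beta> B = embed_pmf (\<lambda>\<sigma>.
     if \<sigma> \<in> spin_configs (dim_row A) then ising_weight A \<beta> B \<sigma> / ising_partition A \<beta> B else 0)"

definition spin_mean :: "real Matrix.vec \<Rightarrow> real" where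
  "spin_mean \<sigma> = (\<Sum>i<dim_vec \<sigma>. vec_index \<sigma> i) / real (dim_vec \<sigma>)"

definition Theta2 :: "(real \<times> real) set" where
  "Theta2 = {(\<beta>, 0) |\<beta>. \<beta> > 1}"

definition pos_root :: "real \<Rightarrow> real" where
  "pos_root \<beta> = (THE x. 0 < x \<and> x = tanh (\<beta> * x))"

definition center :: "real \<Rightarrow> real Matrix.vec \<Rightarrow> real" where
  "center t \<sigma> = (if spin_mean \<sigma> \<ge> 0 then t else - t)"

definition d_KS :: "'a measure \<Rightarrow> ('a \<Rightarrow> real) \<Rightarrow> 'b measure \<Rightarrow> ('b \<Rightarrow> real) \<Rightarrow> real" where
  "d_KS P X Q Y =
     (SUP x. \<bar>measure P {\<omega> \<in> space P. X \<omega> \<le> x} - measure Q {\<omega> \<in> space Q. Y \<omega> \<le> x}\<bar>)"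

text \<open>The sequences compared are indexed by \<open>N \<ge> 2\<close>; values at \<open>0\<close> and \<open>1\<close> are ignored.\<close>

definition lesssim :: "(nat \<Rightarrow> real) \<Rightarrow> (nat \<Rightarrow> real) \<Rightarrow> bool" (infix \<open>\<lesssim>\<^sub>N\<close> 50) where
  "x \<lesssim>\<^sub>N y \<longleftrightarrow> (\<exists>C. \<forall>N\<ge>2. x N \<le> C * y N)"


lemma finite_spin_configs: "finite (spin_configs N)"
proof (rule finite_subset)
  show "spin_configs N \<subseteq> (\<lambda>f. Matrix.vec N f) ` (PiE {..<N} (\<lambda>_. {-1, 1}))"
  proof
    fix s assume s: "s \<in> spin_configs N"
    have "s = Matrix.vec N (restrict (vec_index s) {..<N})"
      using s by (intro eq_vecI) (auto simp: spin_configs_def)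
    moreover have "restrict (vec_index s) {..<N} \<in> PiE {..<N} (\<lambda>_. {-1, 1})"
      using s by (auto simp: spin_configs_def)
    ultimately show "s \<in> (\<lambda>f. Matrix.vec N f) ` (PiE {..<N} (\<lambda>_. {-1, 1}))" by blast
  qed
qed (auto intro!: finite_PiE)

lemma ising_partition_pos: "ising_partition A \<beta> B > 0"
proof -
  have "Matrix.vec (dim_row A) (\<lambda>_. 1) \<in> spin_configs (dim_row A)"
    by (auto simp: spin_configs_def)
  then show ?thesis
    unfolding ising_partition_def ising_weight_def
    by (intro sum_pos) (auto simp: finite_spin_configs)
qed

lemma pmf_ising_pmf:
  "pmf (ising_pmf A \<beta> B) \<sigma> =
     (if \<sigma> \<in> spin_configs (dim_row A) then ising_weight A \<beta> B \<sigma> / ising_partition A \<beta> B else 0)"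
  unfolding ising_pmf_def
proof (rule pmf_embed_pmf)
  let ?S = "spin_configs (dim_row A)"
  let ?f = "\<lambda>\<sigma>. if \<sigma> \<in> ?S then ising_weight A \<beta> B \<sigma> / ising_partition A \<beta> B else 0"
  show nn: "\<And>x. 0 \<le> ?f x"
    using ising_partition_pos[of A \<beta> B] by (auto simp: ising_weight_def)
  have "(\<integral>\<^sup>+x. ennreal (?f x) \<partial>count_space UNIV) = (\<Sum>x\<in>?S. ennreal (?f x))"
    by (intro nn_integral_count_space') (auto simp: finite_spin_configs)
  also have "\<dots> = ennreal (\<Sum>x\<in>?S. ?f x)"
    by (rule sum_ennreal) (rule nn)
  also have "(\<Sum>x\<in>?S. ?f x) = (\<Sum>x\<in>?S. ising_weight A \<beta> B x) / ising_partition A \<beta> B"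
    by (simp add: sum_divide_distrib)
  also have "\<dots> = 1"
    using ising_partition_pos[of A \<beta> B] by (simp add: ising_partition_def)
  finally show "(\<integral>\<^sup>+x. ennreal (?f x) \<partial>count_space UNIV) = 1" by simp
qed

lemma ex1_pos_root:
  fixes \<beta> :: real
  assumes "\<beta> > 1"
  shows "\<exists>!x. 0 < x \<and> x = tanh (\<beta> * x)"
proof -
  define g where "g = (\<lambda>x. tanh (\<beta> * x) - x)"
  have cosh0: "cosh y \<noteq> 0" for y :: real
    using cosh_real_pos[of y] by linarith
  have dg: "(g has_real_derivative (\<beta> * (1 - (tanh (\<beta> * x))\<^sup>2) - 1)) (at x)" for x
    unfolding g_def by (rule derivative_eq_intros refl | simp add: cosh0)+
  have cg: "continuous_on S g" for S
    using dg DERIV_isCont continuous_at_imp_continuous_on by blast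
  have ex: "\<exists>x. 0 < x \<and> g x = 0"
  proof -
    have "(g has_real_derivative (\<beta> - 1)) (at 0)"
      using dg[of 0] by simp
    from DERIV_pos_inc_right[OF this] assms obtain d
      where d: "d > 0" "\<And>h. 0 < h \<Longrightarrow> h < d \<Longrightarrow> g 0 < g (0 + h)" by auto
    define h where "h = min (d / 2) 1"
    have h: "0 < h" "h < d" "h \<le> 1" using d by (auto simp: h_def)
    have "g 0 < g h" using d(2)[OF h(1,2)] by simp
    then have "0 < g h" by (simp add: g_def)
    moreover have "g 1 \<le> 0" using tanh_real_lt_1[of \<beta>] by (simp add: g_def)
    ultimately obtain x where "h \<le> x" "x \<le> 1" "g x = 0"
      using IVT2'[of g 1 0 h] h cg by auto
    with h show ?thesis by (intro exI[of _ x]) auto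
  qed
  have less: False if ab: "0 < a" "a < b" "g a = 0" "g b = 0" for a b
  proof -
    have df: "g differentiable (at x)" for x
      using dg real_differentiable_def by blast
    have g0: "g 0 = 0" by (simp add: g_def)
    obtain c where c: "0 < c" "c < a" "DERIV g c :> 0"
      using Rolle[of 0 a g] ab g0 cg df by auto
    obtain d where d: "a < d" "d < b" "DERIV g d :> 0"
      using Rolle[of a b g] ab cg df by auto
    have "\<beta> * (1 - (tanh (\<beta> * c))\<^sup>2) - 1 = 0" "\<beta> * (1 - (tanh (\<beta> * d))\<^sup>2) - 1 = 0"
      using DERIV_unique[OF dg c(3)] DERIV_unique[OF dg d(3)] by auto
    then have "\<beta> * (tanh (\<beta> * c))\<^sup>2 = \<beta> * (tanh (\<beta> * d))\<^sup>2"
      unfolding right_diff_distrib by linarith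
    then have "(tanh (\<beta> * c))\<^sup>2 = (tanh (\<beta> * d))\<^sup>2" using assms by simp
    moreover have "0 < tanh (\<beta> * c)" "0 < tanh (\<beta> * d)"
      using c d assms ab by auto
    ultimately have "tanh (\<beta> * c) = tanh (\<beta> * d)"
      by (simp add: power2_eq_iff_nonneg)
    then show False using c d assms by (simp add: tanh_real_eq_iff)
  qed
  have eq: "x = tanh (\<beta> * x) \<longleftrightarrow> g x = 0" for x by (auto simp: g_def)
  show ?thesis unfolding eq using ex less by (metis linorder_neqE)
qed

end

theory Submission
  imports Defs "Jordan_Normal_Form.Schur_Decomposition"
begin

text \<open>
  Put \<open>\<rho>\<^sub>i = R\<^sub>i - 1\<close> and \<open>\<epsilon> = \<parallel>A\<parallel>\<^sub>F\<^sup>2 + \<Sum> \<rho>\<^sub>i\<^sup>2 + \<bar>\<Sum> \<rho>\<^sub>i\<bar>\<close>. As the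
  Kolmogorov distance is at most 1, only large \<open>N\<close> with \<open>\<epsilon> \<le> sqrt N\<close> matter.

  Stein's method for Glauber dynamics, with the flips that change the sign of the mean rejected,
  bounds the distance by \<open>1 / sqrt N\<close> times
  \<open>1 + \<Sum> \<rho>\<^sub>i\<^sup>2 + \<bar>\<Sum> \<rho>\<^sub>i\<bar> + E D\<close>, where, with \<open>x = \<sigma> - M(\<sigma>)\<close>,
  \<open>D = (\<Sum> x\<^sub>i)\<^sup>2 / N + \<parallel>A x\<parallel>\<^sup>2 + \<bar>\<Sum> \<rho>\<^sub>i x\<^sub>i\<bar>\<close>.

  To see \<open>E D \<lesssim> \<epsilon>\<close>, restrict by symmetry to a nonnegative mean and compare with independent
  spins of mean \<open>t\<close>: the density is a constant times
  \<open>exp (\<beta>/2 x\<^sup>T A x + \<beta> t \<Sum> \<rho>\<^sub>i x\<^sub>i)\<close>, and by \<open>1 + y \<le> exp y\<close> the constant is at most the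
  partition function. It remains to bound exponential moments of quadratic forms by
  \<open>exp (C \<epsilon>)\<close>. Small eigenvalues are treated by decoupling. The number of large ones is
  \<open>O(\<parallel>A\<parallel>\<^sub>F\<^sup>2)\<close>, and each costs a constant after Gaussian linearisation, because the optimal
  sub-Gaussian variance proxy of a spin of mean \<open>t\<close> is exactly \<open>1/\<beta>\<close>. This suffices off the top
  eigenvector; along it, which is nearly constant, the restriction to a nonnegative mean improves the
  proxy.
\<close>

section \<open>Stein's method for the normal distribution\<close>

text \<open>The obstacle is criticality. Linearising the energy in an eigendirection costs a factor
  1 / sqrt (1 - b), where b is the eigenvalue times \<beta> times the variance proxy of a spin.
  Since that proxy is 1/\<beta>, b tends to 1 along the top eigenvector and the factor blows up.
  Apart from the zero tilt, the proxy bound is attained only by the tilt into the opposite phase,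
  and \<open>well_gap\<close> measures the loss elsewhere. Excluding that phase lowers the proxy by
  a factor 1 - \<kappa> on constant vectors and raises it by 1 + 4 * \<kappa> on vectors orthogonal
  to them; the spectral gap pays for the latter. As the top direction has only this little room, a
  Hoelder-type splitting must give it an exponent p barely above 1 and leave a large conjugate
  exponent q to all other terms. These tolerate any q, because the threshold \<eta> between small
  and large eigenvalues is chosen after q. Additive constants are harmless: for large N the squared
  Frobenius norm is at least the square of the top eigenvalue, hence at least 1/4.\<close>

definition Phi :: "real \<Rightarrow> real" where
  "Phi = cdf std_normal_distribution"

lemma Phi_nonneg: "0 \<le> Phi z" and Phi_le_1: "Phi z \<le> 1"
proof -
  interpret real_distribution std_normal_distribution by (rule real_dist_normal_dist)
  show "0 \<le> Phi z" "Phi z \<le> 1" unfolding Phi_def cdf_def by (auto simp: prob_le_1)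
qed

lemma Phi_at_top: "(Phi \<longlongrightarrow> 1) at_top" and Phi_at_bot: "(Phi \<longlongrightarrow> 0) at_bot"
proof -
  interpret real_distribution std_normal_distribution by (rule real_dist_normal_dist)
  show "(Phi \<longlongrightarrow> 1) at_top" "(Phi \<longlongrightarrow> 0) at_bot" unfolding Phi_def
    by (simp_all add: cdf_lim_at_top_prob cdf_lim_at_bot)
qed

lemma Phi_diff:
  assumes "a \<le> b"
  shows "Phi b - Phi a = integral {a..b} std_normal_density"
proof (cases "a = b")
  case False
  with assms have ab: "a < b" by simp
  interpret real_distribution std_normal_distribution by (rule real_dist_normal_dist)
  have "Phi b - Phi a = measure std_normal_distribution {a<..b}"
    unfolding Phi_def using cdf_diff_eq[OF ab] .
  also have "\<dots> = (LINT x:{a<..b}|lborel. std_normal_density x)"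
  proof -
    have "measure std_normal_distribution {a<..b} = (LINT x|std_normal_distribution. indicator {a<..b} x)"
      by simp
    also have "\<dots> = (LINT x|lborel. std_normal_density x *\<^sub>R indicator {a<..b} x)"
      by (rule integral_density) auto
    finally show ?thesis by (simp add: set_lebesgue_integral_def mult.commute)
  qed
  also have "\<dots> = integral {a<..b} std_normal_density"
    by (rule set_borel_integral_eq_integral)
       (use integrable_mult_indicator[OF _ integrable_normal_density[of 1 0], of "{a<..b}"] in \<open>auto simp: set_integrable_def\<close>)
  also have "\<dots> = integral {a..b} std_normal_density"
    by (rule integral_subset_negligible) (auto intro: negligible_subset[of "{a}"])
  finally show ?thesis .
qed auto

lemma continuous_on_std_normal_density: "continuous_on S std_normal_density"
  unfolding std_normal_density_def by (intro continuous_intros) auto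

lemma Phi_deriv [derivative_intros]:
  "(Phi has_real_derivative std_normal_density x) (at x)"
proof -
  let ?I = "\<lambda>u. integral {x - 1..u} std_normal_density"
  have "(?I has_real_derivative std_normal_density x) (at x within {x - 1..x + 1})"
    by (rule integral_has_real_derivative) (auto intro: continuous_on_std_normal_density)
  then have "(?I has_real_derivative std_normal_density x) (at x)"
    by (subst (asm) at_within_interior) auto
  then have "((\<lambda>u. Phi (x - 1) + ?I u) has_real_derivative std_normal_density x) (at x)"
    by (auto intro!: derivative_eq_intros)
  moreover have "eventually (\<lambda>u. u \<in> {x - 1<..<x + 1}) (nhds x)"
    by (rule eventually_nhds_in_open) auto
  then have "eventually (\<lambda>u. Phi u = Phi (x - 1) + ?I u) (nhds x)"
  proof eventually_elim
    case (elim u)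
    then have "x - 1 \<le> u" by simp
    from Phi_diff[OF this] show ?case by linarith
  qed
  ultimately show ?thesis
    by (subst DERIV_cong_ev[OF refl, where g = "\<lambda>u. Phi (x - 1) + ?I u"]) auto
qed

lemma Phi_minus: "Phi (- x) = 1 - Phi x"
proof -
  let ?g = "\<lambda>x. Phi x + Phi (- x)"
  have D: "(?g has_real_derivative 0) (at y)" for y
    by (rule derivative_eq_intros Phi_deriv DERIV_chain2[of Phi] refl)+
       (simp add: std_normal_density_def)
  have const: "?g y = ?g 0" for y
    using DERIV_isconst_all[of ?g] D by blast
  have "(?g \<longlongrightarrow> 1 + 0) at_top"
    by (intro tendsto_add Phi_at_top filterlim_compose[OF Phi_at_bot] filterlim_uminus_at_bot_at_top)
  then have "((\<lambda>_::real. ?g 0) \<longlongrightarrow> 1) at_top" using const by simp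
  then have "?g 0 = 1" by (simp add: tendsto_const_iff)
  with const[of x] show ?thesis by simp
qed

section \<open>Gaussian tails and the Mills ratio\<close>

lemma std_normal_density_deriv:
  "(std_normal_density has_real_derivative - x * std_normal_density x) (at x)"
  unfolding std_normal_density_def
  by (auto intro!: derivative_eq_intros simp: field_simps)

text \<open>Serves both tail bounds below: the difference of their two sides decreases and vanishes
  at infinity, so no tail integral has to be estimated.\<close>

lemma nonneg_if_decreasing_to_0:
  fixes g :: "real \<Rightarrow> real"
  assumes D: "\<And>x. x \<ge> a \<Longrightarrow> (g has_real_derivative g' x) (at x)"
    and neg: "\<And>x. x \<ge> a \<Longrightarrow> g' x \<le> 0" and lim: "(g \<longlongrightarrow> 0) at_top"
  shows "0 \<le> g a"
proof (rule tendsto_upperbound[OF lim])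
  have "g y \<le> g a" if "y \<ge> a" for y
    using DERIV_nonpos_imp_nonincreasing[OF that, of g] D neg by (meson)
  then show "eventually (\<lambda>y. g y \<le> g a) at_top"
    using eventually_ge_at_top by (rule eventually_mono[rotated])
qed auto

lemma mills_upper:
  assumes "0 < w"
  shows "w * (1 - Phi w) \<le> std_normal_density w"
proof -
  let ?g = "\<lambda>x. std_normal_density x / x - (1 - Phi x)"
  have "0 \<le> ?g w"
  proof (rule nonneg_if_decreasing_to_0[where g = ?g and a = w])
    show "(?g has_real_derivative - std_normal_density x / x\<^sup>2) (at x)" if "w \<le> x" for x
      using that assms
      by (auto intro!: derivative_eq_intros std_normal_density_deriv Phi_deriv
               simp: field_simps power2_eq_square)
    have "((\<lambda>x. std_normal_density x / x) \<longlongrightarrow> 0) at_top"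
      unfolding std_normal_density_def by real_asymp
    from tendsto_diff[OF this tendsto_diff[OF tendsto_const[of 1] Phi_at_top]]
    show "(?g \<longlongrightarrow> 0) at_top" by simp
  qed auto
  with assms show ?thesis by (simp add: field_simps)
qed

lemma mills_lower: "w * std_normal_density w \<le> (1 + w\<^sup>2) * (1 - Phi w)"
proof -
  let ?g = "\<lambda>x. (1 - Phi x) - x * std_normal_density x / (1 + x\<^sup>2)"
  have nz: "1 + x\<^sup>2 \<noteq> 0" for x :: real
    using zero_le_power2[of x] by linarith
  have "0 \<le> ?g w"
  proof (rule nonneg_if_decreasing_to_0[where g = ?g and a = w])
    show "(?g has_real_derivative - (2 * std_normal_density x / (1 + x\<^sup>2)\<^sup>2)) (at x)" for x
      by (rule derivative_eq_intros std_normal_density_deriv Phi_deriv refl nz)+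
         (use nz[of x] in \<open>simp add: divide_simps; simp add: power2_eq_square algebra_simps\<close>)
    have "((\<lambda>x. x * std_normal_density x / (1 + x\<^sup>2)) \<longlongrightarrow> 0) at_top"
      unfolding std_normal_density_def by real_asymp
    from tendsto_diff[OF tendsto_diff[OF tendsto_const[of 1] Phi_at_top] this]
    show "(?g \<longlongrightarrow> 0) at_top" by simp
  qed auto
  moreover have "0 < 1 + w\<^sup>2" using zero_le_power2[of w] by linarith
  ultimately show ?thesis by (simp add: field_simps)
qed

definition mills :: "real \<Rightarrow> real" where
  "mills w = (1 - Phi w) / std_normal_density w"

lemma std_normal_density_gt_0: "0 < std_normal_density w"
  by (rule normal_density_pos) simp

lemma mills_nonneg: "0 \<le> mills w"
  using Phi_le_1[of w] std_normal_density_gt_0[of w] by (simp add: mills_def)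

text \<open>\<open>mills\<close> solves y' = w * y - 1, the Stein equation with a constant
  inhomogeneity. Multiples of it and of its reflection are therefore the two branches of
  \<open>stein_sol\<close>.\<close>

lemma mills_deriv: "(mills has_real_derivative w * mills w - 1) (at w)"
  unfolding mills_def using std_normal_density_gt_0[of w]
  by (auto intro!: derivative_eq_intros std_normal_density_deriv Phi_deriv
           simp: field_simps power2_eq_square)

lemma mills_le: "w * mills w \<le> 1"
proof (cases "0 < w")
  case True
  with mills_upper[OF True] std_normal_density_gt_0[of w] show ?thesis
    by (simp add: mills_def field_simps)
next
  case False
  then have "w * mills w \<le> 0" by (simp add: mult_nonpos_nonneg mills_nonneg)
  then show ?thesis by simp
qed

text \<open>The derivative is nonnegative by exactly \<open>mills_lower\<close>. This monotonicity
  is what allows the Stein remainder to be bounded by increments of a monotone function.\<close>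

lemma mills_mono: "v \<le> w \<Longrightarrow> v * mills v \<le> w * mills w"
proof (erule DERIV_nonneg_imp_nondecreasing)
  fix w
  have "((\<lambda>w. w * mills w) has_real_derivative ((1 + w\<^sup>2) * mills w - w)) (at w)"
    by (rule derivative_eq_intros mills_deriv refl)+ (simp add: power2_eq_square algebra_simps)
  moreover have "0 \<le> (1 + w\<^sup>2) * mills w - w"
    using mills_lower[of w] std_normal_density_gt_0[of w] by (simp add: mills_def field_simps)
  ultimately show "\<exists>y. ((\<lambda>w. w * mills w) has_real_derivative y) (at w) \<and> 0 \<le> y" by blast
qed

lemma mills_antimono: "v \<le> w \<Longrightarrow> mills w \<le> mills v"
proof (erule DERIV_nonpos_imp_nonincreasing)
  fix w
  show "\<exists>y. (mills has_real_derivative y) (at w) \<and> y \<le> 0"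
    using mills_deriv[of w] mills_le[of w] by fastforce
qed

lemma Phi_mono: "v \<le> w \<Longrightarrow> Phi v \<le> Phi w"
  by (erule DERIV_nonneg_imp_nondecreasing) (use Phi_deriv in fastforce)

lemma mills_minus: "mills (- w) = Phi w / std_normal_density w"
  by (simp add: mills_def Phi_minus std_normal_density_def)

text \<open>The bounded solution of \<open>f' w = w * f w + indicator {..z} w - Phi z\<close>.\<close>
definition stein_sol :: "real \<Rightarrow> real \<Rightarrow> real" where
  "stein_sol z w = (if w \<le> z then (1 - Phi z) * mills (- w) else Phi z * mills w)"

text \<open>The branches agree at \<open>w = z\<close>. This continuity lets increments across
  \<open>z\<close> be split there.\<close>

lemma stein_sol_ge: "z \<le> w \<Longrightarrow> stein_sol z w = Phi z * mills w"
  unfolding stein_sol_def mills_minus by (auto simp: mills_def)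

lemma stein_sol_nonneg: "0 \<le> stein_sol z w"
  using Phi_nonneg[of z] Phi_le_1[of z] mills_nonneg by (simp add: stein_sol_def)

text \<open>The solution is a lower tail times an upper tail divided by the density. Dropping either
  factor leaves a Mills ratio, and the sign of \<open>w\<close> decides which one to drop.\<close>

lemma stein_sol_le_mills: "stein_sol z w \<le> mills \<bar>w\<bar>"
proof -
  have eq: "stein_sol z w = min (Phi z) (Phi w) * min (1 - Phi z) (1 - Phi w) / std_normal_density w"
    using Phi_mono[of w z] Phi_mono[of z w]
    unfolding stein_sol_def mills_minus by (cases "w \<le> z") (auto simp: mills_def min_def)
  have "min (Phi z) (Phi w) * min (1 - Phi z) (1 - Phi w) \<le> 1 * (1 - Phi w)"
    using Phi_nonneg Phi_le_1 by (intro mult_mono) (auto simp: min_le_iff_disj le_diff_eq)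
  moreover have "min (Phi z) (Phi w) * min (1 - Phi z) (1 - Phi w) \<le> Phi w * 1"
    using Phi_nonneg Phi_le_1 by (intro mult_mono) (auto simp: min_le_iff_disj le_diff_eq)
  ultimately show ?thesis
    unfolding eq using std_normal_density_gt_0[of w] mills_minus[of w]
    by (cases "w \<ge> 0") (auto simp: mills_def divide_right_mono)
qed

lemma stein_sol_le: "stein_sol z w \<le> mills 0"
  using stein_sol_le_mills[of z w] mills_antimono[of 0 "\<bar>w\<bar>"] by simp

lemma abs_mult_stein_sol_le: "\<bar>w * stein_sol z w\<bar> \<le> 1"
proof -
  have "\<bar>w * stein_sol z w\<bar> = \<bar>w\<bar> * stein_sol z w"
    by (simp add: abs_mult stein_sol_nonneg)
  also have "\<dots> \<le> \<bar>w\<bar> * mills \<bar>w\<bar>" by (intro mult_left_mono stein_sol_le_mills) auto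
  also have "\<dots> \<le> 1" by (rule mills_le)
  finally show ?thesis .
qed

text \<open>Each branch is a nonnegative multiple of \<open>mills_mono\<close>, on the left after
  reflection, and the branches are glued at \<open>z\<close>.\<close>

lemma mult_stein_sol_mono:
  assumes "v \<le> w"
  shows "v * stein_sol z v \<le> w * stein_sol z w"
proof -
  have le: "v * stein_sol z v \<le> w * stein_sol z w" if "v \<le> w" "w \<le> z" for v w
    using mult_left_mono[OF mills_mono[of "-w" "-v"], of "1 - Phi z"] Phi_le_1[of z] that
    by (simp add: stein_sol_def algebra_simps)
  have ge: "v * stein_sol z v \<le> w * stein_sol z w" if "v \<le> w" "z \<le> v" for v w
    using mult_left_mono[OF mills_mono[of v w], of "Phi z"] Phi_nonneg[of z] that
    by (simp add: stein_sol_ge algebra_simps)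
  consider "w \<le> z" | "z \<le> v" | "v \<le> z" "z \<le> w" by linarith
  then show ?thesis
    using le[of v w] ge[of v w] le[of v z] ge[of z w] assms by cases auto
qed

text \<open>A mean value form of the Stein equation. On either side of \<open>z\<close> the
  derivative is \<open>w * stein_sol z w\<close> plus the indicator minus \<open>Phi z\<close>. The
  first term increases and the indicator decreases, so they are extremal at opposite endpoints; an
  interval around \<open>z\<close> is split there.\<close>

lemma stein_sol_diff:
  assumes "a \<le> b"
  shows "stein_sol z b - stein_sol z a \<le> (b - a) * (b * stein_sol z b + of_bool (a \<le> z) - Phi z)"
    and "(b - a) * (a * stein_sol z a + of_bool (b \<le> z) - Phi z) \<le> stein_sol z b - stein_sol z a"
proof -
  let ?f = "stein_sol z" and ?G = "\<lambda>w. w * stein_sol z w"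
  have left: "(b - a) * (?G a + 1 - Phi z) \<le> ?f b - ?f a \<and> ?f b - ?f a \<le> (b - a) * (?G b + 1 - Phi z)"
    if "a \<le> b" "b \<le> z" for a b
  proof (cases "a = b")
    case False
    then have "a < b" using that by simp
    have "((\<lambda>w. (1 - Phi z) * mills (- w)) has_real_derivative (1 - Phi z) * (x * mills (- x) + 1)) (at x)" for x
    proof -
      have "((\<lambda>w. mills (- w)) has_real_derivative (- x * mills (- x) - 1) * - 1) (at x)"
        by (rule DERIV_chain2[OF mills_deriv]) (auto intro!: derivative_eq_intros)
      from DERIV_cmult[OF this, of "1 - Phi z"] show ?thesis by (simp add: algebra_simps)
    qed
    from MVT2[OF \<open>a < b\<close> this] obtain x where x: "a < x" "x < b"
      "(1 - Phi z) * mills (- b) - (1 - Phi z) * mills (- a) = (b - a) * ((1 - Phi z) * (x * mills (- x) + 1))"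
      by auto
    then have "?f b - ?f a = (b - a) * (?G x + 1 - Phi z)"
      using that by (simp add: stein_sol_def algebra_simps)
    then show ?thesis
      using x \<open>a < b\<close> mult_stein_sol_mono[of a x z] mult_stein_sol_mono[of x b z] by simp
  qed auto
  have right: "(b - a) * (?G a - Phi z) \<le> ?f b - ?f a \<and> ?f b - ?f a \<le> (b - a) * (?G b - Phi z)"
    if "a \<le> b" "z \<le> a" for a b
  proof (cases "a = b")
    case False
    then have "a < b" using that by simp
    have "((\<lambda>w. Phi z * mills w) has_real_derivative Phi z * (x * mills x - 1)) (at x)" for x
      by (rule DERIV_cmult[OF mills_deriv])
    from MVT2[OF \<open>a < b\<close> this] obtain x where x: "a < x" "x < b"
      "Phi z * mills b - Phi z * mills a = (b - a) * (Phi z * (x * mills x - 1))"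
      by auto
    then have "?f b - ?f a = (b - a) * (?G x - Phi z)"
      using that by (simp add: stein_sol_ge algebra_simps)
    then show ?thesis
      using x \<open>a < b\<close> mult_stein_sol_mono[of a x z] mult_stein_sol_mono[of x b z] by simp
  qed auto
  consider "b \<le> z" | "z < a" | "a \<le> z" "z < b" using assms by linarith
  then have "?f b - ?f a \<le> (b - a) * (?G b + of_bool (a \<le> z) - Phi z) \<and>
    (b - a) * (?G a + of_bool (b \<le> z) - Phi z) \<le> ?f b - ?f a"
  proof cases
    case 3
    have 1: "?G a \<le> ?G z" "?G z \<le> ?G b" using mult_stein_sol_mono 3 by simp_all
    have "(z - a) * (?G z + 1 - Phi z) \<le> (z - a) * (?G b + 1 - Phi z)"
      "(b - z) * (?G b - Phi z) \<le> (b - z) * (?G b + 1 - Phi z)"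
      "(z - a) * (?G a - Phi z) \<le> (z - a) * (?G a + 1 - Phi z)"
      "(b - z) * (?G a - Phi z) \<le> (b - z) * (?G z - Phi z)"
      using 1 3 by (intro mult_left_mono; simp)+
    moreover have "(z - a) * (?G a + 1 - Phi z) \<le> ?f z - ?f a"
      "?f z - ?f a \<le> (z - a) * (?G z + 1 - Phi z)"
      "(b - z) * (?G z - Phi z) \<le> ?f b - ?f z" "?f b - ?f z \<le> (b - z) * (?G b - Phi z)"
      using left[of a z] right[of z b] 3 by auto
    ultimately have "?f b - ?f a \<le> (b - z) * (?G b + 1 - Phi z) + (z - a) * (?G b + 1 - Phi z)"
      "(b - z) * (?G a - Phi z) + (z - a) * (?G a - Phi z) \<le> ?f b - ?f a" by linarith+
    with 3 show ?thesis by (simp add: algebra_simps)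
  qed (use left[of a b] right[of a b] assms in auto)
  then show "?f b - ?f a \<le> (b - a) * (?G b + of_bool (a \<le> z) - Phi z)"
    "(b - a) * (?G a + of_bool (b \<le> z) - Phi z) \<le> ?f b - ?f a" by auto
qed

text \<open>Reversibility: the rate belongs to the pair of a state and its flip, so the two may be
  exchanged under the sum.\<close>

lemma sum_involution_swap:
  fixes c :: "'i \<Rightarrow> 'a \<Rightarrow> real"
  assumes "\<And>i s. i \<in> I \<Longrightarrow> s \<in> S \<Longrightarrow> \<phi> i s \<in> S" "\<And>i s. i \<in> I \<Longrightarrow> s \<in> S \<Longrightarrow> \<phi> i (\<phi> i s) = s"
    and "\<And>i s. i \<in> I \<Longrightarrow> s \<in> S \<Longrightarrow> c i (\<phi> i s) = c i s"
  shows "(\<Sum>s\<in>S. \<Sum>i\<in>I. c i s * \<Psi> s (\<phi> i s)) = (\<Sum>s\<in>S. \<Sum>i\<in>I. c i s * \<Psi> (\<phi> i s) s)"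
proof -
  have "(\<Sum>s\<in>S. c i s * \<Psi> s (\<phi> i s)) = (\<Sum>s\<in>S. c i s * \<Psi> (\<phi> i s) s)" if "i \<in> I" for i
    by (rule sum.reindex_bij_witness[of _ "\<phi> i" "\<phi> i"]) (use assms that in auto)
  then show ?thesis by (simp add: sum.swap[of _ I S])
qed

text \<open>Stein's method for the reversible flips \<open>\<phi> i\<close> with symmetric rates \<open>c i\<close>. Since
  \<open>w * stein_sol z w\<close> and the indicator are monotone, the second order error of a flip is bounded
  by an antisymmetric quantity, which turns it into the drift of \<open>D * \<bar>D\<bar>\<close>.\<close>
lemma stein_kolmogorov_bound:
  fixes c :: "'i \<Rightarrow> 'a \<Rightarrow> real" and p W :: "'a \<Rightarrow> real"
  assumes \<phi>: "\<And>i s. i \<in> I \<Longrightarrow> s \<in> S \<Longrightarrow> \<phi> i s \<in> S" "\<And>i s. i \<in> I \<Longrightarrow> s \<in> S \<Longrightarrow> \<phi> i (\<phi> i s) = s"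
    and c: "\<And>i s. i \<in> I \<Longrightarrow> s \<in> S \<Longrightarrow> c i (\<phi> i s) = c i s" "\<And>i s. i \<in> I \<Longrightarrow> s \<in> S \<Longrightarrow> 0 \<le> c i s"
    and l: "l > 0"
  defines "D \<equiv> \<lambda>i s. W s - W (\<phi> i s)"
  shows "\<bar>\<Sum>s\<in>S. p s * (of_bool (W s \<le> z) - Phi z)\<bar> \<le>
     2 * (\<Sum>s\<in>S. \<bar>p s - (\<Sum>i\<in>I. c i s * (D i s)\<^sup>2) / (2 * l)\<bar>)
     + mills 0 * (\<Sum>s\<in>S. \<bar>(\<Sum>i\<in>I. c i s * D i s) / l - p s * W s\<bar>)
     + 2 / l * (\<Sum>s\<in>S. \<bar>\<Sum>i\<in>I. c i s * (D i s * \<bar>D i s\<bar>)\<bar>)"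
proof -
  let ?f = "\<lambda>s. stein_sol z (W s)"
  let ?h = "\<lambda>s. of_bool (W s \<le> z) :: real"
  \<comment> \<open>\<open>g\<close> is the derivative of the Stein solution at \<open>W s\<close>.
    \<open>k\<close> is nondecreasing in \<open>W\<close>, and its increment over a flip dominates
    the variation of \<open>g\<close>.\<close>
  define k where "k = (\<lambda>s. W s * ?f s - ?h s)"
  define g where "g = (\<lambda>s. W s * ?f s + ?h s - Phi z)"
  define a where "a = (\<lambda>s. \<Sum>i\<in>I. c i s * D i s)"
  define b where "b = (\<lambda>s. \<Sum>i\<in>I. c i s * (D i s)\<^sup>2)"
  define d where "d = (\<lambda>s. \<Sum>i\<in>I. c i s * (D i s * \<bar>D i s\<bar>))"
  note swap = sum_involution_swap[of I S \<phi> c, OF \<phi> c(1)]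
  have k2: "\<bar>k s\<bar> \<le> 2" for s
    using abs_mult_stein_sol_le[of "W s" z] by (auto simp: k_def)
  have g2: "\<bar>g s\<bar> \<le> 2" for s
    using abs_mult_stein_sol_le[of "W s" z] Phi_nonneg[of z] Phi_le_1[of z] by (auto simp: g_def)
  have f0: "\<bar>?f s\<bar> \<le> mills 0" for s using stein_sol_le[of z "W s"] stein_sol_nonneg[of z "W s"] by simp
  \<comment> \<open>\<open>D\<close> changes sign under the flip, so the flipped term is minus the
    original one and the increment of \<open>f\<close> becomes twice its value. The same holds in
    the next step, as \<open>D * \<bar>D\<bar>\<close> is antisymmetric too.\<close>
  have 1: "(\<Sum>s\<in>S. \<Sum>i\<in>I. c i s * (D i s * (?f s - ?f (\<phi> i s)))) = 2 * (\<Sum>s\<in>S. ?f s * a s)"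
  proof -
    have "(\<Sum>s\<in>S. \<Sum>i\<in>I. c i s * (D i s * ?f (\<phi> i s))) = - (\<Sum>s\<in>S. \<Sum>i\<in>I. c i s * (D i s * ?f s))"
      using swap[of "\<lambda>s s'. (W s - W s') * stein_sol z (W s')"]
      unfolding D_def sum_negf[symmetric] by (simp add: algebra_simps)
    then show ?thesis
      by (simp add: a_def right_diff_distrib sum_subtractf sum_distrib_left mult_ac)
  qed
  have 2: "(\<Sum>s\<in>S. \<Sum>i\<in>I. c i s * (D i s * \<bar>D i s\<bar> * (k s - k (\<phi> i s)))) = 2 * (\<Sum>s\<in>S. k s * d s)"
  proof -
    have "(\<Sum>s\<in>S. \<Sum>i\<in>I. c i s * (D i s * \<bar>D i s\<bar> * k (\<phi> i s)))
        = - (\<Sum>s\<in>S. \<Sum>i\<in>I. c i s * (D i s * \<bar>D i s\<bar> * k s))"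
      using swap[of "\<lambda>s s'. (W s - W s') * \<bar>W s - W s'\<bar> * k s'"]
      unfolding D_def sum_negf[symmetric] by (simp add: abs_minus_commute algebra_simps)
    then show ?thesis
      by (simp add: d_def right_diff_distrib sum_subtractf sum_distrib_left mult_ac)
  qed
  \<comment> \<open>The remainder of one flip. The sign of \<open>D\<close> and that of the
    increment of \<open>k\<close> agree, so the bound is nonnegative and has the antisymmetric form
    just summed.\<close>
  have pw: "\<bar>D i s * (?f s - ?f (\<phi> i s)) - (D i s)\<^sup>2 * g s\<bar> \<le> D i s * \<bar>D i s\<bar> * (k s - k (\<phi> i s))" for i s
  proof -
    let ?s' = "\<phi> i s"
    show ?thesis
    proof (cases "W ?s' \<le> W s")
      case True
      then have D0: "0 \<le> D i s" by (simp add: D_def)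
      have m: "W ?s' * ?f ?s' \<le> W s * ?f s" "?h s \<le> ?h ?s'"
        using True by (auto intro: mult_stein_sol_mono)
      have "D i s * (?f s - ?f ?s') \<le> (D i s)\<^sup>2 * (W s * ?f s + ?h ?s' - Phi z)"
        "(D i s)\<^sup>2 * (W ?s' * ?f ?s' + ?h s - Phi z) \<le> D i s * (?f s - ?f ?s')"
        using mult_left_mono[OF stein_sol_diff(1)[OF True, of z] D0] mult_left_mono[OF stein_sol_diff(2)[OF True, of z] D0]
        by (simp_all add: D_def power2_eq_square mult.assoc)
      moreover have "(D i s)\<^sup>2 * (?h ?s' - ?h s) \<le> (D i s)\<^sup>2 * (k s - k ?s')"
        "(D i s)\<^sup>2 * (W s * ?f s - W ?s' * ?f ?s') \<le> (D i s)\<^sup>2 * (k s - k ?s')"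
        using m by (intro mult_left_mono zero_le_power2; unfold k_def; linarith)+
      moreover have "D i s * \<bar>D i s\<bar> = (D i s)\<^sup>2" using D0 by (simp add: power2_eq_square)
      ultimately show ?thesis unfolding abs_le_iff g_def by (simp only: algebra_simps) linarith
    next
      case False
      then have le: "W s \<le> W ?s'" and D0: "0 \<le> - D i s" by (auto simp: D_def)
      have m: "W s * ?f s \<le> W ?s' * ?f ?s'" "?h ?s' \<le> ?h s"
        using le by (auto intro: mult_stein_sol_mono)
      have "D i s * (?f s - ?f ?s') \<le> (D i s)\<^sup>2 * (W ?s' * ?f ?s' + ?h s - Phi z)"
        "(D i s)\<^sup>2 * (W s * ?f s + ?h ?s' - Phi z) \<le> D i s * (?f s - ?f ?s')"
        using mult_left_mono[OF stein_sol_diff(1)[OF le, of z] D0] mult_left_mono[OF stein_sol_diff(2)[OF le, of z] D0]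
        by (simp_all add: D_def power2_eq_square algebra_simps)
      moreover have "(D i s)\<^sup>2 * (?h s - ?h ?s') \<le> (D i s)\<^sup>2 * (k ?s' - k s)"
        "(D i s)\<^sup>2 * (W ?s' * ?f ?s' - W s * ?f s) \<le> (D i s)\<^sup>2 * (k ?s' - k s)"
        using m by (intro mult_left_mono zero_le_power2; unfold k_def; linarith)+
      moreover have "D i s * \<bar>D i s\<bar> = - (D i s)\<^sup>2" using D0 by (simp add: power2_eq_square)
      ultimately show ?thesis unfolding abs_le_iff g_def by (simp only: algebra_simps) linarith
    qed
  qed
  have kd: "k s * d s \<le> 2 * \<bar>d s\<bar>" for s
    using mult_right_mono[OF k2[of s], of "\<bar>d s\<bar>"] abs_ge_self[of "k s * d s"] by (simp add: abs_mult)
  define E0 where "E0 = (\<Sum>s\<in>S. \<Sum>i\<in>I. c i s * (D i s * (?f s - ?f (\<phi> i s)) - (D i s)\<^sup>2 * g s))"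
  have "\<bar>E0\<bar> \<le> (\<Sum>s\<in>S. \<Sum>i\<in>I. c i s * (D i s * \<bar>D i s\<bar> * (k s - k (\<phi> i s))))"
    unfolding E0_def
    by (intro order_trans[OF sum_abs] sum_mono order_trans[OF sum_abs])
       (simp add: abs_mult c(2) mult_left_mono[OF pw])
  also have "\<dots> \<le> 2 * (\<Sum>s\<in>S. 2 * \<bar>d s\<bar>)"
    unfolding 2
    using kd by (intro mult_left_mono sum_mono) auto
  finally have E0: "\<bar>E0\<bar> \<le> 4 * (\<Sum>s\<in>S. \<bar>d s\<bar>)" by (simp add: sum_distrib_left)
  have E0_eq: "E0 = 2 * (\<Sum>s\<in>S. ?f s * a s) - (\<Sum>s\<in>S. g s * b s)"
    unfolding 1[symmetric] E0_def
    by (simp add: b_def right_diff_distrib sum_subtractf sum_distrib_left mult_ac)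
  \<comment> \<open>The Stein equation \<open>?h s - Phi z = g s - W s * ?f s\<close>, with the
    quadratic variation \<open>b\<close> and the drift \<open>a\<close> inserted; what they leave
    over is \<open>E0\<close>.\<close>
  have "(\<Sum>s\<in>S. p s * (?h s - Phi z)) = (\<Sum>s\<in>S. g s * (p s - b s / (2 * l)))
      + (\<Sum>s\<in>S. ?f s * (a s / l - p s * W s)) - E0 / (2 * l)"
  proof -
    have "(\<Sum>s\<in>S. g s * (p s - b s / (2 * l))) + (\<Sum>s\<in>S. ?f s * (a s / l - p s * W s))
       = (\<Sum>s\<in>S. g s * p s - ?f s * (p s * W s)) - (\<Sum>s\<in>S. g s * b s) / (2 * l) + (\<Sum>s\<in>S. ?f s * a s) / l"
      by (simp add: right_diff_distrib sum_subtractf sum_divide_distrib)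
    also have "(\<Sum>s\<in>S. g s * p s - ?f s * (p s * W s)) = (\<Sum>s\<in>S. p s * (?h s - Phi z))"
      by (intro sum.cong) (auto simp: g_def algebra_simps)
    finally show ?thesis using l by (simp add: E0_eq field_simps)
  qed
  moreover have "\<bar>\<Sum>s\<in>S. g s * (p s - b s / (2 * l))\<bar> \<le> (\<Sum>s\<in>S. 2 * \<bar>p s - b s / (2 * l)\<bar>)"
    by (intro order_trans[OF sum_abs] sum_mono) (simp add: abs_mult g2 mult_right_mono)
  moreover have "\<bar>\<Sum>s\<in>S. ?f s * (a s / l - p s * W s)\<bar> \<le> (\<Sum>s\<in>S. mills 0 * \<bar>a s / l - p s * W s\<bar>)"
    by (intro order_trans[OF sum_abs] sum_mono) (simp only: abs_mult f0 mult_right_mono abs_ge_zero)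
  moreover have "\<bar>E0 / (2 * l)\<bar> \<le> 2 / l * (\<Sum>s\<in>S. \<bar>d s\<bar>)"
    using E0 l by (simp add: field_simps)
  ultimately have "\<bar>\<Sum>s\<in>S. p s * (?h s - Phi z)\<bar> \<le> 2 * (\<Sum>s\<in>S. \<bar>p s - b s / (2 * l)\<bar>)
      + mills 0 * (\<Sum>s\<in>S. \<bar>a s / l - p s * W s\<bar>) + 2 / l * (\<Sum>s\<in>S. \<bar>d s\<bar>)"
    unfolding sum_distrib_left[symmetric] by linarith
  then show ?thesis unfolding a_def b_def d_def .
qed

section \<open>Gaussian linearisation and the double well\<close>

text \<open>\<open>exp ((l s)\<^sup>2 / 2)\<close> is the standard Gaussian average of
  \<open>exp (h * l s)\<close> over \<open>h\<close>. The bound on linear exponents can be averaged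
  in the same way exactly because \<open>b < 1\<close>.\<close>

lemma hubbard_stratonovich:
  fixes w l :: "'a \<Rightarrow> real"
  assumes b: "0 \<le> b" "b < 1"
    and le: "\<And>h. (\<Sum>s\<in>S. w s * exp (h * l s)) \<le> C * exp (b * h\<^sup>2 / 2)"
  shows "(\<Sum>s\<in>S. w s * exp ((l s)\<^sup>2 / 2)) \<le> C / sqrt (1 - b)"
proof -
  define sg where "sg = 1 / sqrt (1 - b)"
  have sg: "sg > 0" "sg\<^sup>2 = 1 / (1 - b)" using b by (auto simp: sg_def power_divide)
  have e1: "std_normal_density h * exp (h * v) = exp (v\<^sup>2 / 2) * normal_density v 1 h" for h v :: real
    by (simp add: normal_density_def exp_add[symmetric] field_simps power2_eq_square)
  have e2: "std_normal_density h * exp (b * h\<^sup>2 / 2) = sg * normal_density 0 sg h" for h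
  proof -
    have "exp (- h\<^sup>2 / 2) * exp (b * h\<^sup>2 / 2) = exp (- h\<^sup>2 / (2 * sg\<^sup>2))"
      unfolding exp_add[symmetric] sg(2) using b by (simp add: field_simps)
    then show ?thesis using sg(1)
      by (simp add: normal_density_def std_normal_density_def real_sqrt_mult)
  qed
  have i1: "integrable lborel (\<lambda>h. std_normal_density h * exp (h * v))"
    "(\<integral>h. std_normal_density h * exp (h * v) \<partial>lborel) = exp (v\<^sup>2 / 2)" for v
    unfolding e1 by (auto simp: integrable_normal_density integral_normal_density)
  have i2: "integrable lborel (\<lambda>h. std_normal_density h * exp (b * h\<^sup>2 / 2))"
    "(\<integral>h. std_normal_density h * exp (b * h\<^sup>2 / 2) \<partial>lborel) = sg"
    unfolding e2 using sg by (auto simp: integrable_normal_density integral_normal_density)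
  have "(\<Sum>s\<in>S. w s * exp ((l s)\<^sup>2 / 2))
      = (\<integral>h. (\<Sum>s\<in>S. w s * (std_normal_density h * exp (h * l s))) \<partial>lborel)"
    by (simp add: i1)
  also have "\<dots> \<le> (\<integral>h. C * (std_normal_density h * exp (b * h\<^sup>2 / 2)) \<partial>lborel)"
  proof (rule integral_mono)
    fix h
    show "(\<Sum>s\<in>S. w s * (std_normal_density h * exp (h * l s)))
        \<le> C * (std_normal_density h * exp (b * h\<^sup>2 / 2))"
      using mult_left_mono[OF le[of h] normal_density_nonneg[of 0 1 h]]
      by (simp add: sum_distrib_left mult_ac)
  qed (auto intro!: Bochner_Integration.integrable_sum integrable_mult_right i1 i2)
  also have "\<dots> = C / sqrt (1 - b)" by (simp add: i2 sg_def)
  finally show ?thesis .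
qed

text \<open>Directions are linearised one at a time. The linear factors of the remaining directions
  are absorbed into the weight, so the one-dimensional case applies to each.\<close>

lemma hubbard_stratonovich_sum:
  fixes w :: "'a \<Rightarrow> real" and l :: "'k \<Rightarrow> 'a \<Rightarrow> real"
  assumes "finite L" and "\<And>k. k \<in> L \<Longrightarrow> 0 \<le> b k" and "\<And>k. k \<in> L \<Longrightarrow> b k < 1"
    and "\<And>c. (\<Sum>s\<in>S. w s * exp (\<Sum>k\<in>L. c k * l k s)) \<le> C * exp ((\<Sum>k\<in>L. b k * (c k)\<^sup>2) / 2)"
  shows "(\<Sum>s\<in>S. w s * exp ((\<Sum>k\<in>L. (l k s)\<^sup>2) / 2)) \<le> C * (\<Prod>k\<in>L. 1 / sqrt (1 - b k))"
  using assms
proof (induction L arbitrary: w C rule: finite_induct)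
  case empty
  then show ?case by simp
next
  case (insert k L)
  have upd: "(\<Sum>j\<in>L. (c(k := h)) j * l j s) = (\<Sum>j\<in>L. c j * l j s)"
    "(\<Sum>j\<in>L. b j * ((c(k := h)) j)\<^sup>2) = (\<Sum>j\<in>L. b j * (c j)\<^sup>2)" for c h s
    using insert.hyps by (auto intro!: sum.cong)
  have "(\<Sum>s\<in>S. (w s * exp ((l k s)\<^sup>2 / 2)) * exp ((\<Sum>j\<in>L. (l j s)\<^sup>2) / 2))
      \<le> (C / sqrt (1 - b k)) * (\<Prod>j\<in>L. 1 / sqrt (1 - b j))"
  proof (rule insert.IH)
    fix c
    have "(\<Sum>s\<in>S. (w s * exp (\<Sum>j\<in>L. c j * l j s)) * exp ((l k s)\<^sup>2 / 2))
        \<le> (C * exp ((\<Sum>j\<in>L. b j * (c j)\<^sup>2) / 2)) / sqrt (1 - b k)"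
    proof (rule hubbard_stratonovich)
      fix h
      have ins: "(\<Sum>j\<in>insert k L. (c(k := h)) j * l j s) = h * l k s + (\<Sum>j\<in>L. c j * l j s)"
        "(\<Sum>j\<in>insert k L. b j * ((c(k := h)) j)\<^sup>2) = b k * h\<^sup>2 + (\<Sum>j\<in>L. b j * (c j)\<^sup>2)" for s
        using insert.hyps by (simp_all only: sum.insert upd fun_upd_same not_False_eq_True)
      from insert.prems(3)[of "c(k := h)", unfolded ins]
      show "(\<Sum>s\<in>S. (w s * exp (\<Sum>j\<in>L. c j * l j s)) * exp (h * l k s))
          \<le> C * exp ((\<Sum>j\<in>L. b j * (c j)\<^sup>2) / 2) * exp (b k * h\<^sup>2 / 2)"
        by (simp add: exp_add add_divide_distrib mult_ac)
    qed (use insert.prems in auto)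
    then show "(\<Sum>s\<in>S. (w s * exp ((l k s)\<^sup>2 / 2)) * exp (\<Sum>j\<in>L. c j * l j s))
        \<le> (C / sqrt (1 - b k)) * exp ((\<Sum>j\<in>L. b j * (c j)\<^sup>2) / 2)"
      by (simp add: mult_ac)
  qed (use insert.prems in auto)
  then show ?case using insert.hyps by (simp add: exp_add add_divide_distrib mult_ac)
qed

text \<open>For small \<open>c\<close> a direction costs only \<open>exp c\<close>, so all
  directions together cost the exponential of a sum, later a multiple of the squared Frobenius
  norm.\<close>

lemma inverse_sqrt_le_exp:
  fixes c :: real
  assumes "0 \<le> c" "c \<le> 1 / 2"
  shows "1 / sqrt (1 - c) \<le> exp c"
proof -
  have "exp (- 2 * c) \<le> 1 - c"
  proof -
    have "(1 + 2 * c) * (1 - c) \<ge> 1" using assms mult_nonneg_nonneg[of c "1 - 2 * c"] by (simp add: algebra_simps)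
    moreover have "1 + 2 * c \<le> exp (2 * c)" by (rule exp_ge_add_one_self)
    ultimately have "1 \<le> exp (2 * c) * (1 - c)"
      using assms mult_right_mono[of "1 + 2 * c" "exp (2 * c)" "1 - c"] by linarith
    then show ?thesis by (simp add: exp_minus field_simps)
  qed
  then have "sqrt (exp (- 2 * c)) \<le> sqrt (1 - c)" by (rule real_sqrt_le_mono)
  moreover have "sqrt (exp (- 2 * c)) = exp (- c)"
    by (intro real_sqrt_unique) (auto simp: power2_eq_square exp_add[symmetric])
  ultimately have "exp (- c) \<le> sqrt (1 - c)" by metis
  then show ?thesis using assms by (simp add: exp_minus field_simps)
qed

text \<open>A substitute for the inequality of Hoelder: \<open>x + y\<close> is a convex combination
  of \<open>p * x\<close> and \<open>q * y\<close>, hence at most the larger of them.\<close>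

lemma exp_add_le_conjugate:
  fixes p q :: real
  assumes "1 < p" "q = p / (p - 1)"
  shows "exp (x + y) \<le> exp (p * x) + exp (q * y)"
proof (cases "y \<le> (p - 1) * x")
  case True
  then have "x + y \<le> p * x" by (simp add: algebra_simps)
  then have "exp (x + y) \<le> exp (p * x)" by simp
  then show ?thesis using exp_gt_zero[of "q * y"] by linarith
next
  case False
  then have "x \<le> y / (p - 1)" using assms by (simp add: field_simps)
  moreover have "y / (p - 1) + y = q * y" unfolding assms(2) using assms(1) by (simp add: field_simps)
  ultimately have "exp (x + y) \<le> exp (q * y)" by simp
  then show ?thesis using exp_gt_zero[of "p * x"] by linarith
qed

lemma exp_add5_le:
  fixes a b c d e :: real
  shows "exp (a + b + c + d + e) \<le> exp (5 * a) + exp (5 * b) + exp (5 * c) + exp (5 * d) + exp (5 * e)"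
proof -
  have "a + b + c + d + e \<le> 5 * a \<or> a + b + c + d + e \<le> 5 * b \<or> a + b + c + d + e \<le> 5 * c
    \<or> a + b + c + d + e \<le> 5 * d \<or> a + b + c + d + e \<le> 5 * e" by linarith
  then have "exp (a + b + c + d + e) \<le> exp (5 * a) \<or> exp (a + b + c + d + e) \<le> exp (5 * b)
    \<or> exp (a + b + c + d + e) \<le> exp (5 * c) \<or> exp (a + b + c + d + e) \<le> exp (5 * d)
    \<or> exp (a + b + c + d + e) \<le> exp (5 * e)" by simp
  then show ?thesis
    using exp_gt_zero[of "5 * a"] exp_gt_zero[of "5 * b"] exp_gt_zero[of "5 * c"]
      exp_gt_zero[of "5 * d"] exp_gt_zero[of "5 * e"] by linarith
qed

section \<open>The moment generating function of a spin and the mean-field double well\<close>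

definition bern_mgf :: "real \<Rightarrow> real \<Rightarrow> real" where
  "bern_mgf t h = (1 + t) / 2 * exp (h * (1 - t)) + (1 - t) / 2 * exp (h * (- 1 - t))"

text \<open>A spin of mean \<open>tanh v\<close> is a spin in the field \<open>v\<close>, and
  tilting by \<open>h\<close> moves the field to \<open>v + h\<close>.\<close>

lemma bern_mgf_tanh:
  "bern_mgf (tanh v) h = exp (ln (cosh (v + h)) - ln (cosh v) - h * tanh v)"
proof -
  have e: "(1 + tanh v) / 2 = exp v / (2 * cosh v)" "(1 - tanh v) / 2 = exp (- v) / (2 * cosh v)"
    using cosh_real_nonzero[of v] by (simp_all add: tanh_def field_simps cosh_plus_sinh cosh_minus_sinh)
  have "bern_mgf (tanh v) h = exp (- h * tanh v) * ((exp (v + h) + exp (- (v + h))) / 2) / cosh v"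
    unfolding bern_mgf_def e using cosh_real_nonzero[of v]
    by (simp add: exp_add exp_diff exp_minus field_simps)
  also have "\<dots> = exp (- h * tanh v) * (cosh (v + h) / cosh v)"
    unfolding cosh_def[of "v + h"] by simp
  also have "cosh (v + h) / cosh v = exp (ln (cosh (v + h)) - ln (cosh v))"
    by (simp add: exp_diff cosh_real_pos)
  finally show ?thesis by (simp add: exp_add[symmetric] algebra_simps)
qed

lemma ln_cosh_deriv: "((\<lambda>x :: real. ln (cosh x)) has_real_derivative tanh x) (at x)"
  using cosh_real_pos[of x] by (auto intro!: derivative_eq_intros simp: tanh_def)

lemma tanh_deriv: "(tanh has_real_derivative 1 - (tanh x)\<^sup>2) (at (x :: real))"
  by (rule derivative_eq_intros | simp add: cosh_real_nonzero)+

lemma tanh_diff_le: "x \<le> y \<Longrightarrow> tanh y - tanh x \<le> y - (x :: real)"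
proof -
  assume "x \<le> y"
  then have "x - tanh x \<le> y - tanh y"
  proof (rule DERIV_nonneg_imp_nondecreasing)
    fix z :: real
    have "((\<lambda>z. z - tanh z) has_real_derivative (tanh z)\<^sup>2) (at z)"
      by (rule derivative_eq_intros tanh_deriv refl)+ simp
    then show "\<exists>y. ((\<lambda>z. z - tanh z) has_real_derivative y) (at z) \<and> 0 \<le> y" by auto
  qed
  then show ?thesis by simp
qed

lemma tanh_lipschitz: "\<bar>tanh x - tanh y\<bar> \<le> \<bar>x - y\<bar>" for x y :: real
  using tanh_diff_le[of x y] tanh_diff_le[of y x] tanh_real_le_iff[of x y] tanh_real_le_iff[of y x]
  by (cases "x \<le> y") (auto simp: abs_real_def)

text \<open>The constant 2 is a Lipschitz constant of the square of tanh, which governs the change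
  of the derivative.\<close>

lemma tanh_scaled_taylor:
  fixes b x y :: real
  shows "\<bar>tanh (b * x) - tanh (b * y) - b * (1 - (tanh (b * y))\<^sup>2) * (x - y)\<bar> \<le> 2 * b\<^sup>2 * (x - y)\<^sup>2"
proof -
  have main: "\<bar>tanh x - tanh y - (1 - (tanh y)\<^sup>2) * (x - y)\<bar> \<le> 2 * (x - y)\<^sup>2" for x y :: real
  proof -
    obtain z where z: "\<bar>z - y\<bar> \<le> \<bar>x - y\<bar>" "tanh x - tanh y = (1 - (tanh z)\<^sup>2) * (x - y)"
    proof (cases x y rule: linorder_cases)
      case less
      from MVT2[OF less, of tanh "\<lambda>z. 1 - (tanh z)\<^sup>2"] tanh_deriv obtain z
        where "x < z" "z < y" "tanh y - tanh x = (y - x) * (1 - (tanh z)\<^sup>2)" by auto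
      then show ?thesis by (intro that[of z]) (auto simp: algebra_simps)
    next
      case greater
      from MVT2[OF greater, of tanh "\<lambda>z. 1 - (tanh z)\<^sup>2"] tanh_deriv obtain z
        where "y < z" "z < x" "tanh x - tanh y = (x - y) * (1 - (tanh z)\<^sup>2)" by auto
      then show ?thesis by (intro that[of z]) (auto simp: algebra_simps)
    qed (auto intro: that[of x])
    have "\<bar>(tanh y)\<^sup>2 - (tanh z)\<^sup>2\<bar> = \<bar>tanh y + tanh z\<bar> * \<bar>tanh z - tanh y\<bar>"
      by (simp add: abs_mult[symmetric] power2_eq_square algebra_simps abs_minus_commute)
    also have "\<dots> \<le> 2 * \<bar>x - y\<bar>"
      using tanh_real_bounds[of y] tanh_real_bounds[of z] tanh_lipschitz[of z y] z(1)
      by (intro mult_mono) (auto simp: abs_le_iff)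
    finally have "\<bar>(tanh y)\<^sup>2 - (tanh z)\<^sup>2\<bar> * \<bar>x - y\<bar> \<le> 2 * \<bar>x - y\<bar> * \<bar>x - y\<bar>" by (rule mult_right_mono) simp
    moreover have "tanh x - tanh y - (1 - (tanh y)\<^sup>2) * (x - y) = ((tanh y)\<^sup>2 - (tanh z)\<^sup>2) * (x - y)"
      unfolding z(2) by (simp add: algebra_simps)
    ultimately show ?thesis by (simp add: abs_mult power2_eq_square)
  qed
  have e1: "b * (1 - (tanh (b * y))\<^sup>2) * (x - y) = (1 - (tanh (b * y))\<^sup>2) * (b * x - b * y)"
    by (simp add: algebra_simps)
  have e2: "2 * b\<^sup>2 * (x - y)\<^sup>2 = 2 * (b * x - b * y)\<^sup>2"
    by (simp add: power2_eq_square algebra_simps)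
  show ?thesis unfolding e1 e2 by (rule main)
qed

lemma min_at_sign_change:
  fixes g :: "real \<Rightarrow> real"
  assumes D: "\<And>x. (g has_real_derivative g' x) (at x)"
    and "\<And>x. x \<le> c \<Longrightarrow> x \<ge> a \<Longrightarrow> g' x \<le> 0" "\<And>x. c \<le> x \<Longrightarrow> 0 \<le> g' x" and "a \<le> x"
  shows "g c \<le> g x"
proof (cases "x \<le> c")
  case True
  then show ?thesis by (rule DERIV_nonpos_imp_nonincreasing) (use assms in fastforce)
next
  case False
  then have "c \<le> x" by simp
  then show ?thesis by (rule DERIV_nonneg_imp_nondecreasing) (use assms in fastforce)
qed

text \<open>Variance proxy 1: the derivative of the difference of the exponents has the sign of its
  argument because tanh is 1-Lipschitz. This coarse bound is enough wherever the coefficients are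
  small.\<close>

lemma bern_mgf_le: "bern_mgf (tanh v) h \<le> exp (h\<^sup>2 / 2)"
proof -
  let ?g = "\<lambda>h. h\<^sup>2 / 2 - (ln (cosh (v + h)) - ln (cosh v) - h * tanh v)"
  have "?g 0 \<le> ?g h"
  proof (rule min_at_sign_change[where a = "min 0 h" and g = ?g and g' = "\<lambda>x. x - (tanh (v + x) - tanh v)"])
    fix x
    have "((\<lambda>h. ln (cosh (v + h))) has_real_derivative tanh (v + x) * (0 + 1)) (at x)"
      by (rule DERIV_chain2[OF ln_cosh_deriv]) (intro derivative_intros)
    moreover have "((\<lambda>h. h\<^sup>2 / 2) has_real_derivative x) (at x)"
      "((\<lambda>h. h * tanh v) has_real_derivative tanh v) (at x)"
      by (auto intro!: derivative_eq_intros)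
    ultimately show "(?g has_real_derivative (x - (tanh (v + x) - tanh v))) (at x)"
      using DERIV_diff[OF _ DERIV_diff[OF DERIV_diff[OF _ DERIV_const]]] by fastforce
    show "x \<le> 0 \<Longrightarrow> x - (tanh (v + x) - tanh v) \<le> 0" using tanh_diff_le[of "v + x" v] by simp
    show "0 \<le> x \<Longrightarrow> 0 \<le> x - (tanh (v + x) - tanh v)" using tanh_diff_le[of v "v + x"] by simp
  qed auto
  then show ?thesis unfolding bern_mgf_tanh by simp
qed

context
  fixes \<beta> t :: real
  assumes \<beta>: "1 < \<beta>" and t: "0 < t" "t = tanh (\<beta> * t)"
begin

text \<open>The doubling formula at half the fixed point gives
  \<open>t / 2 = y / (1 + y\<^sup>2)\<close>, which is less than \<open>y\<close>. This is the
  strictness from which the other gaps are derived.\<close>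

lemma tanh_half_gap: "t / 2 < tanh (\<beta> * (t / 2))"
proof -
  define y where "y = tanh (\<beta> * (t / 2))"
  have y: "0 < y" using \<beta> t(1) by (simp add: y_def)
  have "t = tanh (\<beta> * (t / 2) + \<beta> * (t / 2))" using t(2) by simp
  also have "\<dots> = 2 * y / (1 + y\<^sup>2)"
    unfolding y_def by (subst tanh_add) (auto simp: cosh_real_nonzero power2_eq_square)
  finally have "t = 2 * (y / (1 + y\<^sup>2))" by simp
  then have "t / 2 = y / (1 + y\<^sup>2)" by linarith
  also have "\<dots> < y" using y by (simp add: field_simps power2_eq_square add_pos_pos)
  finally show ?thesis by (simp add: y_def)
qed

lemma tanh_scaled_deriv: "((\<lambda>x. tanh (\<beta> * x)) has_real_derivative \<beta> * (1 - (tanh (\<beta> * x))\<^sup>2)) (at x)"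
proof -
  have "((\<lambda>x. tanh (\<beta> * x)) has_real_derivative (1 - (tanh (\<beta> * x))\<^sup>2) * \<beta>) (at x)"
    by (rule DERIV_chain2[OF tanh_deriv]) (auto intro!: derivative_eq_intros)
  then show ?thesis by (simp add: mult.commute)
qed

lemma tanh_scaled_convex: "convex_on {0..} (\<lambda>x. - tanh (\<beta> * x))"
proof (rule convex_on_realI)
  show "((\<lambda>x. - tanh (\<beta> * x)) has_real_derivative - (\<beta> * (1 - (tanh (\<beta> * x))\<^sup>2))) (at x)" for x
    by (rule derivative_intros tanh_scaled_deriv)+
  show "- (\<beta> * (1 - (tanh (\<beta> * x))\<^sup>2)) \<le> - (\<beta> * (1 - (tanh (\<beta> * y))\<^sup>2))"
    if "x \<in> {0..}" "y \<in> {0..}" "x \<le> y" for x y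
    using that \<beta> by (auto intro!: mult_left_mono power_mono simp: tanh_real_le_iff)
qed auto

lemma tanh_tangent:
  assumes "0 \<le> x" "0 \<le> y"
  shows "tanh (\<beta> * y) \<le> tanh (\<beta> * x) + \<beta> * (1 - (tanh (\<beta> * x))\<^sup>2) * (y - x)"
proof -
  \<comment> \<open>The point 0 is not interior to the half line of convexity; there the claim is
    just tanh z \<le> z.\<close>
  have "- tanh (\<beta> * y) - (- tanh (\<beta> * x)) \<ge> - (\<beta> * (1 - (tanh (\<beta> * x))\<^sup>2)) * (y - x)"
  proof (cases "x = 0")
    case False
    show ?thesis
      by (rule convex_on_imp_above_tangent[OF tanh_scaled_convex])
         (use False assms in \<open>auto intro!: derivative_intros has_field_derivative_at_within[OF tanh_scaled_deriv]\<close>)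
  next
    case True
    have "tanh (\<beta> * y) - tanh 0 \<le> \<beta> * y - 0"
      by (rule tanh_diff_le) (use assms \<beta> in auto)
    then show ?thesis using True by simp
  qed
  then show ?thesis by (simp add: algebra_simps)
qed

text \<open>The tangent at \<open>t\<close> lies above the graph at \<open>t / 2\<close>, where the
  graph is strictly above the diagonal. The gap is the restoring rate of the dynamics and makes the
  limiting variance positive.\<close>

lemma slope_lt_1: "\<beta> * (1 - t\<^sup>2) < 1"
proof -
  have "tanh (\<beta> * (t / 2)) \<le> t + \<beta> * (1 - t\<^sup>2) * (t / 2 - t)"
    using tanh_tangent[of t "t / 2"] t by simp
  with tanh_half_gap have "t / 2 < t + \<beta> * (1 - t\<^sup>2) * (t / 2 - t)" by linarith
  then have "t * (\<beta> * (1 - t\<^sup>2)) < t * 1" by (simp add: algebra_simps)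
  then show ?thesis using t(1) by (simp only: mult_less_cancel_left_pos)
qed

lemma t_lt_1: "t < 1" using t(2) tanh_real_lt_1[of "\<beta> * t"] by simp

text \<open>The Curie-Weiss free energy after Gaussian linearisation, an even double well with
  minima at \<open>t\<close> and \<open>- t\<close>.\<close>

definition well :: "real \<Rightarrow> real" where "well m = \<beta> * m\<^sup>2 / 2 - ln (cosh (\<beta> * m))"

lemma well_deriv: "(well has_real_derivative \<beta> * (m - tanh (\<beta> * m))) (at m)"
proof -
  have D: "((\<lambda>m. ln (cosh (\<beta> * m))) has_real_derivative tanh (\<beta> * m) * \<beta>) (at m)"
    by (rule DERIV_chain2[OF ln_cosh_deriv]) (auto intro!: derivative_eq_intros)
  have "((\<lambda>m. \<beta> * m\<^sup>2 / 2) has_real_derivative \<beta> * m) (at m)"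
    by (auto intro!: derivative_eq_intros)
  from DERIV_diff[OF this D] show ?thesis unfolding well_def[abs_def]
    by (simp add: algebra_simps)
qed

text \<open>Quadratic growth away from the wells. For nonnegative \<open>m\<close> there are three
  ranges: above \<open>t\<close> the tangent at \<open>t\<close> bounds the derivative, between
  \<open>t / 2\<close> and \<open>t\<close> a chord does, and below \<open>t / 2\<close> the well is
  decreasing. Evenness gives the rest.\<close>

lemma well_gap: "\<exists>\<kappa>>0. \<forall>m. \<kappa> * min ((m - t)\<^sup>2) ((m + t)\<^sup>2) \<le> well m - well t"
proof -
  define q0 where "q0 = tanh (\<beta> * (t / 2)) - t / 2"
  have q0: "q0 > 0" using tanh_half_gap by (simp add: q0_def)
  \<comment> \<open>The slopes of \<open>x - tanh (\<beta> * x)\<close> supplied by the chord and by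
    the tangent, times \<beta> and halved because the derivative of \<open>(m - t)\<^sup>2\<close>
    is \<open>2 * (m - t)\<close>.\<close>
  define k where "k = min (\<beta> * (q0 / t)) (\<beta> * (1 - \<beta> * (1 - t\<^sup>2)) / 2)"
  have k: "k > 0" "2 * k \<le> \<beta> * (2 * q0 / t)" "2 * k \<le> \<beta> * (1 - \<beta> * (1 - t\<^sup>2))"
  proof -
    show "k > 0" using \<beta> t(1) q0 slope_lt_1 by (simp add: k_def)
    have "k \<le> \<beta> * (q0 / t)" unfolding k_def by (rule min.cobounded1)
    then have "2 * k \<le> 2 * (\<beta> * (q0 / t))" by simp
    also have "\<dots> = \<beta> * (2 * q0 / t)" by simp
    finally show "2 * k \<le> \<beta> * (2 * q0 / t)" .
    have "k \<le> \<beta> * (1 - \<beta> * (1 - t\<^sup>2)) / 2" unfolding k_def by (rule min.cobounded2)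
    then show "2 * k \<le> \<beta> * (1 - \<beta> * (1 - t\<^sup>2))" by simp
  qed
  have chord: "2 * q0 / t * (t - x) \<le> tanh (\<beta> * x) - x" if "t / 2 \<le> x" "x \<le> t" for x
  proof -
    define r where "r = 2 * (t - x) / t"
    have r: "0 \<le> r" "r \<le> 1" using that t by (auto simp: r_def field_simps)
    have xr: "x = (1 - r) * t + r * (t / 2)" using t by (simp add: r_def field_simps)
    have "- tanh (\<beta> * x) \<le> (1 - r) * (- tanh (\<beta> * t)) + r * (- tanh (\<beta> * (t / 2)))"
      using convex_onD[OF tanh_scaled_convex, of r t "t / 2"] r t that unfolding xr by simp
    then have "(1 - r) * t + r * tanh (\<beta> * (t / 2)) \<le> tanh (\<beta> * x)" using t(2) by simp
    moreover have "(1 - r) * t + r * tanh (\<beta> * (t / 2)) - x = r * q0"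
      by (simp add: q0_def xr algebra_simps)
    ultimately show ?thesis by (simp add: r_def mult_ac)
  qed
  let ?g = "\<lambda>m. well m - k * (m - t)\<^sup>2"
  have right: "k * (m - t)\<^sup>2 \<le> well m - well t" if "t / 2 \<le> m" for m
  proof -
    have "?g t \<le> ?g m"
    proof (rule min_at_sign_change[where a = "t / 2" and g = ?g
          and g' = "\<lambda>x. \<beta> * (x - tanh (\<beta> * x)) - 2 * k * (x - t)" and c = t and x = m])
      fix x
      show "(?g has_real_derivative \<beta> * (x - tanh (\<beta> * x)) - 2 * k * (x - t)) (at x)"
        by (auto intro!: derivative_eq_intros well_deriv)
      show "\<beta> * (x - tanh (\<beta> * x)) - 2 * k * (x - t) \<le> 0" if "x \<le> t" "t / 2 \<le> x"
      proof -
        have "\<beta> * (2 * q0 / t * (t - x)) \<le> \<beta> * (tanh (\<beta> * x) - x)"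
          using chord[OF that(2,1)] \<beta> by (intro mult_left_mono) auto
        moreover have "2 * k * (t - x) \<le> \<beta> * (2 * q0 / t) * (t - x)"
          using k that by (intro mult_right_mono) auto
        ultimately show ?thesis by (simp add: algebra_simps)
      qed
      show "0 \<le> \<beta> * (x - tanh (\<beta> * x)) - 2 * k * (x - t)" if "t \<le> x"
      proof -
        have "tanh (\<beta> * x) \<le> t + \<beta> * (1 - t\<^sup>2) * (x - t)"
          using tanh_tangent[of t x] t that by simp
        then have "(1 - \<beta> * (1 - t\<^sup>2)) * (x - t) \<le> x - tanh (\<beta> * x)" by (simp add: algebra_simps)
        from mult_left_mono[OF this, of \<beta>] \<beta>
        have "\<beta> * (1 - \<beta> * (1 - t\<^sup>2)) * (x - t) \<le> \<beta> * (x - tanh (\<beta> * x))" by (simp add: mult.assoc)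
        moreover have "2 * k * (x - t) \<le> \<beta> * (1 - \<beta> * (1 - t\<^sup>2)) * (x - t)"
          using k that by (intro mult_right_mono) auto
        ultimately show ?thesis by linarith
      qed
    qed (use that in auto)
    then show ?thesis by simp
  qed
  \<comment> \<open>Below \<open>t / 2\<close> only the value at \<open>t / 2\<close> is used, so
    \<open>t\<^sup>2\<close> has to be compared with \<open>(t / 2)\<^sup>2\<close>; hence the loss
    of 4.\<close>
  have nn: "k / 4 * (m - t)\<^sup>2 \<le> well m - well t" if "0 \<le> m" for m
  proof (cases "t / 2 \<le> m")
    case True
    have "k / 4 * (m - t)\<^sup>2 \<le> k * (m - t)\<^sup>2" using k by (intro mult_right_mono) auto
    with right[OF True] show ?thesis by simp
  next
    case False
    have "well (t / 2) \<le> well m"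
    proof (rule DERIV_nonpos_imp_nonincreasing[where f = well and a = m and b = "t / 2"])
      show "m \<le> t / 2" using False by simp
      fix x assume x: "m \<le> x" "x \<le> t / 2"
      define r where "r = x / (t / 2)"
      have r: "0 \<le> r" "r \<le> 1" "x = (1 - r) * 0 + r * (t / 2)" using x that t by (auto simp: r_def)
      have "- tanh (\<beta> * x) \<le> (1 - r) * (- tanh (\<beta> * 0)) + r * (- tanh (\<beta> * (t / 2)))"
        using convex_onD[OF tanh_scaled_convex, of r 0 "t / 2"] r(1,2) t by (simp add: r(3))
      also have "\<dots> \<le> - r * (t / 2)" using mult_left_mono[of "t / 2" "tanh (\<beta> * (t / 2))" r] tanh_half_gap r by simp
      finally have "x \<le> tanh (\<beta> * x)" using r(3) by linarith
      then show "\<exists>y. (well has_real_derivative y) (at x) \<and> y \<le> 0"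
        using well_deriv[of x] \<beta> by (intro exI[of _ "\<beta> * (x - tanh (\<beta> * x))"]) (auto intro: mult_nonneg_nonpos)
    qed
    moreover have "k * (t / 2 - t)\<^sup>2 \<le> well (t / 2) - well t" using right[of "t / 2"] by simp
    moreover have "k / 4 * (m - t)\<^sup>2 \<le> k / 4 * t\<^sup>2"
    proof (rule mult_left_mono)
      have "(t - m)\<^sup>2 \<le> t\<^sup>2" using that False t by (intro power_mono) auto
      then show "(m - t)\<^sup>2 \<le> t\<^sup>2" by (simp add: power2_commute)
    qed (use k in auto)
    ultimately show ?thesis by (simp add: power2_eq_square field_simps)
  qed
  have even: "well (- m) = well m" for m by (simp add: well_def)
  show ?thesis
  proof (intro exI[of _ "k / 4"] conjI allI)
    fix m
    show "k / 4 * min ((m - t)\<^sup>2) ((m + t)\<^sup>2) \<le> well m - well t"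
    proof (cases "0 \<le> m")
      case True
      have "k / 4 * min ((m - t)\<^sup>2) ((m + t)\<^sup>2) \<le> k / 4 * (m - t)\<^sup>2" using k by (intro mult_left_mono) auto
      with nn[OF True] show ?thesis by simp
    next
      case False
      have "k / 4 * min ((m - t)\<^sup>2) ((m + t)\<^sup>2) \<le> k / 4 * (- m - t)\<^sup>2"
        using k by (intro mult_left_mono) (auto simp: power2_eq_square algebra_simps)
      with nn[of "- m"] False show ?thesis by (simp add: even)
    qed
  qed (use k in simp)
qed

text \<open>The tilt by \<open>\<beta> * y\<close> moves the field from \<open>\<beta> * t\<close>
  to \<open>\<beta> * (t + y)\<close>, so the deficit from the Gaussian exponent is exactly
  \<open>well (t + y) - well t\<close>. It vanishes only at \<open>y = 0\<close> and
  \<open>y = - 2 * t\<close>.\<close>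

lemma bern_mgf_fine:
  "\<exists>\<kappa>>0. \<forall>y. bern_mgf t (\<beta> * y) \<le> exp (\<beta> * y\<^sup>2 / 2 - \<kappa> * min (y\<^sup>2) ((y + 2 * t)\<^sup>2))"
proof -
  obtain k where k: "k > 0" "\<And>m. k * min ((m - t)\<^sup>2) ((m + t)\<^sup>2) \<le> well m - well t"
    using well_gap by blast
  have "bern_mgf t (\<beta> * y) \<le> exp (\<beta> * y\<^sup>2 / 2 - k * min (y\<^sup>2) ((y + 2 * t)\<^sup>2))" for y
  proof -
    have "bern_mgf t (\<beta> * y) = bern_mgf (tanh (\<beta> * t)) (\<beta> * y)" using t(2) by simp
    also have "\<dots> = exp (ln (cosh (\<beta> * (t + y))) - ln (cosh (\<beta> * t)) - \<beta> * y * t)"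
      unfolding bern_mgf_tanh using t(2) by (simp add: algebra_simps)
    also have "\<dots> = exp (\<beta> * y\<^sup>2 / 2 - (well (t + y) - well t))"
      by (simp add: well_def power2_eq_square algebra_simps)
    also have "\<dots> \<le> exp (\<beta> * y\<^sup>2 / 2 - k * min (y\<^sup>2) ((y + 2 * t)\<^sup>2))"
      using k(2)[of "t + y"] by (simp add: add.commute add.left_commute)
    finally show ?thesis .
  qed
  with k(1) show ?thesis by blast
qed

end

section \<open>Independent spins\<close>

text \<open>Extensional functions instead of vectors: sums of products over sites factorise by
  \<open>prod_sum_PiE\<close>, and a spin flip is a function update. \<open>sum_spin_configs\<close>
  translates back.\<close>

definition cube :: "nat \<Rightarrow> (nat \<Rightarrow> real) set" where
  "cube N = (\<Pi>\<^sub>E i\<in>{..<N}. {-1, 1})"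

definition bern :: "nat \<Rightarrow> real \<Rightarrow> (nat \<Rightarrow> real) \<Rightarrow> real" where
  "bern N t s = (\<Prod>i<N. (1 + t * s i) / 2)"

definition flip :: "nat \<Rightarrow> (nat \<Rightarrow> real) \<Rightarrow> nat \<Rightarrow> real" where
  "flip i s = s(i := - s i)"

lemma finite_cube: "finite (cube N)"
  unfolding cube_def by (intro finite_PiE) auto

lemma cube_val: "s \<in> cube N \<Longrightarrow> i < N \<Longrightarrow> s i = - 1 \<or> s i = 1"
  by (auto simp: cube_def PiE_iff)

lemma flip_cube: "s \<in> cube N \<Longrightarrow> i < N \<Longrightarrow> flip i s \<in> cube N"
  by (auto simp: cube_def PiE_iff flip_def extensional_def)

lemma flip_flip [simp]: "flip i (flip i s) = s"
  by (simp add: flip_def)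

lemma flip_same [simp]: "flip i s i = - s i" and flip_other: "j \<noteq> i \<Longrightarrow> flip i s j = s j"
  by (simp_all add: flip_def)

lemma bern_nonneg:
  assumes "\<bar>t\<bar> \<le> 1" "s \<in> cube N"
  shows "0 \<le> bern N t s"
  unfolding bern_def using cube_val[OF assms(2)] assms(1) by (intro prod_nonneg) fastforce

lemma sum_bern_prod:
  "(\<Sum>s\<in>cube N. bern N t s * (\<Prod>i<N. f i (s i))) = (\<Prod>i<N. (1 + t) / 2 * f i 1 + (1 - t) / 2 * f i (- 1))"
proof -
  have "(\<Sum>s\<in>cube N. bern N t s * (\<Prod>i<N. f i (s i))) = (\<Sum>s\<in>cube N. \<Prod>i<N. (1 + t * s i) / 2 * f i (s i))"
    by (simp only: bern_def prod.distrib)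
  also have "\<dots> = (\<Prod>i<N. \<Sum>v\<in>{-1, 1}. (1 + t * v) / 2 * f i v)"
    unfolding cube_def by (rule prod_sum_PiE[symmetric]) auto
  finally show ?thesis by (simp add: add.commute)
qed

lemma sum_bern: "(\<Sum>s\<in>cube N. bern N t s) = 1"
  using sum_bern_prod[of N t "\<lambda>_ _. 1"] by (simp add: add_divide_distrib[symmetric])

lemma sum_bern_single:
  assumes "i < N"
  shows "(\<Sum>s\<in>cube N. bern N t s * f (s i)) = (1 + t) / 2 * f 1 + (1 - t) / 2 * f (- 1)"
proof -
  have "(\<Prod>k<N. if k = i then f (s k) else 1) = f (s i)" for s :: "nat \<Rightarrow> real"
    using assms by (simp add: prod.delta)
  moreover have "(\<Prod>k<N. (1 + t) / 2 * (if k = i then f 1 else 1) + (1 - t) / 2 * (if k = i then f (- 1) else 1))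
      = (\<Prod>k<N. if k = i then (1 + t) / 2 * f 1 + (1 - t) / 2 * f (- 1) else 1)"
    by (intro prod.cong) (auto simp: field_simps)
  ultimately show ?thesis
    using sum_bern_prod[of N t "\<lambda>k v. if k = i then f v else 1"] assms by simp
qed

lemma sum_bern_pair:
  assumes "i < N" "j < N" "i \<noteq> j"
  shows "(\<Sum>s\<in>cube N. bern N t s * (f (s i) * g (s j)))
    = ((1 + t) / 2 * f 1 + (1 - t) / 2 * f (- 1)) * ((1 + t) / 2 * g 1 + (1 - t) / 2 * g (- 1))"
proof -
  let ?F = "\<lambda>k v. if k = i then f v else if k = j then g v else 1"
  have pr: "(\<Prod>k<N. if k = i then a else if k = j then b else 1) = a * b" for a b :: real
  proof -
    have "(\<Prod>k<N. if k = i then a else if k = j then b else 1)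
        = (\<Prod>k<N. (if k = i then a else 1) * (if k = j then b else 1))"
      using assms by (intro prod.cong) auto
    then show ?thesis using assms by (simp add: prod.distrib)
  qed
  have "(\<Prod>k<N. ?F k (s k)) = f (s i) * g (s j)" for s :: "nat \<Rightarrow> real"
    using pr[of "f (s i)" "g (s j)"] by (simp cong: if_cong)
  moreover have "(\<Prod>k<N. (1 + t) / 2 * ?F k 1 + (1 - t) / 2 * ?F k (- 1))
      = (\<Prod>k<N. if k = i then (1 + t) / 2 * f 1 + (1 - t) / 2 * f (- 1)
          else if k = j then (1 + t) / 2 * g 1 + (1 - t) / 2 * g (- 1) else 1)"
    by (intro prod.cong) (auto simp: field_simps)
  ultimately show ?thesis using sum_bern_prod[of N t ?F] by (simp add: pr)
qed

lemma sum_bern_exp: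
  "(\<Sum>s\<in>cube N. bern N t s * exp (\<Sum>i<N. h i * (s i - t))) = (\<Prod>i<N. bern_mgf t (h i))"
proof -
  have "exp (\<Sum>i<N. h i * (s i - t)) = (\<Prod>i<N. exp (h i * (s i - t)))" for s :: "nat \<Rightarrow> real"
    by (simp add: exp_sum)
  then show ?thesis
    using sum_bern_prod[of N t "\<lambda>i v. exp (h i * (v - t))"] by (simp add: bern_mgf_def)
qed

lemma sum_bern_exp_le:
  "(\<Sum>s\<in>cube N. bern N (tanh v) s * exp (\<Sum>i<N. h i * (s i - tanh v))) \<le> exp ((\<Sum>i<N. (h i)\<^sup>2) / 2)"
proof -
  have nn: "0 \<le> bern_mgf (tanh v) x" for x unfolding bern_mgf_tanh by simp
  have "exp ((\<Sum>i<N. (h i)\<^sup>2) / 2) = (\<Prod>i<N. exp ((h i)\<^sup>2 / 2))"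
    by (simp add: exp_sum sum_divide_distrib)
  note eq = this
  show ?thesis
    unfolding sum_bern_exp eq
    by (intro prod_mono) (auto simp: nn bern_mgf_le)
qed

text \<open>The coefficients \<open>Y\<close> do not depend on the spins in \<open>I\<close>, so
  these are integrated out one by one, each at proxy 1. Pairing a configuration with its flip at
  \<open>k\<close> plays the role of conditioning on all other spins.\<close>

lemma sum_bern_exp_conditional:
  assumes "finite I" "I \<subseteq> {..<N}"
    and "\<And>i j s. i \<in> I \<Longrightarrow> j \<in> I \<Longrightarrow> Y i (flip j s) = Y i s"
    and "\<And>j s. j \<in> I \<Longrightarrow> Z (flip j s) = Z s"
  shows "(\<Sum>s\<in>cube N. bern N (tanh v) s * exp ((\<Sum>i\<in>I. Y i s * (s i - tanh v)) + Z s))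
    \<le> (\<Sum>s\<in>cube N. bern N (tanh v) s * exp ((\<Sum>i\<in>I. (Y i s)\<^sup>2) / 2 + Z s))"
  using assms
proof (induction I arbitrary: Z rule: finite_induct)
  case empty
  then show ?case by simp
next
  case (insert k I)
  let ?t = "tanh v"
  have abs_t_le_1: "\<bar>?t\<bar> \<le> 1" using tanh_real_bounds[of v] by auto
  let ?Z = "\<lambda>s. (\<Sum>i\<in>I. Y i s * (s i - ?t)) + Z s"
  let ?G = "\<lambda>s. bern N ?t s * exp (Y k s * (s k - ?t) + ?Z s)"
  let ?H = "\<lambda>s. bern N ?t s * exp ((Y k s)\<^sup>2 / 2 + ?Z s)"
  have k: "k < N" using insert.prems by auto
  have half: "(\<Sum>s\<in>cube N. F s) = (\<Sum>s\<in>cube N. F s + F (flip k s)) / 2" for F :: "(nat \<Rightarrow> real) \<Rightarrow> real"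
  proof -
    have "(\<Sum>s\<in>cube N. F (flip k s)) = (\<Sum>s\<in>cube N. F s)"
      by (rule sum.reindex_bij_witness[of _ "flip k" "flip k"]) (use k flip_cube in auto)
    then show ?thesis by (simp add: sum.distrib)
  qed
  have pair: "?G s + ?G (flip k s) \<le> ?H s + ?H (flip k s)" if s: "s \<in> cube N" for s
  proof -
    define R where "R = (\<Prod>i\<in>{..<N} - {k}. (1 + ?t * s i) / 2)"
    have R: "bern N ?t s = (1 + ?t * s k) / 2 * R" "bern N ?t (flip k s) = (1 - ?t * s k) / 2 * R"
      unfolding bern_def R_def using k
      by (subst prod.remove[of _ k]; auto simp: flip_other intro!: prod.cong)+
    have R0: "0 \<le> R" unfolding R_def using cube_val[OF s] abs_t_le_1 by (intro prod_nonneg) fastforce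
    have Zk: "?Z (flip k s) = ?Z s"
    proof -
      have "flip k s i = s i" if "i \<in> I" for i using flip_other insert.hyps that by metis
      then show ?thesis using insert.prems by simp
    qed
    have Yk: "Y k (flip k s) = Y k s" using insert.prems(2) by auto
    have "?G s + ?G (flip k s) = R * exp (?Z s) * bern_mgf ?t (Y k s)"
      unfolding R Zk Yk flip_same bern_mgf_def using cube_val[OF s k]
      by (auto simp: exp_add exp_diff exp_minus field_simps)
    also have "\<dots> \<le> R * exp (?Z s) * exp ((Y k s)\<^sup>2 / 2)"
      using R0 by (intro mult_left_mono bern_mgf_le) auto
    also have "\<dots> = ?H s + ?H (flip k s)"
      unfolding R Zk Yk exp_add[of "(Y k s)\<^sup>2 / 2"] by (simp add: field_simps)
    finally show ?thesis .
  qed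
  have "(\<Sum>s\<in>cube N. ?G s) \<le> (\<Sum>s\<in>cube N. ?H s)"
    by (subst (1 2) half) (intro divide_right_mono sum_mono pair; simp)
  also have "\<dots> = (\<Sum>s\<in>cube N. bern N ?t s * exp ((\<Sum>i\<in>I. Y i s * (s i - ?t)) + ((Y k s)\<^sup>2 / 2 + Z s)))"
    by (simp add: add_ac)
  also have "\<dots> \<le> (\<Sum>s\<in>cube N. bern N ?t s * exp ((\<Sum>i\<in>I. (Y i s)\<^sup>2) / 2 + ((Y k s)\<^sup>2 / 2 + Z s)))"
    by (rule insert.IH) (use insert.prems in auto)
  finally show ?case using insert.hyps by (simp add: add_ac add_divide_distrib)
qed

lemma exp_average_le:
  fixes X :: "'a \<Rightarrow> real"
  assumes "finite S" and "\<And>s. s \<in> S \<Longrightarrow> 0 \<le> w s" and "sum w S = 1"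
  shows "exp (\<Sum>s\<in>S. w s * X s) \<le> (\<Sum>s\<in>S. w s * exp (X s))"
  using convex_on_sum[OF assms(1) _ exp_convex assms(3,2), of X] assms(3)
  by (cases "S = {}") auto

text \<open>Decoupling: for independent fair signs \<open>e\<close> the mean of \<open>(1 + e i) * (1 - e j)\<close>
  is 1 if \<open>i \<noteq> j\<close>, and exp is convex.\<close>
lemma sum_bern_exp_decouple:
  assumes "\<bar>t\<bar> \<le> 1" and diag: "\<And>i. i < N \<Longrightarrow> b i i = 0"
  shows "(\<Sum>s\<in>cube N. bern N t s * exp (\<Sum>i<N. \<Sum>j<N. b i j * x i s * x j s))
    \<le> (\<Sum>e\<in>cube N. bern N 0 e * (\<Sum>s\<in>cube N. bern N t s *
          exp (\<Sum>i\<in>{i\<in>{..<N}. e i = 1}. (\<Sum>j\<in>{j\<in>{..<N}. e j \<noteq> 1}. 4 * b i j * x j s) * x i s)))"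
proof -
  \<comment> \<open>The factor 4 is the value of \<open>(1 + e i) * (1 - e j)\<close> when
    \<open>e i = 1\<close> and \<open>e j = - 1\<close>, the only case in which it is not
    zero.\<close>
  let ?P = "\<lambda>e s. (\<Sum>i\<in>{i\<in>{..<N}. e i = (1::real)}. (\<Sum>j\<in>{j\<in>{..<N}. e j \<noteq> 1}. 4 * b i j * x j s) * x i s)"
  have eq: "(\<Sum>i<N. \<Sum>j<N. b i j * x i s * x j s) = (\<Sum>e\<in>cube N. bern N 0 e * ?P e s)" for s
  proof -
    have P: "?P e s = (\<Sum>i<N. \<Sum>j<N. ((1 + e i) * (1 - e j)) * (b i j * x i s * x j s))" if e: "e \<in> cube N" for e
    proof -
      have "?P e s = (\<Sum>i<N. if e i = 1 then (\<Sum>j<N. if e j \<noteq> 1 then 4 * b i j * x j s else 0) * x i s else 0)"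
        by (simp add: sum.If_cases Int_def sum.inter_filter cong: conj_cong)
      also have "\<dots> = (\<Sum>i<N. \<Sum>j<N. ((1 + e i) * (1 - e j)) * (b i j * x i s * x j s))"
      proof (intro sum.cong refl)
        fix i assume "i \<in> {..<N}"
        then have ei: "e i = - 1 \<or> e i = 1" using cube_val[OF e] by auto
        have "(\<Sum>j<N. if e j \<noteq> 1 then 4 * b i j * x j s else 0) = (\<Sum>j<N. 2 * (1 - e j) * (b i j * x j s))"
        proof (intro sum.cong refl)
          fix j assume "j \<in> {..<N}"
          then show "(if e j \<noteq> 1 then 4 * b i j * x j s else 0) = 2 * (1 - e j) * (b i j * x j s)"
            using cube_val[OF e, of j] by auto
        qed
        then show "(if e i = 1 then (\<Sum>j<N. if e j \<noteq> 1 then 4 * b i j * x j s else 0) * x i s else 0)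
          = (\<Sum>j<N. ((1 + e i) * (1 - e j)) * (b i j * x i s * x j s))"
          using ei by (auto simp: sum_distrib_left sum_distrib_right mult_ac)
      qed
      finally show ?thesis .
    qed
    have mean: "(\<Sum>e\<in>cube N. bern N 0 e * ((1 + e i) * (1 - e j))) * (b i j * y) = b i j * y"
      if "i < N" "j < N" for i j y
      using that diag[of i] sum_bern_pair[of i N j 0 "\<lambda>v. 1 + v" "\<lambda>v. 1 - v"] by (cases "i = j") auto
    have "(\<Sum>e\<in>cube N. bern N 0 e * ?P e s)
        = (\<Sum>e\<in>cube N. \<Sum>i<N. \<Sum>j<N. bern N 0 e * ((1 + e i) * (1 - e j)) * (b i j * x i s * x j s))"
    proof -
      have "(\<Sum>e\<in>cube N. bern N 0 e * ?P e s) = (\<Sum>e\<in>cube N. bern N 0 e *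
          (\<Sum>i<N. \<Sum>j<N. ((1 + e i) * (1 - e j)) * (b i j * x i s * x j s)))"
        by (intro sum.cong refl) (simp only: P)
      then show ?thesis by (simp only: sum_distrib_left mult.assoc)
    qed
    also have "\<dots> = (\<Sum>i<N. \<Sum>j<N. \<Sum>e\<in>cube N. bern N 0 e * ((1 + e i) * (1 - e j)) * (b i j * x i s * x j s))"
      by (subst sum.swap, intro sum.cong refl, rule sum.swap)
    also have "\<dots> = (\<Sum>i<N. \<Sum>j<N. (\<Sum>e\<in>cube N. bern N 0 e * ((1 + e i) * (1 - e j))) * (b i j * (x i s * x j s)))"
      unfolding sum_distrib_right by (simp only: mult.assoc)
    also have "\<dots> = (\<Sum>i<N. \<Sum>j<N. b i j * (x i s * x j s))"
      by (intro sum.cong refl mean) auto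
    finally show ?thesis by (simp add: mult.assoc)
  qed
  have "(\<Sum>s\<in>cube N. bern N t s * exp (\<Sum>i<N. \<Sum>j<N. b i j * x i s * x j s))
      \<le> (\<Sum>s\<in>cube N. bern N t s * (\<Sum>e\<in>cube N. bern N 0 e * exp (?P e s)))"
    unfolding eq
    by (intro sum_mono mult_left_mono exp_average_le finite_cube bern_nonneg sum_bern assms(1)) auto
  also have "\<dots> = (\<Sum>e\<in>cube N. bern N 0 e * (\<Sum>s\<in>cube N. bern N t s * exp (?P e s)))"
    unfolding sum_distrib_left by (subst sum.swap) (simp add: mult_ac)
  finally show ?thesis .
qed

section \<open>Configurations of nonnegative mean: the improved variance proxy\<close>

abbreviation half_cube :: "nat \<Rightarrow> (nat \<Rightarrow> real) set" where
  "half_cube N \<equiv> {s\<in>cube N. 0 \<le> sum s {..<N}}"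

text \<open>Splitting \<open>y\<close> into its average and its fluctuation, the exponent has the
  factor \<open>1 - \<kappa>\<close> on the former and \<open>1 + 4 * \<kappa>\<close> on the
  latter. The unsplit form suits a \<open>y\<close> given in eigenvectors, where the constant vector
  is only approximately the first one.\<close>

definition half_mgf_le :: "real \<Rightarrow> real \<Rightarrow> real \<Rightarrow> nat \<Rightarrow> bool" where
  "half_mgf_le \<beta> t \<kappa> N \<longleftrightarrow> (\<forall>y.
    (\<Sum>s\<in>half_cube N. bern N t s * exp (\<beta> * (\<Sum>i<N. y i * (s i - t))))
      \<le> exp (\<beta> / 2 * ((1 + 4 * \<kappa>) * (\<Sum>i<N. (y i)\<^sup>2) - 5 * \<kappa> * ((\<Sum>i<N. y i)\<^sup>2 / real N))))"

text \<open>The mean-field critical direction. The bound \<open>exp (\<beta> * y\<^sup>2 / 2)\<close> for a single spin is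
  attained at \<open>y = - 2 * t\<close>, the opposite phase; restricting to \<open>0 \<le> sum s {..<N}\<close> rules it out.\<close>
lemma half_cube_exp_le:
  assumes \<beta>: "1 < (\<beta>::real)" and t: "0 < t" "t = tanh (\<beta> * t)"
  shows "\<exists>K>0. \<forall>\<kappa> N. 0 < \<kappa> \<longrightarrow> \<kappa> \<le> K \<longrightarrow> 0 < N \<longrightarrow> half_mgf_le \<beta> t \<kappa> N"
proof -
  obtain k0 where k0: "k0 > 0"
    "\<And>y. bern_mgf t (\<beta> * y) \<le> exp (\<beta> * y\<^sup>2 / 2 - k0 * min (y\<^sup>2) ((y + 2 * t)\<^sup>2))"
    using bern_mgf_fine[OF \<beta> t] by blast
  have abs_t_le_1: "\<bar>t\<bar> \<le> 1" using t_lt_1[OF \<beta> t] t by auto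
  have mgf_nn: "0 \<le> bern_mgf t y" for y by (metis bern_mgf_tanh exp_ge_zero t(2))
  \<comment> \<open>With \<open>k0 / (2 * \<beta>)\<close> the well gap can pay for
    \<open>2 * \<beta> * \<kappa>\<close>; the bound 1/2 keeps \<open>1 - 2 * \<kappa>\<close>
    nonnegative.\<close>
  show ?thesis
  proof (intro exI[of _ "min (1 / 2) (k0 / (2 * \<beta>))"] conjI allI impI half_mgf_le_def[THEN iffD2])
    fix \<kappa> :: real and N :: nat and y :: "nat \<Rightarrow> real"
    assume k: "0 < \<kappa>" "\<kappa> \<le> min (1 / 2) (k0 / (2 * \<beta>))" and N: "0 < N"
    have kb: "2 * \<beta> * \<kappa> \<le> k0" "\<kappa> \<le> 1 / 2" using k \<beta> by (auto simp: field_simps)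
    define n where "n = real N"
    have n: "0 < n" using N by (simp add: n_def)
    define m where "m = (\<Sum>i<N. y i) / n"
    define h where "h = (\<lambda>i. y i - m)"
    define V where "V = (\<Sum>i<N. (h i)\<^sup>2)"
    have sum_y: "(\<Sum>i<N. y i) = n * m" using n by (simp add: m_def)
    have sum_h: "(\<Sum>i<N. h i) = 0" by (simp add: h_def sum_subtractf sum_y n_def[symmetric])
    have V0: "0 \<le> V" unfolding V_def by (intro sum_nonneg) auto
    have sq: "(\<Sum>i<N. (b + h i)\<^sup>2) = V + n * b\<^sup>2" for b
    proof -
      have "(\<Sum>i<N. (b + h i)\<^sup>2) = (\<Sum>i<N. b\<^sup>2 + 2 * b * h i + (h i)\<^sup>2)" by (simp add: power2_sum add_ac)
      also have "\<dots> = n * b\<^sup>2 + 2 * b * (\<Sum>i<N. h i) + V"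
        by (simp add: sum.distrib V_def sum_distrib_left n_def)
      finally show ?thesis by (simp add: sum_h)
    qed
    have sqy: "(\<Sum>i<N. (y i)\<^sup>2) = V + n * m\<^sup>2" using sq[of m] by (simp add: h_def)
    have sm: "(\<Sum>i<N. y i)\<^sup>2 / n = n * m\<^sup>2" using n by (simp add: sum_y power2_eq_square)
    text \<open>\<open>- t\<close> is the midpoint between the two wells \<open>0\<close> and \<open>- 2 * t\<close>.\<close>
    have main: "(\<Sum>s\<in>cube N. bern N t s * exp (\<beta> * (\<Sum>i<N. (b + h i) * (s i - t))))
        \<le> exp (\<beta> / 2 * ((1 + 4 * \<kappa>) * V + (1 - 2 * \<kappa>) * (n * b\<^sup>2)))" if b: "- t \<le> b" for b
    proof -
      have pw: "bern_mgf t (\<beta> * (b + h i)) \<le> exp (\<beta> / 2 * (b + h i)\<^sup>2 - 2 * \<beta> * \<kappa> * (b\<^sup>2 / 2 - (h i)\<^sup>2))" for i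
      proof -
        have sqh: "x\<^sup>2 / 2 - (h i)\<^sup>2 \<le> (x + h i)\<^sup>2" for x
        proof -
          have "(x + h i)\<^sup>2 - (x\<^sup>2 / 2 - (h i)\<^sup>2) = (x + 2 * h i)\<^sup>2 / 2"
            by (simp add: power2_eq_square field_simps)
          moreover have "0 \<le> (x + 2 * h i)\<^sup>2 / 2" by simp
          ultimately show ?thesis by linarith
        qed
        have "b\<^sup>2 \<le> (b + 2 * t)\<^sup>2"
          using mult_nonneg_nonneg[of t "b + t"] b t by (simp add: power2_eq_square algebra_simps)
        with sqh[of b] sqh[of "b + 2 * t"]
        have mn: "b\<^sup>2 / 2 - (h i)\<^sup>2 \<le> min ((b + h i)\<^sup>2) ((b + h i + 2 * t)\<^sup>2)"
          by (simp add: add_ac)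
        have "2 * \<beta> * \<kappa> * (b\<^sup>2 / 2 - (h i)\<^sup>2) \<le> 2 * \<beta> * \<kappa> * min ((b + h i)\<^sup>2) ((b + h i + 2 * t)\<^sup>2)"
          using mn k \<beta> by (intro mult_left_mono) auto
        also have "\<dots> \<le> k0 * min ((b + h i)\<^sup>2) ((b + h i + 2 * t)\<^sup>2)"
          using kb by (intro mult_right_mono) auto
        finally show ?thesis by (intro order_trans[OF k0(2)[of "b + h i"]]) simp
      qed
      have "(\<Sum>s\<in>cube N. bern N t s * exp (\<beta> * (\<Sum>i<N. (b + h i) * (s i - t))))
          = (\<Prod>i<N. bern_mgf t (\<beta> * (b + h i)))"
        unfolding sum_bern_exp[symmetric] by (simp add: sum_distrib_left mult.assoc)
      also have "\<dots> \<le> (\<Prod>i<N. exp (\<beta> / 2 * (b + h i)\<^sup>2 - 2 * \<beta> * \<kappa> * (b\<^sup>2 / 2 - (h i)\<^sup>2)))"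
        by (intro prod_mono conjI mgf_nn pw)
      also have "\<dots> = exp (\<Sum>i<N. \<beta> / 2 * (b + h i)\<^sup>2 - 2 * \<beta> * \<kappa> * (b\<^sup>2 / 2 - (h i)\<^sup>2))"
        by (rule exp_sum[symmetric]) simp
      also have "(\<Sum>i<N. \<beta> / 2 * (b + h i)\<^sup>2 - 2 * \<beta> * \<kappa> * (b\<^sup>2 / 2 - (h i)\<^sup>2))
          = \<beta> / 2 * (V + n * b\<^sup>2) - 2 * \<beta> * \<kappa> * (n * (b\<^sup>2 / 2) - V)"
        by (simp only: sum_subtractf sum_distrib_left[symmetric] sq V_def[symmetric] sum_constant card_lessThan n_def[symmetric])
      also have "\<dots> = \<beta> / 2 * ((1 + 4 * \<kappa>) * V + (1 - 2 * \<kappa>) * (n * b\<^sup>2))"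
        by (simp add: field_simps)
      finally show ?thesis .
    qed
    have sub: "(\<Sum>s\<in>half_cube N. bern N t s * exp (F s)) \<le> (\<Sum>s\<in>cube N. bern N t s * exp (F s))" for F
      by (intro sum_mono2 finite_cube) (auto intro!: mult_nonneg_nonneg bern_nonneg abs_t_le_1)
    have yh: "y i = m + h i" for i by (simp add: h_def)
    have "(\<Sum>s\<in>half_cube N. bern N t s * exp (\<beta> * (\<Sum>i<N. y i * (s i - t))))
        \<le> exp (\<beta> / 2 * ((1 + 4 * \<kappa>) * V + (1 - \<kappa>) * (n * m\<^sup>2)))"
    proof (cases "- t \<le> m")
      case True
      have "(1 - 2 * \<kappa>) * (n * m\<^sup>2) \<le> (1 - \<kappa>) * (n * m\<^sup>2)" using k n by (intro mult_right_mono) auto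
      then have "exp (\<beta> / 2 * ((1 + 4 * \<kappa>) * V + (1 - 2 * \<kappa>) * (n * m\<^sup>2)))
          \<le> exp (\<beta> / 2 * ((1 + 4 * \<kappa>) * V + (1 - \<kappa>) * (n * m\<^sup>2)))"
        using \<beta> by simp
      with sub main[OF True] show ?thesis unfolding yh by (meson order_trans)
    next
      case False
      \<comment> \<open>The average of \<open>y\<close> is raised to \<open>- t\<close>. On the half
        cube the factor split off is at most \<open>exp (\<beta> * b * n * t)\<close>, since the
        total spin is nonnegative.\<close>
      define b where "b = - t - m"
      have b: "0 < b" "m = - t - b" using False by (auto simp: b_def)
      have "(\<Sum>s\<in>half_cube N. bern N t s * exp (\<beta> * (\<Sum>i<N. y i * (s i - t))))
          \<le> (\<Sum>s\<in>half_cube N. exp (\<beta> * b * n * t) * (bern N t s * exp (\<beta> * (\<Sum>i<N. (- t + h i) * (s i - t)))))"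
      proof (rule sum_mono)
        fix s assume s: "s \<in> half_cube N"
        have "(\<Sum>i<N. y i * (s i - t)) = (\<Sum>i<N. (- t + h i) * (s i - t) - b * (s i - t))"
          unfolding yh b(2) by (intro sum.cong) (auto simp: algebra_simps)
        also have "\<dots> = (\<Sum>i<N. (- t + h i) * (s i - t)) - b * (sum s {..<N} - n * t)"
          by (simp add: sum_subtractf sum_distrib_left right_diff_distrib n_def)
        also have "\<dots> \<le> (\<Sum>i<N. (- t + h i) * (s i - t)) + b * n * t"
          using b s mult_nonneg_nonneg[of b "sum s {..<N}"] by (simp add: algebra_simps)
        finally have "\<beta> * (\<Sum>i<N. y i * (s i - t)) \<le> \<beta> * b * n * t + \<beta> * (\<Sum>i<N. (- t + h i) * (s i - t))"
          using mult_left_mono[of _ _ \<beta>] \<beta> by (fastforce simp: algebra_simps)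
        then have "exp (\<beta> * (\<Sum>i<N. y i * (s i - t)))
            \<le> exp (\<beta> * b * n * t) * exp (\<beta> * (\<Sum>i<N. (- t + h i) * (s i - t)))"
          by (simp add: exp_add[symmetric])
        from mult_left_mono[OF this, of "bern N t s"] bern_nonneg[OF abs_t_le_1, of s N] s
        show "bern N t s * exp (\<beta> * (\<Sum>i<N. y i * (s i - t)))
            \<le> exp (\<beta> * b * n * t) * (bern N t s * exp (\<beta> * (\<Sum>i<N. (- t + h i) * (s i - t))))"
          by (simp add: mult_ac)
      qed
      also have "\<dots> = exp (\<beta> * b * n * t) * (\<Sum>s\<in>half_cube N. bern N t s * exp (\<beta> * (\<Sum>i<N. (- t + h i) * (s i - t))))"
        by (rule sum_distrib_left[symmetric])
      also have "\<dots> \<le> exp (\<beta> * b * n * t) * exp (\<beta> / 2 * ((1 + 4 * \<kappa>) * V + (1 - 2 * \<kappa>) * (n * (- t)\<^sup>2)))"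
        by (intro mult_left_mono order_trans[OF sub main]) auto
      also have "\<dots> = exp (\<beta> / 2 * ((1 + 4 * \<kappa>) * V + n * ((1 - 2 * \<kappa>) * t\<^sup>2 + 2 * b * t)))"
        by (simp add: exp_add[symmetric] algebra_simps)
      also have "\<dots> \<le> exp (\<beta> / 2 * ((1 + 4 * \<kappa>) * V + n * ((1 - \<kappa>) * m\<^sup>2)))"
      proof -
        have "0 \<le> \<kappa> * (t - b)\<^sup>2 + (1 - 2 * \<kappa>) * b\<^sup>2" using k kb by (intro add_nonneg_nonneg mult_nonneg_nonneg) auto
        also have "\<dots> = (1 - \<kappa>) * m\<^sup>2 - ((1 - 2 * \<kappa>) * t\<^sup>2 + 2 * b * t)"
          unfolding b(2) by (simp add: power2_eq_square algebra_simps)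
        finally have "(1 - 2 * \<kappa>) * t\<^sup>2 + 2 * b * t \<le> (1 - \<kappa>) * m\<^sup>2" by simp
        then show ?thesis using \<beta> n by (simp add: mult_left_mono)
      qed
      finally show ?thesis by (simp add: mult_ac)
    qed
    also have "(1 + 4 * \<kappa>) * V + (1 - \<kappa>) * (n * m\<^sup>2)
       = (1 + 4 * \<kappa>) * (\<Sum>i<N. (y i)\<^sup>2) - 5 * \<kappa> * ((\<Sum>i<N. y i)\<^sup>2 / n)"
      unfolding sm sqy by (simp add: algebra_simps)
    finally show "(\<Sum>s\<in>half_cube N. bern N t s * exp (\<beta> * (\<Sum>i<N. y i * (s i - t))))
      \<le> exp (\<beta> / 2 * ((1 + 4 * \<kappa>) * (\<Sum>i<N. (y i)\<^sup>2) - 5 * \<kappa> * ((\<Sum>i<N. y i)\<^sup>2 / real N)))"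
      unfolding n_def .
  qed (use k0 \<beta> in auto)
qed

section \<open>Diagonalisation of real symmetric matrices\<close>

text \<open>A complex eigenvalue exists, and it is real because the form with the conjugate
  eigenvector equals its own conjugate.\<close>

lemma real_symmetric_eigenvalue_exists:
  fixes A :: "real mat"
  assumes A: "A \<in> carrier_mat n n" and sym: "A\<^sup>T = A" and n: "n \<noteq> 0"
  shows "\<exists>e. eigenvalue A e"
proof -
  let ?C = "map_mat complex_of_real A"
  have C: "?C \<in> carrier_mat n n" using A by simp
  obtain as where as: "char_poly ?C = (\<Prod>a\<leftarrow>as. [:- a, 1:])" "length as = n"
    using char_poly_factorized[OF C] by auto
  with n obtain a as' where "as = a # as'" by (cases as) auto
  with as have root: "poly (char_poly ?C) a = 0" by simp
  then have "eigenvalue ?C a" using eigenvalue_root_char_poly[OF C] by simp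
  then obtain z where z: "z \<in> carrier_vec n" "z \<noteq> 0\<^sub>v n" "?C *\<^sub>v z = a \<cdot>\<^sub>v z"
    using C unfolding eigenvalue_def eigenvector_def by auto
  have symij: "A $$ (i, j) = A $$ (j, i)" if "i < n" "j < n" for i j
    using that A sym by (metis carrier_matD index_transpose_mat(1))
  have row: "(\<Sum>j<n. complex_of_real (A $$ (i, j)) * vec_index z j) = a * vec_index z i" if "i < n" for i
  proof -
    have "vec_index (?C *\<^sub>v z) i = (\<Sum>j<n. complex_of_real (A $$ (i, j)) * vec_index z j)"
      using that z(1) A by (auto simp: scalar_prod_def atLeast0LessThan intro!: sum.cong)
    then show ?thesis using z that by simp
  qed
  let ?s = "\<Sum>i<n. cnj (vec_index z i) * vec_index z i"
  let ?q = "\<Sum>i<n. \<Sum>j<n. complex_of_real (A $$ (i, j)) * (cnj (vec_index z i) * vec_index z j)"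
  have "?q = (\<Sum>i<n. cnj (vec_index z i) * (\<Sum>j<n. complex_of_real (A $$ (i, j)) * vec_index z j))"
    by (simp add: sum_distrib_left mult_ac)
  also have "\<dots> = (\<Sum>i<n. cnj (vec_index z i) * (a * vec_index z i))"
    using row by (intro sum.cong) auto
  also have "\<dots> = a * ?s"
    by (simp add: sum_distrib_left mult_ac)
  finally have q: "?q = a * ?s" .
  have "cnj ?q = (\<Sum>i<n. \<Sum>j<n. complex_of_real (A $$ (j, i)) * (cnj (vec_index z j) * vec_index z i))"
    using symij by (auto intro!: sum.cong simp: mult_ac)
  also have "\<dots> = ?q" by (rule sum.swap)
  finally have "cnj ?q = ?q" .
  moreover have s: "?s = complex_of_real (\<Sum>i<n. (cmod (vec_index z i))\<^sup>2)"
    by (simp add: complex_norm_square mult.commute del: of_real_power)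
  have "?s \<noteq> 0"
  proof
    assume "?s = 0"
    then have "(\<Sum>i<n. (cmod (vec_index z i))\<^sup>2) = 0" unfolding s by (simp only: of_real_eq_0_iff)
    then have "\<forall>i<n. vec_index z i = 0" by (subst (asm) sum_nonneg_eq_0_iff) auto
    then have "z = 0\<^sub>v n" using z(1) by (intro eq_vecI) auto
    with z(2) show False by simp
  qed
  moreover have "cnj ?s = ?s" by (simp only: s complex_cnj_complex_of_real)
  ultimately have "cnj a = a" unfolding q by (metis complex_cnj_mult mult_cancel_right)
  then have "a = complex_of_real (Re a)"
    by (auto simp: complex_eq_iff)
  with root have "poly (map_poly complex_of_real (char_poly A)) (complex_of_real (Re a)) = 0"
    using of_real_hom.char_poly_hom[OF A, where 'a = complex] by simp
  then have "poly (char_poly A) (Re a) = 0" by simp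
  then show ?thesis using eigenvalue_root_char_poly[OF A] by blast
qed

text \<open>Gram-Schmidt on a basis starting with \<open>v\<close> keeps \<open>v\<close> in front;
  normalising the columns afterwards only rescales it, hence \<open>c\<close>.\<close>

lemma orthogonal_matrix_with_first_column:
  fixes v :: "real Matrix.vec"
  assumes v: "v \<in> carrier_vec n" "v \<noteq> 0\<^sub>v n"
  shows "\<exists>W c. W \<in> carrier_mat n n \<and> W\<^sup>T * W = 1\<^sub>m n \<and> col W 0 = c \<cdot>\<^sub>v v"
proof -
  interpret cof_vec_space n "TYPE(real)" .
  let ?b = "basis_completion v"
  have b: "set ?b \<subseteq> carrier_vec n" "distinct ?b" "\<not> lin_dep (set ?b)" "length ?b = n" "hd ?b = v"
    using basis_completion[OF v] by auto
  have n: "n \<noteq> 0" using v by (metis carrier_vecD eq_vecI index_zero_vec(2) not_less_zero)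
  define ws where "ws = gram_schmidt n ?b"
  have ws: "set ws \<subseteq> carrier_vec n" "corthogonal ws" "length ws = n"
    using gram_schmidt_result[OF b(1-3) ws_def] b(4) by auto
  obtain vs where "?b = v # vs" using b n by (cases ?b) auto
  then have hd: "hd ws = v" using gram_schmidt_hd[OF v(1), of vs] by (simp add: ws_def)
  define f where "f = (\<lambda>w :: real Matrix.vec. (1 / sqrt (w \<bullet> w)) \<cdot>\<^sub>v w)"
  define W where "W = mat_of_cols n (map f ws)"
  have wsi: "ws ! i \<in> carrier_vec n" if "i < n" for i using ws that by auto
  have fc: "f w \<in> carrier_vec n" if "w \<in> carrier_vec n" for w using that by (simp add: f_def)
  have W: "W \<in> carrier_mat n n" using mat_of_cols_carrier(1)[of n "map f ws"] ws(3) by (simp add: W_def)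
  have colW: "col W i = f (ws ! i)" if "i < n" for i
    using that ws wsi fc by (simp add: W_def)
  have "W\<^sup>T * W = 1\<^sub>m n"
  proof (rule eq_matI)
    fix i j assume "i < dim_row (1\<^sub>m n)" "j < dim_col (1\<^sub>m n)"
    then have ij: "i < n" "j < n" by auto
    have "(W\<^sup>T * W) $$ (i, j) = f (ws ! i) \<bullet> f (ws ! j)"
      using ij W colW by (simp add: row_transpose)
    also have "\<dots> = (ws ! i \<bullet> ws ! j) / (sqrt (ws ! i \<bullet> ws ! i) * sqrt (ws ! j \<bullet> ws ! j))"
      using wsi[OF ij(1)] wsi[OF ij(2)] by (simp add: f_def)
    also have "\<dots> = of_bool (i = j)"
    proof -
      have o: "(ws ! i \<bullet> ws ! j = 0) = (i \<noteq> j)" if "i < n" "j < n" for i j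
        using corthogonalD[OF ws(2), of i j] that ws(3)
        by (simp add: conjugate_vec_def)
      have "0 \<le> ws ! i \<bullet> ws ! i" unfolding scalar_prod_def by (rule sum_nonneg) auto
      with o[OF ij] o[OF ij(1) ij(1)] show ?thesis by auto
    qed
    finally show "(W\<^sup>T * W) $$ (i, j) = 1\<^sub>m n $$ (i, j)" using ij by simp
  qed (use W in auto)
  moreover have "col W 0 = (1 / sqrt (v \<bullet> v)) \<cdot>\<^sub>v v"
    using colW[of 0] n hd ws(3) hd_conv_nth[of ws] by (auto simp: f_def)
  ultimately show ?thesis using W by blast
qed

text \<open>Deflation: in an orthonormal basis whose first vector is an eigenvector, symmetry clears
  the first row together with the first column, and induction treats the remaining block.\<close>

theorem real_symmetric_diagonalizable:
  fixes A :: "real mat"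
  assumes "A \<in> carrier_mat n n" and "A\<^sup>T = A"
  shows "\<exists>P D. P \<in> carrier_mat n n \<and> D \<in> carrier_mat n n \<and> diagonal_mat D \<and>
    P\<^sup>T * P = 1\<^sub>m n \<and> A = P * D * P\<^sup>T"
  using assms
proof (induction n arbitrary: A)
  case 0
  then show ?case by (intro exI[of _ "1\<^sub>m 0"]) (auto simp: diagonal_mat_def)
next
  case (Suc m)
  let ?n = "Suc m"
  note A = Suc.prems(1) and sym = Suc.prems(2)
  obtain e where "eigenvalue A e" using real_symmetric_eigenvalue_exists[OF A sym] by auto
  then obtain v where v: "v \<in> carrier_vec ?n" "v \<noteq> 0\<^sub>v ?n" "A *\<^sub>v v = e \<cdot>\<^sub>v v"
    using A unfolding eigenvalue_def eigenvector_def by auto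
  obtain W c where W: "W \<in> carrier_mat ?n ?n" "W\<^sup>T * W = 1\<^sub>m ?n" "col W 0 = c \<cdot>\<^sub>v v"
    using orthogonal_matrix_with_first_column[OF v(1,2)] by blast
  have WT: "W\<^sup>T \<in> carrier_mat ?n ?n" using W by simp
  have WW: "W * W\<^sup>T = 1\<^sub>m ?n" using mat_mult_left_right_inverse[OF WT W(1) W(2)] .
  define A' where "A' = W\<^sup>T * (A * W)"
  have A': "A' \<in> carrier_mat ?n ?n" using A W by (simp add: A'_def)
  have A'T: "A'\<^sup>T = A'"
  proof -
    have "A'\<^sup>T = (A * W)\<^sup>T * W\<^sup>T\<^sup>T" unfolding A'_def using A W by (intro transpose_mult) auto
    also have "(A * W)\<^sup>T = W\<^sup>T * A" using transpose_mult[OF A W(1)] sym by simp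
    finally show ?thesis unfolding A'_def using A W by (simp add: assoc_mult_mat[OF WT A W(1)])
  qed
  have col0: "col A' 0 = e \<cdot>\<^sub>v unit_vec ?n 0"
  proof -
    have "col A' 0 = W\<^sup>T *\<^sub>v (A *\<^sub>v col W 0)"
      unfolding A'_def using col_mult2[OF WT, of "A * W" ?n 0] col_mult2[OF A W(1), of 0] A W(1)
      by simp
    also have "A *\<^sub>v col W 0 = e \<cdot>\<^sub>v col W 0"
      using v A by (simp add: W(3) mult_mat_vec smult_smult_assoc mult.commute)
    also have "W\<^sup>T *\<^sub>v (e \<cdot>\<^sub>v col W 0) = e \<cdot>\<^sub>v col (W\<^sup>T * W) 0"
      using W using mult_mat_vec[OF WT, of "col W 0" e] col_mult2[OF WT W(1), of 0] v(1) by (simp add: W(3))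
    also have "\<dots> = e \<cdot>\<^sub>v unit_vec ?n 0" by (simp add: W(2))
    finally show ?thesis .
  qed
  define A3 where "A3 = Matrix.mat m m (\<lambda>(i, j). A' $$ (Suc i, Suc j))"
  have A3: "A3 \<in> carrier_mat m m" by (simp add: A3_def)
  have A'0: "A' $$ (i, 0) = (if i = 0 then e else 0)" if "i < ?n" for i
    using arg_cong[OF col0, of "\<lambda>v. vec_index v i"] that A' by simp
  have A'0': "A' $$ (0, i) = (if i = 0 then e else 0)" if "i < ?n" for i
    using A'0[OF that] A'T that A' by (metis carrier_matD index_transpose_mat(1) zero_less_Suc)
  let ?E = "Matrix.mat 1 1 (\<lambda>_. e)"
  have A'_eq: "A' = four_block_mat ?E (0\<^sub>m 1 m) (0\<^sub>m m 1) A3"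
  proof (rule eq_matI)
    fix i j assume "i < dim_row (four_block_mat ?E (0\<^sub>m 1 m) (0\<^sub>m m 1) A3)"
      "j < dim_col (four_block_mat ?E (0\<^sub>m 1 m) (0\<^sub>m m 1) A3)"
    then show "A' $$ (i, j) = four_block_mat ?E (0\<^sub>m 1 m) (0\<^sub>m m 1) A3 $$ (i, j)"
      by (cases i; cases j) (auto simp: A3_def A'0 A'0')
  qed (use A' in \<open>auto simp: A3_def\<close>)
  have "A3\<^sup>T = A3"
  proof (rule eq_matI)
    fix i j assume "i < dim_row A3" "j < dim_col A3"
    then show "A3\<^sup>T $$ (i, j) = A3 $$ (i, j)"
      using A'T A' unfolding A3_def
      by simp (metis Suc_less_eq carrier_matD index_transpose_mat(1))
  qed (auto simp: A3_def)
  from Suc.IH[OF A3 this] obtain P D where P: "P \<in> carrier_mat m m" and D: "D \<in> carrier_mat m m"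
    "diagonal_mat D" and PP: "P\<^sup>T * P = 1\<^sub>m m" and A3_eq: "A3 = P * D * P\<^sup>T" by blast
  define R where "R = four_block_mat (1\<^sub>m 1) (0\<^sub>m 1 m) (0\<^sub>m m 1) P"
  define S where "S = four_block_mat ?E (0\<^sub>m 1 m) (0\<^sub>m m 1) D"
  have R: "R \<in> carrier_mat ?n ?n" and S: "S \<in> carrier_mat ?n ?n"
    using P D by (auto simp: R_def S_def)
  have RT: "R\<^sup>T = four_block_mat (1\<^sub>m 1) (0\<^sub>m 1 m) (0\<^sub>m m 1) P\<^sup>T"
    unfolding R_def using P by (subst transpose_four_block_mat) auto
  have RTc: "R\<^sup>T \<in> carrier_mat ?n ?n" using R by simp
  have RR: "R\<^sup>T * R = 1\<^sub>m ?n"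
    unfolding RT unfolding R_def
    using P PP four_block_one_mat[of 1 m] by (subst mult_four_block_mat[of _ 1 1 _ m _ m _ _ 1 _ m]) auto
  have RSR: "R * S * R\<^sup>T = A'"
    unfolding RT unfolding R_def S_def A'_eq A3_eq using P D
    by (subst mult_four_block_mat[of _ 1 1 _ m _ m _ _ 1 _ m]; (subst mult_four_block_mat[of _ 1 1 _ m _ m _ _ 1 _ m])?) auto
  have "diagonal_mat S"
    unfolding diagonal_mat_def
  proof (intro allI impI)
    fix i j assume "i < dim_row S" "j < dim_col S" "i \<noteq> j"
    then show "S $$ (i, j) = 0"
      using D unfolding S_def diagonal_mat_def by (cases i; cases j) auto
  qed
  moreover have "(W * R)\<^sup>T * (W * R) = 1\<^sub>m ?n"
  proof -
    have "(W * R)\<^sup>T * (W * R) = R\<^sup>T * (W\<^sup>T * (W * R))"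
      by (simp add: transpose_mult[OF W(1) R] assoc_mult_mat[OF RTc WT mult_carrier_mat[OF W(1) R]])
    also have "W\<^sup>T * (W * R) = R"
      using W R by (simp add: assoc_mult_mat[OF WT W(1) R, symmetric])
    finally show ?thesis using RR by simp
  qed
  moreover have "A = (W * R) * S * (W * R)\<^sup>T"
  proof -
    have "(W * R) * S * (W * R)\<^sup>T = (W * (R * S)) * (R\<^sup>T * W\<^sup>T)"
      by (simp add: transpose_mult[OF W(1) R] assoc_mult_mat[OF W(1) R S])
    also have "\<dots> = W * ((R * S * R\<^sup>T) * W\<^sup>T)"
      using W R S WT RTc by (simp add: assoc_mult_mat[of _ ?n ?n _ ?n _ ?n])
    also have "\<dots> = (W * W\<^sup>T) * A * (W * W\<^sup>T)"
      unfolding RSR A'_def using W A WT by (simp add: assoc_mult_mat[of _ ?n ?n _ ?n _ ?n])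
    finally show ?thesis using WW A by simp
  qed
  ultimately show ?case using W(1) R S by (metis mult_carrier_mat)
qed

lemma proots_linear_factors: "proots (\<Prod>a\<leftarrow>as. [:- a, 1 :: 'a :: idom:]) = mset as"
proof (induction as)
  case (Cons a as)
  have "(\<Prod>a\<leftarrow>as. [:- a, 1:]) \<noteq> 0" by (auto simp: prod_list_zero_iff)
  then show ?case using Cons.IH by (simp add: proots_mult del: mult_pCons_left)
qed auto

lemma spectral_decomposition:
  fixes A :: "real mat"
  assumes A: "A \<in> carrier_mat n n" and sym: "\<And>i j. i < n \<Longrightarrow> j < n \<Longrightarrow> A $$ (i, j) = A $$ (j, i)"
  obtains u :: "nat \<Rightarrow> nat \<Rightarrow> real" and d :: "nat \<Rightarrow> real"
  where "\<And>k l. k < n \<Longrightarrow> l < n \<Longrightarrow> (\<Sum>i<n. u k i * u l i) = of_bool (k = l)"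
    and "\<And>i j. i < n \<Longrightarrow> j < n \<Longrightarrow> (\<Sum>k<n. u k i * u k j) = of_bool (i = j)"
    and "\<And>i j. i < n \<Longrightarrow> j < n \<Longrightarrow> A $$ (i, j) = (\<Sum>k<n. d k * u k i * u k j)"
    and "\<And>k. k < n \<Longrightarrow> d k = eigval A (Suc k)"
    and "\<And>k l. k \<le> l \<Longrightarrow> l < n \<Longrightarrow> d l \<le> d k"
proof -
  have "A\<^sup>T = A" using A sym by (intro eq_matI) auto
  from real_symmetric_diagonalizable[OF A this] obtain P D where
    P: "P \<in> carrier_mat n n" and D: "D \<in> carrier_mat n n" "diagonal_mat D"
    and PP: "P\<^sup>T * P = 1\<^sub>m n" and A_eq: "A = P * D * P\<^sup>T" by blast
  have PT: "P\<^sup>T \<in> carrier_mat n n" using P by simp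
  have PP': "P * P\<^sup>T = 1\<^sub>m n" using mat_mult_left_right_inverse[OF PT P PP] .
  have "similar_mat A D"
    unfolding similar_mat_def similar_mat_wit_def Let_def
    using A P D PP PP' A_eq by (intro exI[of _ P] exI[of _ "P\<^sup>T"]) auto
  moreover have "upper_triangular D"
    using D unfolding diagonal_mat_def upper_triangular_def by auto
  ultimately have "proots (char_poly A) = mset (diag_mat D)"
    using char_poly_similar char_poly_upper_triangular[OF D(1)] proots_linear_factors by metis
  moreover define es where "es = rev (sorted_list_of_multiset (proots (char_poly A)))"
  ultimately have "mset es = mset (diag_mat D)" by simp
  \<comment> \<open>The diagonal of \<open>D\<close> and the decreasing list behind
    \<open>eigval\<close> have the same multiset; \<open>f\<close> reorders the columns of
    \<open>P\<close> so that column \<open>k\<close> belongs to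
    \<open>eigval A (Suc k)\<close>.\<close>
  then obtain f where f: "f permutes {..<length (diag_mat D)}" "permute_list f (diag_mat D) = es"
    using mset_eq_permutation by metis
  have len: "length (diag_mat D) = n" using D by (simp add: diag_mat_def)
  have fn: "f k < n" if "k < n" for k using permutes_in_image[OF f(1)] that len by auto
  have es_k: "es ! k = D $$ (f k, f k)" if "k < n" for k
    using f len that fn[OF that] D by (auto simp: permute_list_nth diag_mat_def)
  have bij: "bij_betw f {..<n} {..<n}" using permutes_imp_bij f(1) len by auto
  define u where "u = (\<lambda>k i. P $$ (i, f k))"
  define d where "d = (\<lambda>k. es ! k)"
  show thesis
  proof (rule that[of u d])
    fix k l assume kl: "k < n" "l < n"
    have "(\<Sum>i<n. u k i * u l i) = (P\<^sup>T * P) $$ (f k, f l)"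
      using P fn kl by (simp add: u_def scalar_prod_def atLeast0LessThan)
    then show "(\<Sum>i<n. u k i * u l i) = of_bool (k = l)"
      unfolding PP using fn kl bij by (auto simp: bij_betw_def inj_on_def)
  next
    fix i j assume ij: "i < n" "j < n"
    have "(\<Sum>k<n. u k i * u k j) = (\<Sum>k<n. P $$ (i, k) * P $$ (j, k))"
      unfolding u_def by (rule sum.reindex_bij_betw[OF bij])
    also have "\<dots> = (P * P\<^sup>T) $$ (i, j)"
      using P ij by (simp add: scalar_prod_def atLeast0LessThan)
    finally show "(\<Sum>k<n. u k i * u k j) = of_bool (i = j)" unfolding PP' using ij by simp
  next
    fix i j assume ij: "i < n" "j < n"
    have "(P * D) $$ (i, k) = P $$ (i, k) * D $$ (k, k)" if "k < n" for k
    proof -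
      have "(P * D) $$ (i, k) = (\<Sum>l<n. P $$ (i, l) * D $$ (l, k))"
        using P D ij that by (simp add: scalar_prod_def atLeast0LessThan)
      also have "\<dots> = (\<Sum>l<n. if l = k then P $$ (i, k) * D $$ (k, k) else 0)"
        using D that unfolding diagonal_mat_def by (intro sum.cong) auto
      finally show ?thesis using that by simp
    qed
    moreover have "(M * P\<^sup>T) $$ (i, j) = (\<Sum>k<n. M $$ (i, k) * P $$ (j, k))" if "M \<in> carrier_mat n n" for M
      using P ij that by (simp add: scalar_prod_def atLeast0LessThan)
    ultimately have "A $$ (i, j) = (\<Sum>k<n. P $$ (i, k) * D $$ (k, k) * P $$ (j, k))"
      unfolding A_eq using mult_carrier_mat[OF P D(1)] by simp
    also have "\<dots> = (\<Sum>k<n. P $$ (i, f k) * D $$ (f k, f k) * P $$ (j, f k))"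
      by (rule sum.reindex_bij_betw[OF bij, symmetric])
    finally show "A $$ (i, j) = (\<Sum>k<n. d k * u k i * u k j)"
      by (simp add: u_def d_def es_k mult_ac)
  next
    fix k assume "k < n"
    then show "d k = eigval A (Suc k)" by (simp add: d_def es_def eigval_def)
  next
    fix k l assume kl: "k \<le> l" "l < n"
    have "sorted (rev es)" "length es = n"
      using arg_cong[OF f(2), of length] len by (simp_all add: es_def)
    then show "d l \<le> d k" using kl unfolding d_def by (intro sorted_rev_nth_mono) auto
  qed
qed

section \<open>Exponential moments of quadratic forms\<close>

text \<open>A single \<open>N\<close>, with the matrix and its spectral data as plain functions. The
  limits in the theorem enter only later, as inequalities for this \<open>N\<close>.\<close>

locale spin_matrix =
  fixes N :: nat and a u :: "nat \<Rightarrow> nat \<Rightarrow> real" and d :: "nat \<Rightarrow> real" and \<beta> t :: real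
  assumes N2: "2 \<le> N"
    and a_sym: "\<And>i j. i < N \<Longrightarrow> j < N \<Longrightarrow> a i j = a j i"
    and a_nonneg: "\<And>i j. i < N \<Longrightarrow> j < N \<Longrightarrow> 0 \<le> a i j"
    and a_diag: "\<And>i. i < N \<Longrightarrow> a i i = 0"
    and ortho: "\<And>k l. k < N \<Longrightarrow> l < N \<Longrightarrow> (\<Sum>i<N. u k i * u l i) = of_bool (k = l)"
    and complete: "\<And>i j. i < N \<Longrightarrow> j < N \<Longrightarrow> (\<Sum>k<N. u k i * u k j) = of_bool (i = j)"
    and a_eq: "\<And>i j. i < N \<Longrightarrow> j < N \<Longrightarrow> a i j = (\<Sum>k<N. d k * u k i * u k j)"
    and d_mono: "\<And>k l. k \<le> l \<Longrightarrow> l < N \<Longrightarrow> d l \<le> d k"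
    and \<beta>: "1 < \<beta>" and t: "0 < t" "t = tanh (\<beta> * t)"
begin

abbreviation mean :: "((nat \<Rightarrow> real) \<Rightarrow> real) \<Rightarrow> real" where
  "mean F \<equiv> (\<Sum>s\<in>cube N. bern N t s * F s)"

abbreviation half_mean :: "((nat \<Rightarrow> real) \<Rightarrow> real) \<Rightarrow> real" where
  "half_mean F \<equiv> (\<Sum>s\<in>half_cube N. bern N t s * F s)"

definition coord :: "nat \<Rightarrow> (nat \<Rightarrow> real) \<Rightarrow> real" where
  "coord k y = (\<Sum>i<N. u k i * y i)"

text \<open>Functional calculus: the matrix with eigenvalues \<open>\<mu>\<close> in the eigenbasis
  of \<open>a\<close>, used for truncations of the spectrum.\<close>

definition spec :: "(nat \<Rightarrow> real) \<Rightarrow> nat \<Rightarrow> nat \<Rightarrow> real" where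
  "spec \<mu> i j = (\<Sum>k<N. \<mu> k * u k i * u k j)"

lemma a_spec: "i < N \<Longrightarrow> j < N \<Longrightarrow> a i j = spec d i j"
  by (simp add: spec_def a_eq)

lemma parseval_sub:
  assumes "L \<subseteq> {..<N}"
  shows "(\<Sum>i<N. (\<Sum>k\<in>L. c k * u k i)\<^sup>2) = (\<Sum>k\<in>L. (c k)\<^sup>2)"
proof -
  have fin: "finite L" using assms finite_subset by blast
  have "(\<Sum>i<N. (\<Sum>k\<in>L. c k * u k i)\<^sup>2) = (\<Sum>i<N. \<Sum>k\<in>L. \<Sum>l\<in>L. c k * c l * (u k i * u l i))"
    by (simp add: power2_eq_square sum_product mult_ac)
  also have "\<dots> = (\<Sum>k\<in>L. \<Sum>l\<in>L. \<Sum>i<N. c k * c l * (u k i * u l i))"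
    by (rule trans[OF sum.swap]) (rule sum.cong[OF refl], rule sum.swap)
  also have "\<dots> = (\<Sum>k\<in>L. \<Sum>l\<in>L. if k = l then c k * c l else 0)"
  proof -
    have "(\<Sum>i<N. u k i * u l i) = of_bool (k = l)" if "k \<in> L" "l \<in> L" for k l
      using assms that ortho by blast
    then show ?thesis
      unfolding sum_distrib_left[symmetric] by (intro sum.cong refl) auto
  qed
  also have "\<dots> = (\<Sum>k\<in>L. (c k)\<^sup>2)" using fin by (simp add: power2_eq_square)
  finally show ?thesis .
qed

lemma coord_expand:
  assumes "i < N"
  shows "(\<Sum>k<N. coord k y * u k i) = y i"
proof -
  have "(\<Sum>k<N. coord k y * u k i) = (\<Sum>k<N. \<Sum>j<N. y j * (u k j * u k i))"
    by (simp add: coord_def sum_distrib_left sum_distrib_right mult_ac)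
  also have "\<dots> = (\<Sum>j<N. y j * (\<Sum>k<N. u k j * u k i))"
    by (subst sum.swap) (simp add: sum_distrib_left)
  also have "\<dots> = (\<Sum>j<N. if j = i then y j else 0)"
    using assms by (intro sum.cong refl) (auto simp: complete)
  finally show ?thesis using assms by simp
qed

lemma parseval: "(\<Sum>i<N. (y i)\<^sup>2) = (\<Sum>k<N. (coord k y)\<^sup>2)"
proof -
  have "(\<Sum>i<N. (y i)\<^sup>2) = (\<Sum>i<N. (\<Sum>k<N. coord k y * u k i)\<^sup>2)"
    by (intro sum.cong refl) (simp add: coord_expand)
  then show ?thesis by (simp add: parseval_sub)
qed

lemma spec_apply: "(\<Sum>j<N. spec \<mu> i j * y j) = (\<Sum>k<N. (\<mu> k * coord k y) * u k i)"
proof -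
  have "(\<Sum>j<N. spec \<mu> i j * y j) = (\<Sum>j<N. \<Sum>k<N. \<mu> k * u k i * (u k j * y j))"
    by (simp add: spec_def sum_distrib_left sum_distrib_right mult_ac)
  also have "\<dots> = (\<Sum>k<N. \<mu> k * u k i * (\<Sum>j<N. u k j * y j))"
    by (subst sum.swap) (simp add: sum_distrib_left)
  finally show ?thesis by (simp add: coord_def mult_ac)
qed

lemma spec_norm: "(\<Sum>i<N. (\<Sum>j<N. spec \<mu> i j * y j)\<^sup>2) = (\<Sum>k<N. (\<mu> k)\<^sup>2 * (coord k y)\<^sup>2)"
  by (simp add: spec_apply parseval_sub power_mult_distrib)

lemma spec_quad: "(\<Sum>i<N. \<Sum>j<N. spec \<mu> i j * y i * y j) = (\<Sum>k<N. \<mu> k * (coord k y)\<^sup>2)"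
proof -
  have "(\<Sum>i<N. \<Sum>j<N. spec \<mu> i j * y i * y j) = (\<Sum>i<N. y i * (\<Sum>j<N. spec \<mu> i j * y j))"
    by (simp add: sum_distrib_left mult_ac)
  also have "\<dots> = (\<Sum>i<N. \<Sum>k<N. \<mu> k * coord k y * (u k i * y i))"
    by (simp only: spec_apply) (simp add: sum_distrib_left mult_ac)
  also have "\<dots> = (\<Sum>k<N. \<mu> k * coord k y * coord k y)"
    by (subst sum.swap) (simp add: sum_distrib_left coord_def)
  finally show ?thesis by (simp add: power2_eq_square mult.assoc)
qed

definition frob2 :: real where "frob2 = (\<Sum>i<N. \<Sum>j<N. (a i j)\<^sup>2)"

lemma frob2_eq: "frob2 = (\<Sum>k<N. (d k)\<^sup>2)"
proof -
  have "frob2 = (\<Sum>i<N. \<Sum>j<N. (\<Sum>k<N. (d k * u k i) * u k j)\<^sup>2)"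
    unfolding frob2_def by (intro sum.cong refl) (simp add: a_eq)
  also have "\<dots> = (\<Sum>i<N. \<Sum>k<N. (d k)\<^sup>2 * (u k i * u k i))"
    by (simp only: parseval_sub[OF order_refl]) (simp add: power2_eq_square mult_ac)
  also have "\<dots> = (\<Sum>k<N. (d k)\<^sup>2 * (\<Sum>i<N. u k i * u k i))"
    by (subst sum.swap) (simp add: sum_distrib_left)
  finally show ?thesis by (simp add: ortho)
qed

text \<open>The Perron-Frobenius argument: as the entries are nonnegative, taking absolute values in
  the eigenvector can only increase the quadratic form in modulus, and its maximum on unit vectors
  is \<open>d 0\<close>.\<close>

lemma abs_d_le:
  assumes k: "k < N"
  shows "\<bar>d k\<bar> \<le> d 0"
proof -
  have quad: "(\<Sum>i<N. \<Sum>j<N. a i j * y i * y j) = (\<Sum>l<N. d l * (coord l y)\<^sup>2)" for y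
    unfolding spec_quad[symmetric] by (intro sum.cong refl) (simp add: a_spec)
  have c: "coord l (u k) = of_bool (l = k)" if "l < N" for l
    using ortho[OF that k] by (simp add: coord_def)
  have "(\<Sum>l<N. d l * (coord l (u k))\<^sup>2) = (\<Sum>l<N. if l = k then d l else 0)"
    by (intro sum.cong refl) (auto simp: c)
  then have "d k = (\<Sum>i<N. \<Sum>j<N. a i j * u k i * u k j)" using k by (simp add: quad)
  then have "\<bar>d k\<bar> = \<bar>\<Sum>i<N. \<Sum>j<N. a i j * u k i * u k j\<bar>" by simp
  also have "\<dots> \<le> (\<Sum>i<N. \<Sum>j<N. \<bar>a i j * u k i * u k j\<bar>)"
    by (rule order_trans[OF sum_abs sum_mono[OF sum_abs]])
  also have "\<dots> = (\<Sum>i<N. \<Sum>j<N. a i j * \<bar>u k i\<bar> * \<bar>u k j\<bar>)"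
    by (intro sum.cong refl) (simp add: abs_mult a_nonneg)
  also have "\<dots> = (\<Sum>l<N. d l * (coord l (\<lambda>i. \<bar>u k i\<bar>))\<^sup>2)" by (rule quad)
  also have "\<dots> \<le> (\<Sum>l<N. d 0 * (coord l (\<lambda>i. \<bar>u k i\<bar>))\<^sup>2)"
    using d_mono[of 0] by (intro sum_mono mult_right_mono) auto
  also have "\<dots> = d 0 * (\<Sum>i<N. \<bar>u k i\<bar>\<^sup>2)" unfolding parseval[of "\<lambda>i. \<bar>u k i\<bar>"] by (rule sum_distrib_left[symmetric])
  also have "(\<Sum>i<N. \<bar>u k i\<bar>\<^sup>2) = 1" using ortho[OF k k] by (simp add: power2_eq_square)
  finally show ?thesis by simp
qed

lemma abs_t_le_1: "\<bar>t\<bar> \<le> 1" using t_lt_1[OF \<beta> t] t by auto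

lemma bern_exp_le:
  "mean (\<lambda>s. exp (\<Sum>i<N. h i * (s i - t))) \<le> exp ((\<Sum>i<N. (h i)\<^sup>2) / 2)"
  using sum_bern_exp_le[of N "\<beta> * t" h] t(2) by simp

text \<open>Linearising all squares leaves one linear form whose coefficient vector is a combination
  of eigenvectors cut down to \<open>J\<close>. Cutting down does not increase the norm, and the
  full norm is known by orthonormality. The set \<open>J\<close> comes from the decoupling.\<close>

lemma bern_exp_quad_le:
  assumes J: "J \<subseteq> {..<N}" and c: "\<And>k. k < N \<Longrightarrow> 0 \<le> c k" "\<And>k. k < N \<Longrightarrow> c k \<le> 1 / 2"
  shows "mean (\<lambda>s. exp ((\<Sum>k<N. c k * (\<Sum>i\<in>J. u k i * (s i - t))\<^sup>2) / 2))
    \<le> exp (\<Sum>k<N. c k)"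
proof -
  have c1: "c k < 1" if "k < N" for k using c(2)[OF that] by simp
  let ?l = "\<lambda>k s. sqrt (c k) * (\<Sum>i\<in>J. u k i * (s i - t))"
  have "mean (\<lambda>s. exp ((\<Sum>k<N. (?l k s)\<^sup>2) / 2)) \<le> 1 * (\<Prod>k<N. 1 / sqrt (1 - c k))"
  proof (rule hubbard_stratonovich_sum)
    fix h :: "nat \<Rightarrow> real"
    let ?th = "\<lambda>i. \<Sum>k<N. (h k * sqrt (c k)) * u k i"
    let ?th' = "\<lambda>i. if i \<in> J then ?th i else 0"
    have fJ: "finite J" using J finite_subset by blast
    have "(\<Sum>k<N. h k * ?l k s) = (\<Sum>i<N. ?th' i * (s i - t))" for s
    proof -
      have "(\<Sum>k<N. h k * ?l k s) = (\<Sum>i\<in>J. ?th i * (s i - t))"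
        unfolding sum_distrib_left sum_distrib_right by (subst sum.swap) (simp add: mult_ac)
      also have "\<dots> = (\<Sum>i<N. if i \<in> J then ?th i * (s i - t) else 0)"
        using J by (simp add: sum.If_cases Int_absorb1)
      finally show ?thesis by (auto intro!: sum.cong)
    qed
    then have "mean (\<lambda>s. exp (\<Sum>k<N. h k * ?l k s))
        \<le> exp ((\<Sum>i<N. (?th' i)\<^sup>2) / 2)" using bern_exp_le[of ?th'] by simp
    also have "(\<Sum>i<N. (?th' i)\<^sup>2) \<le> (\<Sum>i<N. (?th i)\<^sup>2)" by (intro sum_mono) auto
    then have "exp ((\<Sum>i<N. (?th' i)\<^sup>2) / 2) \<le> exp ((\<Sum>i<N. (?th i)\<^sup>2) / 2)" by simp
    also have "(\<Sum>i<N. (?th i)\<^sup>2) = (\<Sum>k<N. c k * (h k)\<^sup>2)"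
      by (simp only: parseval_sub[OF order_refl]) (simp add: power_mult_distrib c(1) mult.commute)
    finally show "mean (\<lambda>s. exp (\<Sum>k<N. h k * ?l k s))
        \<le> 1 * exp ((\<Sum>k<N. c k * (h k)\<^sup>2) / 2)" by simp
  qed (use c(1) c1 in auto)
  also have "\<dots> \<le> 1 * (\<Prod>k<N. exp (c k))"
    using c by (intro mult_left_mono prod_mono conjI inverse_sqrt_le_exp) (auto intro: less_imp_le[OF c1])
  also have "\<dots> = exp (\<Sum>k<N. c k)" by (simp add: exp_sum)
  finally show ?thesis using c by (simp add: power_mult_distrib)
qed

text \<open>After decoupling, the spins on one side are integrated out given the other side, which
  leaves a quadratic form in the squared matrix. The cost is therefore the sum of the
  \<open>(\<mu> k)\<^sup>2\<close>, not of their moduli; 16 is the square of the decoupling factor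
  4.\<close>

lemma bern_exp_offdiag_le:
  assumes \<mu>: "\<And>k. k < N \<Longrightarrow> 16 * (\<mu> k)\<^sup>2 \<le> 1 / 2"
  defines "b \<equiv> \<lambda>i j. if i = j then 0 else spec \<mu> i j"
  shows "mean (\<lambda>s. exp (\<Sum>i<N. \<Sum>j<N. b i j * (s i - t) * (s j - t)))
    \<le> exp (16 * (\<Sum>k<N. (\<mu> k)\<^sup>2))"
proof -
  have each: "(\<Sum>s\<in>cube N. bern N t s *
      exp (\<Sum>i\<in>{i\<in>{..<N}. e i = 1}. (\<Sum>j\<in>{j\<in>{..<N}. e j \<noteq> 1}. 4 * b i j * (s j - t)) * (s i - t)))
      \<le> exp (16 * (\<Sum>k<N. (\<mu> k)\<^sup>2))" for e :: "nat \<Rightarrow> real"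
  proof -
    let ?I = "{i\<in>{..<N}. e i = 1}" and ?J = "{j\<in>{..<N}. e j \<noteq> 1}"
    let ?Y = "\<lambda>i s. \<Sum>j\<in>?J. 4 * b i j * (s j - t)"
    have "(\<Sum>s\<in>cube N. bern N (tanh (\<beta> * t)) s * exp ((\<Sum>i\<in>?I. ?Y i s * (s i - tanh (\<beta> * t))) + 0))
      \<le> (\<Sum>s\<in>cube N. bern N (tanh (\<beta> * t)) s * exp ((\<Sum>i\<in>?I. (?Y i s)\<^sup>2) / 2 + 0))"
    proof (rule sum_bern_exp_conditional)
      show "?Y i (flip j s) = ?Y i s" if "j \<in> ?I" for i j s
        using that by (intro sum.cong refl) (auto simp: flip_def)
    qed auto
    then have "mean (\<lambda>s. exp (\<Sum>i\<in>?I. ?Y i s * (s i - t)))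
      \<le> mean (\<lambda>s. exp ((\<Sum>i\<in>?I. (?Y i s)\<^sup>2) / 2))"
      by (simp add: t(2)[symmetric])
    also have "\<dots> \<le> mean (\<lambda>s. exp ((\<Sum>k<N. (16 * (\<mu> k)\<^sup>2) * (\<Sum>i\<in>?J. u k i * (s i - t))\<^sup>2) / 2))"
    proof (intro sum_mono mult_left_mono)
      fix s
      let ?y = "\<lambda>j. if e j \<noteq> 1 then s j - t else 0"
      have "(\<Sum>i\<in>?I. (?Y i s)\<^sup>2) = (\<Sum>i\<in>?I. 16 * (\<Sum>j<N. spec \<mu> i j * ?y j)\<^sup>2)"
      proof (intro sum.cong refl)
        fix i assume i: "i \<in> ?I"
        have "?Y i s = (\<Sum>j\<in>?J. 4 * (spec \<mu> i j * ?y j))"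
          using i by (intro sum.cong refl) (auto simp: b_def)
        also have "\<dots> = (\<Sum>j<N. 4 * (spec \<mu> i j * ?y j))"
          by (intro sum.mono_neutral_left) auto
        finally show "(?Y i s)\<^sup>2 = 16 * (\<Sum>j<N. spec \<mu> i j * ?y j)\<^sup>2"
          by (simp add: sum_distrib_left[symmetric] power_mult_distrib)
      qed
      also have "\<dots> \<le> (\<Sum>i<N. 16 * (\<Sum>j<N. spec \<mu> i j * ?y j)\<^sup>2)"
        by (intro sum_mono2) auto
      also have "\<dots> = (\<Sum>k<N. (16 * (\<mu> k)\<^sup>2) * (coord k ?y)\<^sup>2)"
        by (simp add: sum_distrib_left[symmetric] spec_norm mult.assoc)
      also have "\<dots> = (\<Sum>k<N. (16 * (\<mu> k)\<^sup>2) * (\<Sum>i\<in>?J. u k i * (s i - t))\<^sup>2)"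
      proof -
        have "coord k ?y = (\<Sum>i\<in>?J. u k i * (s i - t))" for k
          unfolding coord_def by (subst sum.inter_filter) (auto intro!: sum.cong)
        then show ?thesis by simp
      qed
      finally show "exp ((\<Sum>i\<in>?I. (?Y i s)\<^sup>2) / 2)
          \<le> exp ((\<Sum>k<N. (16 * (\<mu> k)\<^sup>2) * (\<Sum>i\<in>?J. u k i * (s i - t))\<^sup>2) / 2)" by simp
    qed (rule bern_nonneg[OF abs_t_le_1])
    also have "\<dots> \<le> exp (\<Sum>k<N. 16 * (\<mu> k)\<^sup>2)"
      by (rule bern_exp_quad_le) (use \<mu> in auto)
    finally show ?thesis by (simp add: sum_distrib_left)
  qed
  have "mean (\<lambda>s. exp (\<Sum>i<N. \<Sum>j<N. b i j * (s i - t) * (s j - t)))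
    \<le> (\<Sum>e\<in>cube N. bern N 0 e * (\<Sum>s\<in>cube N. bern N t s *
      exp (\<Sum>i\<in>{i\<in>{..<N}. e i = 1}. (\<Sum>j\<in>{j\<in>{..<N}. e j \<noteq> 1}. 4 * b i j * (s j - t)) * (s i - t))))"
    by (rule sum_bern_exp_decouple) (auto simp: abs_t_le_1 b_def)
  also have "\<dots> \<le> (\<Sum>e\<in>cube N. bern N 0 e * exp (16 * (\<Sum>k<N. (\<mu> k)\<^sup>2)))"
    by (intro sum_mono mult_left_mono each bern_nonneg) auto
  also have "\<dots> = exp (16 * (\<Sum>k<N. (\<mu> k)\<^sup>2))"
    by (simp add: sum_distrib_right[symmetric] sum_bern)
  finally show ?thesis .
qed

text \<open>The truncated matrix is not hollow, but its trace is at most \<open>frob2 / \<eta>\<close> because \<open>a\<close> is.\<close>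
lemma bern_exp_small_le:
  assumes \<eta>: "0 < \<eta>" and \<theta>: "0 \<le> \<theta>" "16 * (\<theta> * \<eta>)\<^sup>2 \<le> 1 / 2"
  shows "mean (\<lambda>s. exp (\<theta> * (\<Sum>k\<in>{k\<in>{..<N}. \<bar>d k\<bar> < \<eta>}. d k * (coord k (\<lambda>i. s i - t))\<^sup>2)))
    \<le> exp ((16 * \<theta>\<^sup>2 + 4 * \<theta> / \<eta>) * frob2)"
proof -
  define \<mu> where "\<mu> = (\<lambda>k. if \<bar>d k\<bar> < \<eta> then \<theta> * d k else 0)"
  let ?b = "\<lambda>i j. if i = j then 0 else spec \<mu> i j"
  have \<mu>2: "(\<mu> k)\<^sup>2 \<le> \<theta>\<^sup>2 * (d k)\<^sup>2" for k by (simp add: \<mu>_def power_mult_distrib)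
  have \<mu>3: "16 * (\<mu> k)\<^sup>2 \<le> 1 / 2" for k
  proof (cases "\<bar>d k\<bar> < \<eta>")
    case True
    then have "(d k)\<^sup>2 \<le> \<eta>\<^sup>2" using \<eta> by (simp add: abs_le_square_iff[symmetric])
    then have "16 * (\<mu> k)\<^sup>2 \<le> 16 * (\<theta> * \<eta>)\<^sup>2"
      using True by (simp add: \<mu>_def power_mult_distrib mult_left_mono)
    with \<theta> show ?thesis by simp
  qed (simp add: \<mu>_def)
  have diag: "(\<Sum>i<N. \<bar>spec \<mu> i i\<bar>) \<le> \<theta> / \<eta> * frob2"
  proof -
    have "(\<Sum>i<N. \<bar>spec \<mu> i i\<bar>) \<le> (\<Sum>i<N. \<Sum>k<N. \<theta> / \<eta> * (d k)\<^sup>2 * (u k i * u k i))"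
    proof (rule sum_mono)
      fix i assume "i \<in> {..<N}"
      \<comment> \<open>As \<open>a\<close> has zero diagonal, the diagonal of the truncation is
        minus that of the removed part, whose eigenvalues have modulus at least
        \<open>\<eta>\<close> and hence at most \<open>(d k)\<^sup>2 / \<eta>\<close>.\<close>
      then have "(\<Sum>k<N. d k * u k i * u k i) = 0" using a_eq[of i i] a_diag[of i] by simp
      then have "spec \<mu> i i = (\<Sum>k<N. \<mu> k * u k i * u k i) - \<theta> * (\<Sum>k<N. d k * u k i * u k i)"
        by (simp add: spec_def)
      also have "\<dots> = (\<Sum>k<N. (\<mu> k - \<theta> * d k) * (u k i * u k i))"
        by (simp add: sum_distrib_left sum_subtractf[symmetric] algebra_simps)
      finally have "\<bar>spec \<mu> i i\<bar> \<le> (\<Sum>k<N. \<bar>\<mu> k - \<theta> * d k\<bar> * (u k i * u k i))"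
        by (simp only:) (rule order_trans[OF sum_abs], simp add: abs_mult)
      also have "\<dots> \<le> (\<Sum>k<N. \<theta> / \<eta> * (d k)\<^sup>2 * (u k i * u k i))"
      proof (intro sum_mono mult_right_mono)
        fix k
        show "\<bar>\<mu> k - \<theta> * d k\<bar> \<le> \<theta> / \<eta> * (d k)\<^sup>2"
        proof (cases "\<bar>d k\<bar> < \<eta>")
          case False
          then have "\<theta> * (\<bar>d k\<bar> * \<eta>) \<le> \<theta> * (\<bar>d k\<bar> * \<bar>d k\<bar>)"
            using \<theta> by (intro mult_left_mono) auto
          then show ?thesis using False \<theta> \<eta>
            by (simp add: \<mu>_def abs_mult field_simps power2_eq_square)
        qed (use \<theta> \<eta> in \<open>simp add: \<mu>_def\<close>)
      qed auto
      finally show "\<bar>spec \<mu> i i\<bar> \<le> (\<Sum>k<N. \<theta> / \<eta> * (d k)\<^sup>2 * (u k i * u k i))" .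
    qed
    also have "\<dots> = (\<Sum>k<N. \<theta> / \<eta> * (d k)\<^sup>2 * (\<Sum>i<N. u k i * u k i))"
      by (subst sum.swap) (simp add: sum_distrib_left)
    also have "\<dots> = \<theta> / \<eta> * frob2" by (simp add: ortho frob2_eq sum_distrib_left)
    finally show ?thesis .
  qed
  have le: "\<theta> * (\<Sum>k\<in>{k\<in>{..<N}. \<bar>d k\<bar> < \<eta>}. d k * (coord k (\<lambda>i. s i - t))\<^sup>2)
      \<le> (\<Sum>i<N. \<Sum>j<N. ?b i j * (s i - t) * (s j - t)) + 4 * \<theta> / \<eta> * frob2" if s: "s \<in> cube N" for s
  proof -
    have "\<theta> * (\<Sum>k\<in>{k\<in>{..<N}. \<bar>d k\<bar> < \<eta>}. d k * (coord k (\<lambda>i. s i - t))\<^sup>2)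
        = (\<Sum>k<N. \<mu> k * (coord k (\<lambda>i. s i - t))\<^sup>2)"
      unfolding sum_distrib_left by (subst sum.inter_filter) (auto simp: \<mu>_def intro!: sum.cong)
    also have "\<dots> = (\<Sum>i<N. \<Sum>j<N. spec \<mu> i j * (s i - t) * (s j - t))" by (rule spec_quad[symmetric])
    also have "\<dots> = (\<Sum>i<N. (\<Sum>j<N. ?b i j * (s i - t) * (s j - t)) + spec \<mu> i i * (s i - t)\<^sup>2)"
    proof (intro sum.cong refl)
      fix i assume i: "i \<in> {..<N}"
      show "(\<Sum>j<N. spec \<mu> i j * (s i - t) * (s j - t))
          = (\<Sum>j<N. ?b i j * (s i - t) * (s j - t)) + spec \<mu> i i * (s i - t)\<^sup>2"
        using i by (simp add: sum.remove[of _ i] power2_eq_square mult.assoc)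
    qed
    also have "\<dots> \<le> (\<Sum>i<N. (\<Sum>j<N. ?b i j * (s i - t) * (s j - t)) + \<bar>spec \<mu> i i\<bar> * 4)"
    proof (intro sum_mono add_left_mono)
      fix i assume "i \<in> {..<N}"
      then have "\<bar>s i - t\<bar> \<le> 2" using cube_val[OF s, of i] abs_t_le_1 by auto
      then have "(s i - t)\<^sup>2 \<le> 2\<^sup>2" by (metis abs_ge_zero power2_abs power_mono)
      then show "spec \<mu> i i * (s i - t)\<^sup>2 \<le> \<bar>spec \<mu> i i\<bar> * 4"
        using mult_mono[of "spec \<mu> i i" "\<bar>spec \<mu> i i\<bar>" "(s i - t)\<^sup>2" 4] by simp
    qed
    also have "\<dots> = (\<Sum>i<N. \<Sum>j<N. ?b i j * (s i - t) * (s j - t)) + 4 * (\<Sum>i<N. \<bar>spec \<mu> i i\<bar>)"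
      by (simp add: sum.distrib sum_distrib_left mult.commute)
    also have "4 * (\<Sum>i<N. \<bar>spec \<mu> i i\<bar>) \<le> 4 * \<theta> / \<eta> * frob2" using diag by simp
    finally show ?thesis by simp
  qed
  have "mean (\<lambda>s. exp (\<theta> * (\<Sum>k\<in>{k\<in>{..<N}. \<bar>d k\<bar> < \<eta>}. d k * (coord k (\<lambda>i. s i - t))\<^sup>2)))
      \<le> mean (\<lambda>s. exp ((\<Sum>i<N. \<Sum>j<N. ?b i j * (s i - t) * (s j - t)) + 4 * \<theta> / \<eta> * frob2))"
    using le by (intro sum_mono mult_left_mono bern_nonneg[OF abs_t_le_1]) auto
  also have "\<dots> = mean (\<lambda>s. exp (\<Sum>i<N. \<Sum>j<N. ?b i j * (s i - t) * (s j - t)))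
      * exp (4 * \<theta> / \<eta> * frob2)"
    by (simp add: exp_add sum_distrib_right mult.assoc)
  also have "\<dots> \<le> exp (16 * (\<Sum>k<N. (\<mu> k)\<^sup>2)) * exp (4 * \<theta> / \<eta> * frob2)"
    by (intro mult_right_mono bern_exp_offdiag_le \<mu>3) auto
  also have "\<dots> = exp (16 * (\<Sum>k<N. (\<mu> k)\<^sup>2) + 4 * \<theta> / \<eta> * frob2)"
    by (rule exp_add[symmetric])
  also have "\<dots> \<le> exp ((16 * \<theta>\<^sup>2 + 4 * \<theta> / \<eta>) * frob2)"
  proof -
    have "(\<Sum>k<N. (\<mu> k)\<^sup>2) \<le> \<theta>\<^sup>2 * frob2"
      unfolding frob2_eq sum_distrib_left by (intro sum_mono \<mu>2)
    then show ?thesis by (simp add: algebra_simps)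
  qed
  finally show ?thesis .
qed

text \<open>Every eigendirection with \<open>\<eta> \<le> d k\<close> is linearised and costs the
  same constant. The gain of \<open>half_mgf_le\<close> is needed for direction 0 only; the others
  have a gap that covers the loss. At most \<open>frob2 / \<eta>\<^sup>2\<close> directions
  occur.\<close>

lemma half_exp_large_le:
  assumes half: "half_mgf_le \<beta> t \<kappa> N"
    and \<kappa>: "0 < \<kappa>" and p: "0 \<le> p" and \<eta>: "0 < \<eta>" "\<eta> \<le> d 0" and \<zeta>: "0 \<le> \<zeta>" "\<zeta> < 1"
    and overlap: "17 / 18 \<le> (\<Sum>i<N. u 0 i)\<^sup>2 / N"
    and b0: "p * d 0 * (1 - \<kappa> / 4) \<le> \<zeta>"
    and bk: "\<And>k. 0 < k \<Longrightarrow> k < N \<Longrightarrow> \<eta> \<le> d k \<Longrightarrow> p * d k * (1 + 49 * \<kappa>) \<le> \<zeta>"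
  defines "L \<equiv> {k\<in>{..<N}. \<eta> \<le> d k}"
  shows "(\<Sum>s\<in>half_cube N. bern N t s *
      exp (p * \<beta> / 2 * (\<Sum>k\<in>L. d k * (coord k (\<lambda>i. s i - t))\<^sup>2)))
    \<le> exp (ln (1 / sqrt (1 - \<zeta>)) / \<eta>\<^sup>2 * frob2)"
proof -
  let ?x = "\<lambda>s i. s i - t"
  let ?l = "\<lambda>k s. sqrt (p * \<beta> * d k) * coord k (?x s)"
  have fin: "finite L" and LN: "L \<subseteq> {..<N}" by (auto simp: L_def)
  have dL: "0 < d k" if "k \<in> L" for k using that \<eta> by (auto simp: L_def)
  have L0: "0 \<in> L" using N2 \<eta> by (simp add: L_def)
  \<comment> \<open>The coordinates of the constant unit vector in the eigenbasis.\<close>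
  define f where "f = (\<lambda>k. (\<Sum>i<N. u k i) / sqrt N)"
  have f_sum: "(\<Sum>k<N. (f k)\<^sup>2) = 1"
  proof -
    have "f k = coord k (\<lambda>_. 1 / sqrt N)" for k
      by (simp add: f_def coord_def sum_divide_distrib)
    then have "(\<Sum>k<N. (f k)\<^sup>2) = (\<Sum>i<N. (1 / sqrt (real N))\<^sup>2)"
      by (simp only: parseval[of "\<lambda>_. 1 / sqrt N"])
    also have "\<dots> = 1" using N2 by (simp add: power_divide)
    finally show ?thesis .
  qed
  have f0: "17 / 18 \<le> (f 0)\<^sup>2" using overlap by (simp add: f_def power_divide)
  have "half_mean (\<lambda>s. exp ((\<Sum>k\<in>L. (?l k s)\<^sup>2) / 2)) \<le> 1 * (\<Prod>k\<in>L. 1 / sqrt (1 - \<zeta>))"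
  proof (rule hubbard_stratonovich_sum[OF fin])
    fix c :: "nat \<Rightarrow> real"
    define z where "z = (\<lambda>k. c k * sqrt (p * d k))"
    define y where "y = (\<lambda>i. \<Sum>k\<in>L. (z k / sqrt \<beta>) * u k i)"
    have z2: "(z k)\<^sup>2 = (c k)\<^sup>2 * (p * d k)" if "k \<in> L" for k
      using that p dL[OF that] by (simp add: z_def power_mult_distrib)
    have lin: "(\<Sum>k\<in>L. c k * ?l k s) = \<beta> * (\<Sum>i<N. y i * (s i - t))" for s
    proof -
      have "\<beta> * (\<Sum>i<N. y i * (s i - t)) = (\<Sum>i<N. \<Sum>k\<in>L. \<beta> / sqrt \<beta> * z k * (u k i * (s i - t)))"
        by (simp add: y_def sum_distrib_left sum_distrib_right mult_ac)
      also have "\<dots> = (\<Sum>k\<in>L. \<beta> / sqrt \<beta> * z k * coord k (?x s))"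
        by (subst sum.swap) (simp add: coord_def sum_distrib_left)
      also have "\<dots> = (\<Sum>k\<in>L. c k * ?l k s)"
        using \<beta> by (intro sum.cong refl) (simp add: z_def real_sqrt_mult real_div_sqrt mult_ac)
      finally show ?thesis by simp
    qed
    have y2: "(\<Sum>i<N. (y i)\<^sup>2) = (\<Sum>k\<in>L. (z k)\<^sup>2) / \<beta>"
      unfolding y_def parseval_sub[OF LN] using \<beta> by (simp add: power_divide sum_divide_distrib)
    have sy: "(\<Sum>i<N. y i)\<^sup>2 / N = (\<Sum>k\<in>L. z k * f k)\<^sup>2 / \<beta>"
    proof -
      have "(\<Sum>i<N. y i) = (\<Sum>k\<in>L. z k / sqrt \<beta> * (\<Sum>i<N. u k i))"
        unfolding y_def by (subst sum.swap) (simp add: sum_distrib_left)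
      also have "\<dots> = sqrt N / sqrt \<beta> * (\<Sum>k\<in>L. z k * f k)"
      proof -
        have "(\<Sum>i<N. u k i) = sqrt N * f k" for k using N2 by (simp add: f_def)
        then show ?thesis by (simp add: sum_distrib_left mult_ac)
      qed
      finally show ?thesis using N2 \<beta> by (simp add: power_mult_distrib power_divide)
    qed
    let ?M = "L - {0}"
    define Z where "Z = (\<Sum>k\<in>?M. (z k)\<^sup>2)"
    define r where "r = (\<Sum>k\<in>?M. z k * f k)"
    have r2: "r\<^sup>2 \<le> Z"
    proof -
      have "r\<^sup>2 \<le> Z * (\<Sum>k\<in>?M. (f k)\<^sup>2)" unfolding r_def Z_def by (rule Cauchy_Schwarz_ineq_sum)
      also have "(\<Sum>k\<in>?M. (f k)\<^sup>2) \<le> (\<Sum>k<N. (f k)\<^sup>2)" using LN by (intro sum_mono2) auto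
      then have "Z * (\<Sum>k\<in>?M. (f k)\<^sup>2) \<le> Z * 1"
        unfolding f_sum by (intro mult_left_mono) (auto simp: Z_def intro: sum_nonneg)
      finally show ?thesis by simp
    qed
    have "(1 + 4 * \<kappa>) * (\<Sum>k\<in>L. (z k)\<^sup>2) - 5 * \<kappa> * (\<Sum>k\<in>L. z k * f k)\<^sup>2
        = (1 + 4 * \<kappa>) * ((z 0)\<^sup>2 + Z) - 5 * \<kappa> * (z 0 * f 0 + r)\<^sup>2"
      using L0 fin by (simp add: sum.remove[of L 0] Z_def r_def)
    \<comment> \<open>From (x + r)^2 \<ge> 9/10 x^2 - 9 r^2 and 9/10 * 17/18 = 17/20. Multiplied by
      \<open>5 * \<kappa>\<close> this gains 17/4 \<kappa>, that is \<kappa>/4 beyond the loss of 4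
      \<kappa>; the other directions lose 4 \<kappa> + 45 \<kappa>.\<close>
    also have "\<dots> \<le> (1 - \<kappa> / 4) * (z 0)\<^sup>2 + (1 + 49 * \<kappa>) * Z"
    proof -
      have "17 / 18 * (z 0)\<^sup>2 \<le> (f 0)\<^sup>2 * (z 0)\<^sup>2" using f0 by (intro mult_right_mono) auto
      then have 1: "17 / 20 * (z 0)\<^sup>2 \<le> 9 / 10 * (z 0 * f 0)\<^sup>2" by (simp add: power_mult_distrib mult.commute)
      have "(z 0 * f 0 + r)\<^sup>2 - (9 / 10 * (z 0 * f 0)\<^sup>2 - 9 * r\<^sup>2) = (z 0 * f 0 + 10 * r)\<^sup>2 / 10"
        by (simp add: power2_eq_square field_simps)
      moreover have "0 \<le> (z 0 * f 0 + 10 * r)\<^sup>2 / 10" by simp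
      ultimately have "9 / 10 * (z 0 * f 0)\<^sup>2 - 9 * r\<^sup>2 \<le> (z 0 * f 0 + r)\<^sup>2" by linarith
      with 1 r2 have "17 / 20 * (z 0)\<^sup>2 - 9 * Z \<le> (z 0 * f 0 + r)\<^sup>2" by linarith
      from mult_left_mono[OF this, of "5 * \<kappa>"] \<kappa>
      have "5 * \<kappa> * (17 / 20 * (z 0)\<^sup>2 - 9 * Z) \<le> 5 * \<kappa> * (z 0 * f 0 + r)\<^sup>2" by simp
      then show ?thesis by (simp add: algebra_simps)
    qed
    also have "\<dots> \<le> (\<Sum>k\<in>L. \<zeta> * (c k)\<^sup>2)"
    proof -
      have "(1 - \<kappa> / 4) * (z 0)\<^sup>2 = (p * d 0 * (1 - \<kappa> / 4)) * (c 0)\<^sup>2"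
        by (simp add: z2[OF L0] mult_ac)
      also have "\<dots> \<le> \<zeta> * (c 0)\<^sup>2" using b0 by (intro mult_right_mono) auto
      finally have 1: "(1 - \<kappa> / 4) * (z 0)\<^sup>2 \<le> \<zeta> * (c 0)\<^sup>2" .
      have "(1 + 49 * \<kappa>) * Z = (\<Sum>k\<in>?M. (p * d k * (1 + 49 * \<kappa>)) * (c k)\<^sup>2)"
        unfolding Z_def sum_distrib_left by (intro sum.cong refl) (auto simp: z2 mult_ac)
      also have "\<dots> \<le> (\<Sum>k\<in>?M. \<zeta> * (c k)\<^sup>2)"
        using bk by (intro sum_mono mult_right_mono) (auto simp: L_def)
      finally show ?thesis using 1 L0 fin by (simp add: sum.remove[of L 0])
    qed
    finally have fin_le: "(1 + 4 * \<kappa>) * (\<Sum>k\<in>L. (z k)\<^sup>2) - 5 * \<kappa> * (\<Sum>k\<in>L. z k * f k)\<^sup>2 \<le> (\<Sum>k\<in>L. \<zeta> * (c k)\<^sup>2)" .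
    have "half_mean (\<lambda>s. exp (\<Sum>k\<in>L. c k * ?l k s))
        \<le> exp (\<beta> / 2 * ((1 + 4 * \<kappa>) * (\<Sum>i<N. (y i)\<^sup>2) - 5 * \<kappa> * ((\<Sum>i<N. y i)\<^sup>2 / real N)))"
      unfolding lin using half by (simp only: half_mgf_le_def)
    also have "\<beta> / 2 * ((1 + 4 * \<kappa>) * (\<Sum>i<N. (y i)\<^sup>2) - 5 * \<kappa> * ((\<Sum>i<N. y i)\<^sup>2 / real N))
        = ((1 + 4 * \<kappa>) * (\<Sum>k\<in>L. (z k)\<^sup>2) - 5 * \<kappa> * (\<Sum>k\<in>L. z k * f k)\<^sup>2) / 2"
      unfolding y2 sy using \<beta> by (simp add: field_simps)
    also have "exp \<dots> \<le> exp ((\<Sum>k\<in>L. \<zeta> * (c k)\<^sup>2) / 2)" using fin_le by simp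
    finally show "half_mean (\<lambda>s. exp (\<Sum>k\<in>L. c k * ?l k s)) \<le> 1 * exp ((\<Sum>k\<in>L. \<zeta> * (c k)\<^sup>2) / 2)"
      by simp
  qed (use \<zeta> in auto)
  moreover have "(\<Sum>k\<in>L. (?l k s)\<^sup>2) / 2 = p * \<beta> / 2 * (\<Sum>k\<in>L. d k * (coord k (?x s))\<^sup>2)" for s
    using p \<beta> dL by (simp add: power_mult_distrib sum_distrib_left less_imp_le sum_divide_distrib mult_ac)
  ultimately have "half_mean (\<lambda>s. exp (p * \<beta> / 2 * (\<Sum>k\<in>L. d k * (coord k (?x s))\<^sup>2)))
      \<le> (1 / sqrt (1 - \<zeta>)) ^ card L" by simp
  also have "\<dots> = exp (real (card L) * ln (1 / sqrt (1 - \<zeta>)))"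
    using \<zeta> by (subst exp_of_nat_mult) simp
  also have "\<dots> \<le> exp (ln (1 / sqrt (1 - \<zeta>)) / \<eta>\<^sup>2 * frob2)"
  proof -
    have "real (card L) * \<eta>\<^sup>2 = (\<Sum>k\<in>L. \<eta>\<^sup>2)" by simp
    also have "\<dots> \<le> (\<Sum>k\<in>L. (d k)\<^sup>2)" using \<eta> by (intro sum_mono power_mono) (auto simp: L_def)
    also have "\<dots> \<le> frob2" unfolding frob2_eq using LN by (intro sum_mono2) auto
    finally have "real (card L) \<le> frob2 / \<eta>\<^sup>2" using \<eta> by (simp add: field_simps)
    moreover have "0 \<le> ln (1 / sqrt (1 - \<zeta>))" using \<zeta> by (intro ln_ge_zero) simp
    ultimately have "real (card L) * ln (1 / sqrt (1 - \<zeta>)) \<le> frob2 / \<eta>\<^sup>2 * ln (1 / sqrt (1 - \<zeta>))"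
      by (rule mult_right_mono)
    then show ?thesis by (simp add: mult_ac)
  qed
  finally show ?thesis .
qed

section \<open>All terms of the exponent together\<close>

definition rho :: "nat \<Rightarrow> real" where "rho i = (\<Sum>j<N. a i j) - 1"

definition rho2 :: real where "rho2 = (\<Sum>i<N. (rho i)\<^sup>2)"

definition deviation :: "real \<Rightarrow> (nat \<Rightarrow> real) \<Rightarrow> real" where
  "deviation m s = (\<Sum>i<N. s i - m)\<^sup>2 / N + (\<Sum>i<N. (\<Sum>j<N. a i j * (s j - m))\<^sup>2)
     + \<bar>\<Sum>i<N. rho i * (s i - m)\<bar>"

definition energy :: "(nat \<Rightarrow> real) \<Rightarrow> real" where
  "energy s = (\<Sum>i<N. \<Sum>j<N. a i j * s i * s j)"

lemma frob2_nonneg: "0 \<le> frob2" and rho2_nonneg: "0 \<le> rho2"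
  unfolding frob2_def rho2_def by (intro sum_nonneg; simp)+

text \<open>Large eigenvalues take the exponent \<open>p\<close>, everything else takes
  \<open>q\<close> and then a further factor 5 for its five terms. With 80 = 5 * 16 each part of the
  deviation ends up with the factor 1/16, for which proxy 1 suffices. The 8 adds up the individual
  bounds, two of which count twice.\<close>

lemma half_exp_le:
  assumes half: "half_mgf_le \<beta> t \<kappa> N"
    and \<kappa>: "0 < \<kappa>" and \<eta>: "0 < \<eta>" "\<eta> \<le> d 0" and \<zeta>: "0 \<le> \<zeta>" "\<zeta> < 1"
    and overlap: "17 / 18 \<le> (\<Sum>i<N. u 0 i)\<^sup>2 / N"
    and b0: "p * d 0 * (1 - \<kappa> / 4) \<le> \<zeta>"
    and bk: "\<And>k. 0 < k \<Longrightarrow> k < N \<Longrightarrow> \<eta> \<le> d k \<Longrightarrow> p * d k * (1 + 49 * \<kappa>) \<le> \<zeta>"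
    and p: "1 < p" and q: "q = p / (p - 1)" and \<eta>2: "16 * (5 * q * \<beta> / 2 * \<eta>)\<^sup>2 \<le> 1 / 2" and d2: "d 0 \<le> 2"
  defines "C \<equiv> ln (1 / sqrt (1 - \<zeta>)) / \<eta>\<^sup>2 + (16 * (5 * q * \<beta> / 2)\<^sup>2 + 4 * (5 * q * \<beta> / 2) / \<eta>)
      + (5 * q * \<beta> * t)\<^sup>2 + 1"
  shows "(\<Sum>s\<in>half_cube N. bern N t s *
      exp (\<beta> / 2 * energy (\<lambda>i. s i - t) + \<beta> * t * (\<Sum>i<N. rho i * (s i - t)) + 1 / (80 * q) * deviation t s))
    \<le> 8 * exp (C * (frob2 + rho2))"
proof -
  let ?x = "\<lambda>s i. s i - t"
  let ?L = "{k\<in>{..<N}. \<eta> \<le> d k}" and ?S = "{k\<in>{..<N}. \<bar>d k\<bar> < \<eta>}"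
  let ?E = "exp (C * (frob2 + rho2))"
  define \<theta> where "\<theta> = 5 * q * \<beta> / 2"
  have q0: "1 < q" unfolding q using p by (simp add: field_simps)
  have \<theta>0: "0 < \<theta>" using q0 \<beta> by (simp add: \<theta>_def)
  define Lg where "Lg = (\<lambda>s. \<Sum>k\<in>?L. d k * (coord k (?x s))\<^sup>2)"
  define Sm where "Sm = (\<lambda>s. \<Sum>k\<in>?S. d k * (coord k (?x s))\<^sup>2)"
  define rx where "rx = (\<lambda>s. \<Sum>i<N. rho i * (s i - t))"
  define D1 where "D1 = (\<lambda>s. (\<Sum>i<N. s i - t)\<^sup>2 / N)"
  define D2 where "D2 = (\<lambda>s. \<Sum>i<N. (\<Sum>j<N. a i j * (s j - t))\<^sup>2)"
  have D2_eq: "D2 s = (\<Sum>k<N. (d k)\<^sup>2 * (coord k (?x s))\<^sup>2)" for s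
    unfolding D2_def spec_norm[symmetric] by (intro sum.cong refl) (simp add: a_spec)
  \<comment> \<open>Eigenvalues at most \<open>- \<eta>\<close> contribute nonpositive terms and are
    dropped.\<close>
  have energy_le: "energy (?x s) \<le> Lg s + Sm s" for s
  proof -
    have "energy (?x s) = (\<Sum>i<N. \<Sum>j<N. spec d i j * ?x s i * ?x s j)"
      unfolding energy_def by (intro sum.cong refl) (simp add: a_spec)
    also have "\<dots> = (\<Sum>k<N. d k * (coord k (?x s))\<^sup>2)" by (rule spec_quad)
    also have "\<dots> \<le> (\<Sum>k<N. (if \<eta> \<le> d k then d k * (coord k (?x s))\<^sup>2 else 0)
        + (if \<bar>d k\<bar> < \<eta> then d k * (coord k (?x s))\<^sup>2 else 0))"
      using \<eta> by (intro sum_mono) (auto intro: mult_nonpos_nonneg)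
    also have "\<dots> = Lg s + Sm s"
      by (simp add: sum.distrib Lg_def Sm_def sum.inter_filter[symmetric])
    finally show ?thesis .
  qed
  have ln0: "0 \<le> ln (1 / sqrt (1 - \<zeta>)) / \<eta>\<^sup>2" using \<zeta> by (intro divide_nonneg_nonneg ln_ge_zero) simp_all
  have \<theta>\<eta>: "0 \<le> 16 * \<theta>\<^sup>2 + 4 * \<theta> / \<eta>" using \<theta>0 \<eta> by simp
  have C_alt: "C = ln (1 / sqrt (1 - \<zeta>)) / \<eta>\<^sup>2 + (16 * \<theta>\<^sup>2 + 4 * \<theta> / \<eta>) + (5 * q * \<beta> * t)\<^sup>2 + 1"
    by (simp add: C_def \<theta>_def)
  have leC: "exp (x * frob2) \<le> ?E" "exp (x * rho2) \<le> ?E" if "x \<le> C" for x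
  proof -
    have "0 \<le> C" using ln0 \<theta>\<eta> zero_le_power2[of "5 * q * \<beta> * t"] by (simp only: C_alt)
    then have "0 \<le> C * frob2" "0 \<le> C * rho2" using frob2_nonneg rho2_nonneg by auto
    then have "x * frob2 \<le> C * frob2 + C * rho2" "x * rho2 \<le> C * frob2 + C * rho2"
      using mult_right_mono[OF that frob2_nonneg] mult_right_mono[OF that rho2_nonneg] by linarith+
    then show "exp (x * frob2) \<le> ?E" "exp (x * rho2) \<le> ?E" by (simp_all add: distrib_left)
  qed
  have sub: "half_mean (\<lambda>s. exp (F s)) \<le> mean (\<lambda>s. exp (F s))" for F
    by (intro sum_mono2 finite_cube) (auto intro!: mult_nonneg_nonneg bern_nonneg abs_t_le_1)
  have T0: "half_mean (\<lambda>s. exp (p * \<beta> / 2 * Lg s)) \<le> ?E"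
  proof -
    have "half_mean (\<lambda>s. exp (p * \<beta> / 2 * Lg s)) \<le> exp (ln (1 / sqrt (1 - \<zeta>)) / \<eta>\<^sup>2 * frob2)"
      unfolding Lg_def by (rule half_exp_large_le[OF half \<kappa> _ \<eta> \<zeta> overlap b0 bk]) (use p in auto)
    also have "\<dots> \<le> ?E" using ln0 \<theta>\<eta> zero_le_power2[of "5 * q * \<beta> * t"] by (intro leC) (simp only: C_alt)
    finally show ?thesis .
  qed
  have T1: "mean (\<lambda>s. exp (\<theta> * Sm s)) \<le> ?E"
  proof -
    have "mean (\<lambda>s. exp (\<theta> * Sm s)) \<le> exp ((16 * \<theta>\<^sup>2 + 4 * \<theta> / \<eta>) * frob2)"
      unfolding Sm_def by (rule bern_exp_small_le) (use \<eta> \<theta>0 \<eta>2 in \<open>auto simp: \<theta>_def\<close>)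
    also have "\<dots> \<le> ?E" using ln0 \<theta>\<eta> zero_le_power2[of "5 * q * \<beta> * t"] by (intro leC) (simp only: C_alt)
    finally show ?thesis .
  qed
  have lin: "mean (\<lambda>s. exp (b * rx s)) \<le> exp (b\<^sup>2 / 2 * rho2)" for b
  proof -
    have "b * rx s = (\<Sum>i<N. (b * rho i) * (s i - t))" for s by (simp add: rx_def sum_distrib_left mult_ac)
    then show ?thesis using bern_exp_le[of "\<lambda>i. b * rho i"]
      by (simp add: rho2_def power_mult_distrib sum_distrib_left[symmetric])
  qed
  have T2: "mean (\<lambda>s. exp (5 * (q * (\<beta> * t * rx s)))) \<le> ?E"
  proof -
    have "mean (\<lambda>s. exp (5 * (q * (\<beta> * t * rx s)))) \<le> exp ((5 * q * \<beta> * t)\<^sup>2 / 2 * rho2)"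
      using lin[of "5 * q * \<beta> * t"] by (simp add: mult.assoc)
    also have "\<dots> \<le> ?E" using ln0 \<theta>\<eta> zero_le_power2[of "5 * q * \<beta> * t"] by (intro leC) (simp only: C_alt)
    finally show ?thesis .
  qed
  have C1: "1 \<le> C" using ln0 \<theta>\<eta> zero_le_power2[of "5 * q * \<beta> * t"] by (simp only: C_alt)
  have E1: "1 \<le> ?E" using C1 frob2_nonneg rho2_nonneg by simp
  have T3: "mean (\<lambda>s. exp (D1 s / 16)) \<le> 2 * ?E"
  proof -
    let ?l = "\<lambda>s. (\<Sum>i<N. s i - t) / sqrt (8 * N)"
    have "mean (\<lambda>s. exp ((?l s)\<^sup>2 / 2)) \<le> 1 / sqrt (1 - 1 / 8)"
    proof (rule hubbard_stratonovich)
      fix h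
      have "h * ?l s = (\<Sum>i<N. (h / sqrt (8 * N)) * (s i - t))" for s
        by (simp add: sum_distrib_left sum_divide_distrib)
      then have "mean (\<lambda>s. exp (h * ?l s)) \<le> exp ((\<Sum>i<N. (h / sqrt (8 * N))\<^sup>2) / 2)"
        using bern_exp_le[of "\<lambda>_. h / sqrt (8 * N)"] by simp
      also have "(\<Sum>i<N. (h / sqrt (8 * N))\<^sup>2) = h\<^sup>2 / 8"
        using N2 by (simp add: power_divide)
      finally show "mean (\<lambda>s. exp (h * ?l s)) \<le> 1 * exp (1 / 8 * h\<^sup>2 / 2)" by simp
    qed auto
    also have "1 / sqrt (1 - 1 / 8) \<le> (2::real)"
    proof -
      have "1 / 2 \<le> sqrt (1 - 1 / 8)" by (rule real_le_rsqrt) (simp add: power2_eq_square)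
      then show ?thesis by (simp add: field_simps)
    qed
    finally have "mean (\<lambda>s. exp ((?l s)\<^sup>2 / 2)) \<le> 2" .
    moreover have "(?l s)\<^sup>2 / 2 = D1 s / 16" for s
      by (simp add: D1_def power_divide)
    ultimately have "mean (\<lambda>s. exp (D1 s / 16)) \<le> 2" by (simp only:)
    with E1 show ?thesis by linarith
  qed
  have T4: "mean (\<lambda>s. exp (D2 s / 16)) \<le> ?E"
  proof -
    have "mean (\<lambda>s. exp ((\<Sum>k<N. (d k)\<^sup>2 / 8 * (\<Sum>i\<in>{..<N}. u k i * (s i - t))\<^sup>2) / 2))
      \<le> exp (\<Sum>k<N. (d k)\<^sup>2 / 8)"
    proof (rule bern_exp_quad_le)
      fix k assume "k < N"
      then have "\<bar>d k\<bar> \<le> 2" using abs_d_le d2 by (meson order_trans)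
      then have "(d k)\<^sup>2 \<le> 2\<^sup>2" by (metis abs_ge_zero power2_abs power_mono)
      then show "(d k)\<^sup>2 / 8 \<le> 1 / 2" by simp
    qed auto
    also have "(\<Sum>k<N. (d k)\<^sup>2 / 8) = 1 / 8 * frob2" by (simp add: frob2_eq sum_divide_distrib)
    also have "exp (1 / 8 * frob2) \<le> ?E" using C1 by (intro leC) simp
    finally show ?thesis
      by (simp add: D2_eq coord_def sum_divide_distrib mult_ac)
  qed
  have T5: "mean (\<lambda>s. exp (\<bar>rx s\<bar> / 16)) \<le> ?E + ?E"
  proof -
    have "exp (\<bar>rx s\<bar> / 16) \<le> exp (1 / 16 * rx s) + exp (- 1 / 16 * rx s)" for s
    proof (cases "0 \<le> rx s")
      case True
      then show ?thesis using exp_gt_zero[of "- 1 / 16 * rx s"] by simp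
    next
      case False
      then show ?thesis using exp_gt_zero[of "1 / 16 * rx s"] by simp
    qed
    then have "mean (\<lambda>s. exp (\<bar>rx s\<bar> / 16))
      \<le> mean (\<lambda>s. (exp (1 / 16 * rx s) + exp (- 1 / 16 * rx s)))"
      by (intro sum_mono mult_left_mono bern_nonneg abs_t_le_1)
    also have "\<dots> \<le> exp ((1 / 16)\<^sup>2 / 2 * rho2) + exp ((- 1 / 16)\<^sup>2 / 2 * rho2)"
      unfolding distrib_left[of "bern N t _"] sum.distrib by (intro add_mono lin)
    also have "\<dots> \<le> ?E + ?E" using C1 by (intro add_mono leC) (simp_all add: power2_eq_square)
    finally show ?thesis .
  qed
  have pt: "exp (\<beta> / 2 * energy (?x s) + \<beta> * t * rx s + 1 / (80 * q) * deviation t s)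
      \<le> exp (p * \<beta> / 2 * Lg s) + (exp (\<theta> * Sm s) + exp (5 * (q * (\<beta> * t * rx s)))
        + exp (D1 s / 16) + exp (D2 s / 16) + exp (\<bar>rx s\<bar> / 16))" for s
  proof -
    let ?V = "\<beta> / 2 * Sm s + \<beta> * t * rx s + 1 / (80 * q) * deviation t s"
    have dev: "deviation t s = D1 s + D2 s + \<bar>rx s\<bar>"
      by (simp add: deviation_def D1_def D2_def rx_def)
    have "\<beta> / 2 * energy (?x s) \<le> \<beta> / 2 * (Lg s + Sm s)" using energy_le[of s] \<beta> by (intro mult_left_mono) auto
    then have "exp (\<beta> / 2 * energy (?x s) + \<beta> * t * rx s + 1 / (80 * q) * deviation t s) \<le> exp (\<beta> / 2 * Lg s + ?V)"
      by (simp add: algebra_simps)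
    also have "\<dots> \<le> exp (p * (\<beta> / 2 * Lg s)) + exp (q * ?V)" by (rule exp_add_le_conjugate[OF p q])
    also have "q * ?V = q * (\<beta> / 2 * Sm s) + q * (\<beta> * t * rx s) + D1 s / 80 + D2 s / 80 + \<bar>rx s\<bar> / 80"
      using q0 by (simp add: dev field_simps)
    also have "exp \<dots> \<le> exp (5 * (q * (\<beta> / 2 * Sm s))) + exp (5 * (q * (\<beta> * t * rx s)))
        + exp (5 * (D1 s / 80)) + exp (5 * (D2 s / 80)) + exp (5 * (\<bar>rx s\<bar> / 80))"
      by (rule exp_add5_le)
    finally show ?thesis by (simp add: \<theta>_def mult.assoc)
  qed
  have "half_mean (\<lambda>s. exp (\<beta> / 2 * energy (?x s) + \<beta> * t * rx s + 1 / (80 * q) * deviation t s))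
      \<le> half_mean (\<lambda>s. (exp (p * \<beta> / 2 * Lg s) + (exp (\<theta> * Sm s) + exp (5 * (q * (\<beta> * t * rx s)))
        + exp (D1 s / 16) + exp (D2 s / 16) + exp (\<bar>rx s\<bar> / 16))))"
    by (intro sum_mono mult_left_mono pt bern_nonneg abs_t_le_1) simp
  also have "\<dots> \<le> ?E + (?E + ?E + 2 * ?E + ?E + (?E + ?E))"
    unfolding distrib_left[of "bern N t _"] sum.distrib
    by (intro add_mono T0 order_trans[OF sub T1] order_trans[OF sub T2] order_trans[OF sub T3]
        order_trans[OF sub T4] order_trans[OF sub T5])
  finally show ?thesis by (simp add: rx_def)
qed

section \<open>The Ising measure\<close>

definition weight :: "(nat \<Rightarrow> real) \<Rightarrow> real" where "weight s = exp (\<beta> / 2 * energy s)"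

definition mag :: "(nat \<Rightarrow> real) \<Rightarrow> real" where "mag s = (if 0 \<le> sum s {..<N} then t else - t)"

text \<open>The constant by which the Ising weight exceeds the tilted product density: the cosh
  factors normalise \<open>bern\<close>, and the exponential holds the terms of the expansion at
  \<open>t\<close> that do not depend on the spins.\<close>

definition norm_const :: real where
  "norm_const = (2 * cosh (\<beta> * t)) ^ N * exp (\<beta> / 2 * t\<^sup>2 * (\<Sum>i<N. rho i - 1))"

lemma energy_shift:
  "energy s = energy (\<lambda>i. s i - t) + 2 * t * (\<Sum>i<N. (rho i + 1) * (s i - t)) + t\<^sup>2 * (\<Sum>i<N. rho i + 1)"
proof -
  have sw: "(\<Sum>i<N. \<Sum>j<N. a i j * (s j - t)) = (\<Sum>i<N. \<Sum>j<N. a i j * (s i - t))"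
    by (subst sum.swap) (intro sum.cong refl, simp add: a_sym)
  have "energy s = (\<Sum>i<N. \<Sum>j<N. a i j * (s i - t) * (s j - t) + t * (a i j * (s i - t))
      + t * (a i j * (s j - t)) + t\<^sup>2 * a i j)"
    unfolding energy_def by (intro sum.cong refl) (simp add: algebra_simps power2_eq_square)
  also have "\<dots> = energy (\<lambda>i. s i - t) + 2 * t * (\<Sum>i<N. \<Sum>j<N. a i j * (s i - t)) + t\<^sup>2 * (\<Sum>i<N. \<Sum>j<N. a i j)"
    by (simp add: sum.distrib sum_distrib_left[symmetric] sw energy_def)
  finally show ?thesis by (simp add: rho_def sum_distrib_right)
qed

text \<open>If all row sums were 1, the linear part of the energy expanded at \<open>t\<close> would
  be the constant field \<open>\<beta> * t\<close>, and by the fixed point equation that field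
  produces independent spins of mean \<open>t\<close>. \<open>rho\<close> carries the
  difference.\<close>

lemma weight_eq:
  assumes s: "s \<in> cube N"
  shows "weight s = norm_const * (bern N t s *
    exp (\<beta> / 2 * energy (\<lambda>i. s i - t) + \<beta> * t * (\<Sum>i<N. rho i * (s i - t))))"
proof -
  have c0: "cosh (\<beta> * t) \<noteq> 0" by (rule cosh_real_nonzero)
  have one: "(1 + t * s i) / 2 = exp (\<beta> * t * s i) / (2 * cosh (\<beta> * t))" if "i < N" for i
  proof -
    have "t = sinh (\<beta> * t) / cosh (\<beta> * t)" using t(2) by (simp add: tanh_def)
    then have tc: "t * cosh (\<beta> * t) = sinh (\<beta> * t)" using c0 by (metis nonzero_eq_divide_eq)
    from cube_val[OF s that] show ?thesis
    proof
      assume "s i = 1"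
      have "(1 + t) * cosh (\<beta> * t) = exp (\<beta> * t)"
        by (simp add: distrib_right tc cosh_plus_sinh)
      then have "1 + t = exp (\<beta> * t) / cosh (\<beta> * t)" using c0 by (metis nonzero_eq_divide_eq)
      with \<open>s i = 1\<close> show ?thesis by simp
    next
      assume "s i = - 1"
      have "(1 - t) * cosh (\<beta> * t) = exp (- (\<beta> * t))"
        by (simp add: left_diff_distrib tc cosh_minus_sinh)
      then have "1 - t = exp (- (\<beta> * t)) / cosh (\<beta> * t)" using c0 by (metis nonzero_eq_divide_eq)
      with \<open>s i = - 1\<close> show ?thesis by simp
    qed
  qed
  have "bern N t s = exp (\<beta> * t * sum s {..<N}) / (2 * cosh (\<beta> * t)) ^ N"
    unfolding bern_def by (simp add: one prod_dividef exp_sum[symmetric] sum_distrib_left)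
  then have b: "exp (\<beta> * t * sum s {..<N}) = (2 * cosh (\<beta> * t)) ^ N * bern N t s" using c0 by simp
  have en: "\<beta> / 2 * energy s = \<beta> * t * sum s {..<N} + \<beta> / 2 * t\<^sup>2 * (\<Sum>i<N. rho i - 1)
      + (\<beta> / 2 * energy (\<lambda>i. s i - t) + \<beta> * t * (\<Sum>i<N. rho i * (s i - t)))"
  proof -
    have "(\<Sum>i<N. (rho i + 1) * (s i - t)) = (\<Sum>i<N. rho i * (s i - t)) + (sum s {..<N} - N * t)"
      by (simp add: distrib_right sum.distrib sum_subtractf)
    moreover have "(\<Sum>i<N. rho i + 1) = (\<Sum>i<N. rho i - 1) + 2 * N"
      by (simp add: sum.distrib sum_subtractf)
    note eqs = this calculation
    show ?thesis unfolding energy_shift[of s] eqs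
      by (simp add: algebra_simps power2_eq_square)
  qed
  show ?thesis unfolding weight_def norm_const_def en exp_add b by (simp only: mult_ac)
qed

lemma norm_const_pos: "0 < norm_const"
  unfolding norm_const_def by (simp add: cosh_real_pos)

text \<open>The exponent in \<open>weight_eq\<close> has mean zero, because the independent spins
  are centred at \<open>t\<close> and \<open>a\<close> has no diagonal.\<close>

lemma norm_const_le: "norm_const \<le> (\<Sum>s\<in>cube N. weight s)"
proof -
  let ?x = "\<lambda>s i. s i - t"
  let ?Y = "\<lambda>s. \<beta> / 2 * energy (?x s) + \<beta> * t * (\<Sum>i<N. rho i * ?x s i)"
  have m1: "(\<Sum>s\<in>cube N. bern N t s * ?x s i) = 0" if "i < N" for i
    using sum_bern_single[OF that, of t "\<lambda>v. v - t"] by (simp add: field_simps)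
  have m2: "mean (\<lambda>s. (?x s i * ?x s j)) = 0" if "i < N" "j < N" "i \<noteq> j" for i j
    using sum_bern_pair[OF that, of t "\<lambda>v. v - t" "\<lambda>v. v - t"] by (simp add: field_simps)
  have "mean (\<lambda>s. energy (?x s))
      = (\<Sum>i<N. \<Sum>j<N. \<Sum>s\<in>cube N. a i j * (bern N t s * (?x s i * ?x s j)))"
    unfolding energy_def sum_distrib_left
    by (rule trans[OF sum.swap], rule sum.cong[OF refl], rule trans[OF sum.swap])
       (simp add: mult_ac)
  also have "\<dots> = (\<Sum>i<N. \<Sum>j<N. a i j * mean (\<lambda>s. (?x s i * ?x s j)))"
    by (simp add: sum_distrib_left)
  also have "\<dots> = 0"
  proof (intro sum.neutral ballI)
    fix i j assume "i \<in> {..<N}" "j \<in> {..<N}"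
    then show "a i j * mean (\<lambda>s. (?x s i * ?x s j)) = 0"
      using m2[of i j] a_diag[of i] by (cases "i = j") auto
  qed
  finally have e: "mean (\<lambda>s. energy (?x s)) = 0" .
  have "mean (\<lambda>s. (\<Sum>i<N. rho i * ?x s i)) = (\<Sum>i<N. rho i * (\<Sum>s\<in>cube N. bern N t s * ?x s i))"
    unfolding sum_distrib_left by (rule trans[OF sum.swap]) (simp add: mult_ac)
  then have l: "mean (\<lambda>s. (\<Sum>i<N. rho i * ?x s i)) = 0" by (simp add: m1)
  have "1 = mean (\<lambda>s. (1 + ?Y s))"
  proof -
    have "mean (\<lambda>s. (1 + (\<beta> / 2 * f s + \<beta> * t * g s))) = (\<Sum>s\<in>cube N. bern N t s)
        + \<beta> / 2 * (\<Sum>s\<in>cube N. bern N t s * f s) + \<beta> * t * (\<Sum>s\<in>cube N. bern N t s * g s)" for f g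
      by (simp add: distrib_left sum.distrib sum_distrib_left mult_ac)
    note this[of "\<lambda>s. energy (?x s)" "\<lambda>s. \<Sum>i<N. rho i * ?x s i"]
    then show ?thesis unfolding e l by (simp add: sum_bern)
  qed
  also have "\<dots> \<le> mean (\<lambda>s. exp (?Y s))"
    by (intro sum_mono mult_left_mono bern_nonneg abs_t_le_1 exp_ge_add_one_self)
  finally have "norm_const * 1 \<le> norm_const * mean (\<lambda>s. exp (?Y s))"
    using norm_const_pos by (intro mult_left_mono) auto
  also have "\<dots> = (\<Sum>s\<in>cube N. weight s)"
    unfolding sum_distrib_left[of norm_const] by (intro sum.cong refl) (simp only: weight_eq)
  finally show ?thesis by simp
qed

text \<open>The global spin flip; \<open>undefined\<close> off the sites keeps the configuration
  extensional.\<close>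

lemma sum_cube_neg:
  "(\<Sum>s\<in>cube N. F s) = (\<Sum>s\<in>cube N. F (\<lambda>i. if i < N then - s i else undefined))"
  by (rule sym, rule sum.reindex_bij_witness[of _ "\<lambda>s i. if i < N then - s i else undefined"
        "\<lambda>s i. if i < N then - s i else undefined"])
     (auto simp: cube_def PiE_iff extensional_def fun_eq_iff)

lemma energy_neg: "energy (\<lambda>i. if i < N then - s i else undefined) = energy s"
  unfolding energy_def by (intro sum.cong refl) auto

lemma deviation_neg: "deviation (- m) (\<lambda>i. if i < N then - s i else undefined) = deviation m s"
proof -
  have 1: "(\<Sum>i<N. (if i < N then - s i else undefined) - - m) = - (\<Sum>i<N. s i - m)"
    by (simp add: sum_negf[symmetric])
  have 2: "(\<Sum>j<N. a i j * ((if j < N then - s j else undefined) - - m)) = - (\<Sum>j<N. a i j * (s j - m))" for i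
    unfolding sum_negf[symmetric] by (intro sum.cong refl) (simp add: algebra_simps)
  have 3: "(\<Sum>i<N. rho i * ((if i < N then - s i else undefined) - - m)) = - (\<Sum>i<N. rho i * (s i - m))"
    unfolding sum_negf[symmetric] by (intro sum.cong refl) (simp add: algebra_simps)
  show ?thesis unfolding deviation_def 1 2 3 by simp
qed

lemma deviation_nonneg: "0 \<le> deviation m s"
  unfolding deviation_def by (intro add_nonneg_nonneg sum_nonneg) auto

text \<open>Here the two phases are joined by the global flip, and the exponential moment becomes a
  first moment whose bound is linear in the logarithm \<open>c\<close>.\<close>

lemma moment_le:
  assumes S: "(\<Sum>s\<in>half_cube N. bern N t s *
      exp (\<beta> / 2 * energy (\<lambda>i. s i - t) + \<beta> * t * (\<Sum>i<N. rho i * (s i - t)) + \<delta> * deviation t s)) \<le> 8 * exp c"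
    and \<delta>: "0 < \<delta>" and c: "0 \<le> c"
  shows "(\<Sum>s\<in>cube N. weight s * deviation (mag s) s) \<le> 2 * (c + 8) / \<delta> * (\<Sum>s\<in>cube N. weight s)"
proof -
  let ?n = "\<lambda>s i. if i < N then - s i else undefined"
  have w0: "0 \<le> weight s" for s by (simp add: weight_def)
  have ind: "(\<Sum>s\<in>half_cube N. G s) = (\<Sum>s\<in>cube N. of_bool (0 \<le> sum s {..<N}) * G s)" for G :: "_ \<Rightarrow> real"
    unfolding sum.inter_filter[OF finite_cube] by (intro sum.cong refl) auto
  \<comment> \<open>Configurations of total spin 0 are counted in both phases, which makes the flip
    an exact symmetry and only enlarges the bound.\<close>
  have "(\<Sum>s\<in>cube N. weight s * deviation (mag s) s) \<le> (\<Sum>s\<in>cube N. of_bool (0 \<le> sum s {..<N}) * (weight s * deviation t s)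
      + of_bool (sum s {..<N} \<le> 0) * (weight s * deviation (- t) s))"
    using w0 deviation_nonneg by (intro sum_mono) (auto simp: mag_def)
  also have "\<dots> = (\<Sum>s\<in>half_cube N. weight s * deviation t s) + (\<Sum>s\<in>cube N. of_bool (sum s {..<N} \<le> 0) * (weight s * deviation (- t) s))"
    by (simp add: sum.distrib ind)
  also have "(\<Sum>s\<in>cube N. of_bool (sum s {..<N} \<le> 0) * (weight s * deviation (- t) s))
      = (\<Sum>s\<in>cube N. of_bool (sum (?n s) {..<N} \<le> 0) * (weight (?n s) * deviation (- t) (?n s)))"
    by (rule sum_cube_neg)
  also have "\<dots> = (\<Sum>s\<in>half_cube N. weight s * deviation t s)"
    unfolding ind weight_def energy_neg deviation_neg by (intro sum.cong refl) (simp add: sum_negf)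
  finally have 1: "(\<Sum>s\<in>cube N. weight s * deviation (mag s) s) \<le> 2 * (\<Sum>s\<in>half_cube N. weight s * deviation t s)" by simp
  have "\<delta> * (\<Sum>s\<in>half_cube N. weight s * deviation t s) = (\<Sum>s\<in>half_cube N. weight s * (\<delta> * deviation t s))"
    by (simp add: sum_distrib_left mult_ac)
  \<comment> \<open>The inequality x \<le> c + exp (x - c) replaces Jensen; shifting by
    \<open>c\<close> cancels the size of the exponential moment.\<close>
  also have "\<dots> \<le> (\<Sum>s\<in>half_cube N. weight s * (c + exp (\<delta> * deviation t s - c)))"
  proof (intro sum_mono mult_left_mono w0)
    fix s
    show "\<delta> * deviation t s \<le> c + exp (\<delta> * deviation t s - c)"
      using exp_ge_add_one_self[of "\<delta> * deviation t s - c"] by linarith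
  qed
  also have "\<dots> = c * (\<Sum>s\<in>half_cube N. weight s) + exp (- c) * (\<Sum>s\<in>half_cube N. weight s * exp (\<delta> * deviation t s))"
    by (simp add: distrib_left sum.distrib sum_distrib_left exp_diff exp_minus divide_inverse mult_ac)
  also have "\<dots> \<le> c * (\<Sum>s\<in>cube N. weight s) + 8 * (\<Sum>s\<in>cube N. weight s)"
  proof (intro add_mono mult_left_mono c)
    show "(\<Sum>s\<in>half_cube N. weight s) \<le> (\<Sum>s\<in>cube N. weight s)"
      by (intro sum_mono2 finite_cube) (auto simp: w0)
    have "(\<Sum>s\<in>half_cube N. weight s * exp (\<delta> * deviation t s)) = norm_const * (\<Sum>s\<in>half_cube N. bern N t s *
      exp (\<beta> / 2 * energy (\<lambda>i. s i - t) + \<beta> * t * (\<Sum>i<N. rho i * (s i - t)) + \<delta> * deviation t s))"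
      unfolding sum_distrib_left[of norm_const]
      by (intro sum.cong refl) (simp add: weight_eq exp_add mult_ac)
    also have "\<dots> \<le> norm_const * (8 * exp c)" using S norm_const_pos by (intro mult_left_mono) auto
    finally have "exp (- c) * (\<Sum>s\<in>half_cube N. weight s * exp (\<delta> * deviation t s)) \<le> exp (- c) * (norm_const * (8 * exp c))"
      by (rule mult_left_mono) simp
    also have "\<dots> = 8 * norm_const" by (simp add: exp_minus)
    also have "\<dots> \<le> 8 * (\<Sum>s\<in>cube N. weight s)" using norm_const_le by simp
    finally show "exp (- c) * (\<Sum>s\<in>half_cube N. weight s * exp (\<delta> * deviation t s)) \<le> 8 * (\<Sum>s\<in>cube N. weight s)" .
  qed
  finally have "(\<Sum>s\<in>half_cube N. weight s * deviation t s) \<le> (c + 8) / \<delta> * (\<Sum>s\<in>cube N. weight s)"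
    using \<delta> by (simp add: field_simps)
  moreover have "2 * (c + 8) / \<delta> * x = 2 * ((c + 8) / \<delta> * x)" for x by simp
  ultimately show ?thesis using 1 by linarith
qed

section \<open>Glauber dynamics\<close>

definition field :: "nat \<Rightarrow> (nat \<Rightarrow> real) \<Rightarrow> real" where "field i s = (\<Sum>j<N. a i j * s j)"

lemma energy_flip:
  assumes i: "i < N"
  shows "energy (flip i s) = energy s - 4 * (s i * field i s)"
proof -
  have "energy (flip i s) = (\<Sum>j<N. \<Sum>k<N. a j k * s j * s k
      - 2 * (if j = i then a i k * s i * s k else 0) - 2 * (if k = i then a j i * s j * s i else 0)
      + 4 * (if j = i then if k = i then a i i * s i * s i else 0 else 0))"
    unfolding energy_def flip_def by (intro sum.cong refl) auto
  also have "\<dots> = energy s - 2 * (\<Sum>k<N. a i k * s i * s k) - 2 * (\<Sum>j<N. a j i * s j * s i) + 4 * (a i i * s i * s i)"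
  proof -
    have inner: "(\<Sum>k<N. if j = i then f k else 0) = (if j = i then (\<Sum>k<N. f k) else 0)"
      for f :: "nat \<Rightarrow> real" and j by simp
    show ?thesis
      unfolding sum.distrib sum_subtractf sum_distrib_left[symmetric] inner
      using i by (simp add: energy_def)
  qed
  also have "(\<Sum>j<N. a j i * s j * s i) = (\<Sum>k<N. a i k * s i * s k)"
    using i by (intro sum.cong refl) (simp add: a_sym)
  also have "(\<Sum>k<N. a i k * s i * s k) = s i * field i s"
    by (simp add: field_def sum_distrib_left mult_ac)
  finally show ?thesis using a_diag[OF i] by simp
qed

lemma field_flip: "i < N \<Longrightarrow> field i (flip i s) = field i s"
  unfolding field_def by (intro sum.cong refl) (auto simp: flip_def a_diag)

lemma sum_flip: "i < N \<Longrightarrow> sum (flip i s) {..<N} = sum s {..<N} - 2 * s i"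
  by (simp add: sum.remove[of _ i] flip_other)

text \<open>The conditional mean of the spin at \<open>i\<close> given all others; the field does
  not see that spin because the diagonal vanishes.\<close>

definition theta :: "nat \<Rightarrow> (nat \<Rightarrow> real) \<Rightarrow> real" where "theta i s = tanh (\<beta> * field i s)"

text \<open>Flips into the other phase are rejected: the dynamics stays reversible, its jumps stay of
  size \<open>2 / sqrt N\<close>, and the defect lives on the rare event of an almost vanishing mean.\<close>
definition accept :: "nat \<Rightarrow> (nat \<Rightarrow> real) \<Rightarrow> real" where "accept i s = of_bool (mag (flip i s) = mag s)"

text \<open>Detailed balance for heat-bath updates: \<open>(1 - s i * theta i s) / 2\<close> is the
  probability that resampling the spin reverses it.\<close>

lemma rate_symmetric:
  assumes s: "s \<in> cube N" and i: "i < N"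
  shows "weight (flip i s) * (1 - flip i s i * theta i (flip i s)) * accept i (flip i s)
    = weight s * (1 - s i * theta i s) * accept i s"
proof -
  define y where "y = \<beta> * s i * field i s"
  have th: "s i * theta i s = tanh y"
    using cube_val[OF s i] by (auto simp: theta_def y_def)
  have w: "weight (flip i s) = weight s * exp (- 2 * y)"
    unfolding weight_def exp_add[symmetric] energy_flip[OF i] y_def by (simp add: algebra_simps)
  have "1 - tanh y = exp (- y) / cosh y" "1 + tanh y = exp y / cosh y"
    using cosh_real_nonzero[of y] by (simp_all add: tanh_def field_simps cosh_plus_sinh cosh_minus_sinh)
  then have "exp (- 2 * y) * (1 + tanh y) = 1 - tanh y"
    by (simp add: exp_add[symmetric])
  moreover have "flip i s i * theta i (flip i s) = - tanh y"
    using th by (simp add: theta_def field_flip[OF i])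
  moreover have "accept i (flip i s) = accept i s" by (auto simp: accept_def)
  ultimately show ?thesis by (simp add: w th mult.assoc)
qed

text \<open>A common pointwise bound for the Stein errors; its Ising mean is controlled once, in
  \<open>slack_mean_le\<close>.\<close>

definition slack :: "(nat \<Rightarrow> real) \<Rightarrow> real" where
  "slack s = 1 + deviation (mag s) s + rho2 + \<bar>\<Sum>i<N. rho i\<bar>"

section \<open>Pointwise errors of drift and variance\<close>

lemma mag_cases: "mag s = t \<or> mag s = - t" and mag_sq: "(mag s)\<^sup>2 = t\<^sup>2" and mag_abs: "\<bar>mag s\<bar> = t"
  using t by (auto simp: mag_def)

lemma tanh_mag: "tanh (\<beta> * mag s) = mag s"
  using mag_cases[of s] t(2) by auto

lemma field_diff: "i < N \<Longrightarrow> field i s - mag s = (\<Sum>j<N. a i j * (s j - mag s)) + mag s * rho i"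
  by (simp add: field_def rho_def right_diff_distrib sum_subtractf sum_distrib_left sum_distrib_right mult_ac)

lemma field_dev_le: "(\<Sum>i<N. (field i s - mag s)\<^sup>2) \<le> 2 * deviation (mag s) s + 2 * rho2"
proof -
  have "(field i s - mag s)\<^sup>2 \<le> 2 * (\<Sum>j<N. a i j * (s j - mag s))\<^sup>2 + 2 * (rho i)\<^sup>2" if "i < N" for i
  proof -
    have "(x + y)\<^sup>2 \<le> 2 * x\<^sup>2 + 2 * y\<^sup>2" for x y :: real
      using zero_le_power2[of "x - y"] by (simp add: power2_eq_square algebra_simps)
    moreover have "(mag s * rho i)\<^sup>2 \<le> 1 * (rho i)\<^sup>2"
      unfolding power_mult_distrib mag_sq using abs_t_le_1 t by (intro mult_right_mono) (auto simp: power_le_one)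
    ultimately show ?thesis unfolding field_diff[OF that] by (smt (verit))
  qed
  then have "(\<Sum>i<N. (field i s - mag s)\<^sup>2) \<le> (\<Sum>i<N. 2 * (\<Sum>j<N. a i j * (s j - mag s))\<^sup>2 + 2 * (rho i)\<^sup>2)"
    by (intro sum_mono) auto
  also have "\<dots> = 2 * (\<Sum>i<N. (\<Sum>j<N. a i j * (s j - mag s))\<^sup>2) + 2 * rho2"
    by (simp add: sum.distrib sum_distrib_left rho2_def)
  also have "(\<Sum>i<N. (\<Sum>j<N. a i j * (s j - mag s))\<^sup>2) \<le> deviation (mag s) s"
    by (simp add: deviation_def)
  finally show ?thesis by simp
qed

text \<open>Almost vanishing total spin is far from both phases, so the deviation itself is of order
  \<open>N\<close> there. This pointwise comparison takes the place of a large deviation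
  estimate.\<close>

lemma edge_le:
  assumes Nt: "4 \<le> N * t" and s: "s \<in> cube N"
  shows "2 * real N * (of_bool (\<bar>sum s {..<N}\<bar> \<le> 2) :: real) \<le> 8 / t\<^sup>2 * deviation (mag s) s"
proof (cases "\<bar>sum s {..<N}\<bar> \<le> 2")
  case True
  have "sum s {..<N} - N * mag s = (\<Sum>i<N. s i - mag s)" by (simp add: sum_subtractf)
  moreover have "N * t / 2 \<le> \<bar>sum s {..<N} - N * mag s\<bar>"
  proof -
    have "N * mag s = N * t \<or> N * mag s = - (N * t)" using mag_cases[of s] by auto
    then show ?thesis using True Nt by (elim disjE) linarith+
  qed
  ultimately have "N * t / 2 \<le> \<bar>\<Sum>i<N. s i - mag s\<bar>" by simp
  then have "(N * t / 2)\<^sup>2 \<le> (\<Sum>i<N. s i - mag s)\<^sup>2"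
    using t by (simp add: abs_le_square_iff[symmetric])
  then have "(N * t / 2)\<^sup>2 / N \<le> (\<Sum>i<N. s i - mag s)\<^sup>2 / N" by (rule divide_right_mono) simp
  also have "\<dots> \<le> deviation (mag s) s" by (simp add: deviation_def sum_nonneg)
  finally have "N * t\<^sup>2 / 4 \<le> deviation (mag s) s" using N2 by (simp add: power2_eq_square mult_ac)
  from mult_left_mono[OF this, of "8 / t\<^sup>2"] show ?thesis using True t by simp
next
  case False
  then show ?thesis using deviation_nonneg by simp
qed

lemma one_minus_accept_le:
  assumes "s \<in> cube N" "i < N"
  shows "0 \<le> 1 - accept i s" "1 - accept i s \<le> of_bool (\<bar>sum s {..<N}\<bar> \<le> 2)"
  using cube_val[OF assms] t(1) by (auto simp: accept_def mag_def sum_flip[OF assms(2)])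

lemma sum_one_minus_accept_le:
  assumes Nt: "4 \<le> N * t" and s: "s \<in> cube N" and g: "\<And>i. i < N \<Longrightarrow> \<bar>g i\<bar> \<le> 2"
  shows "\<bar>\<Sum>i<N. g i * (1 - accept i s)\<bar> \<le> 8 / t\<^sup>2 * slack s"
proof -
  have "\<bar>g i * (1 - accept i s)\<bar> \<le> 2 * of_bool (\<bar>sum s {..<N}\<bar> \<le> 2)" if "i < N" for i
    unfolding abs_mult using one_minus_accept_le[OF s that] g[OF that] by (intro mult_mono) auto
  then have "\<bar>\<Sum>i<N. g i * (1 - accept i s)\<bar> \<le> (\<Sum>i<N. 2 * of_bool (\<bar>sum s {..<N}\<bar> \<le> 2))"
    by (intro order_trans[OF sum_abs] sum_mono) auto
  also have "\<dots> = 2 * real N * of_bool (\<bar>sum s {..<N}\<bar> \<le> 2)" by simp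
  also have "\<dots> \<le> 8 / t\<^sup>2 * deviation (mag s) s" by (rule edge_le[OF Nt s])
  also have "\<dots> \<le> 8 / t\<^sup>2 * slack s"
    using rho2_nonneg by (intro mult_left_mono) (auto simp: slack_def)
  finally show ?thesis .
qed

lemma theta_bounds: "\<bar>theta i s\<bar> \<le> 1"
  using tanh_real_bounds[of "\<beta> * field i s"] by (auto simp: theta_def)

text \<open>tanh is linearised at the phase. Since column sums equal row sums, the local fields add
  up to the total spin plus a \<open>rho\<close> term, which gives the linear drift. The errors are
  this \<open>rho\<close> term, the Taylor remainder and the rejected flips.\<close>

lemma drift_le:
  assumes Nt: "4 \<le> N * t" and s: "s \<in> cube N"
  shows "\<bar>(\<Sum>i<N. (s i - theta i s) * accept i s) - (1 - \<beta> * (1 - t\<^sup>2)) * (\<Sum>i<N. s i - mag s)\<bar>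
    \<le> (\<beta> + 4 * \<beta>\<^sup>2 + 8 / t\<^sup>2) * slack s"
proof -
  define b where "b = \<beta> * (1 - t\<^sup>2)"
  define r where "r = (\<lambda>i. theta i s - mag s - b * (field i s - mag s))"
  have b01: "0 \<le> b" "b \<le> \<beta>" using \<beta> abs_t_le_1 t by (auto simp: b_def power_le_one mult_left_le)
  have r: "\<bar>r i\<bar> \<le> 2 * \<beta>\<^sup>2 * (field i s - mag s)\<^sup>2" for i
    using tanh_scaled_taylor[of \<beta> "field i s" "mag s"]
    unfolding tanh_mag mag_sq by (simp add: r_def theta_def b_def)
  have sumf: "(\<Sum>i<N. field i s - mag s) = (\<Sum>i<N. s i - mag s) + (\<Sum>i<N. rho i * s i)"
  proof -
    have "(\<Sum>i<N. field i s) = (\<Sum>j<N. (\<Sum>i<N. a i j) * s j)"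
      unfolding field_def by (subst sum.swap) (simp add: sum_distrib_right)
    also have "\<dots> = (\<Sum>j<N. (rho j + 1) * s j)"
      unfolding rho_def by (intro sum.cong refl) (simp add: a_sym)
    finally show ?thesis by (simp add: sum_subtractf distrib_right sum.distrib)
  qed
  have "(\<Sum>i<N. (s i - theta i s) * accept i s)
      = (\<Sum>i<N. (s i - mag s) - b * (field i s - mag s) - r i - (s i - theta i s) * (1 - accept i s))"
    by (intro sum.cong refl) (simp add: r_def algebra_simps)
  also have "\<dots> = (1 - b) * (\<Sum>i<N. s i - mag s) - b * (\<Sum>i<N. rho i * s i) - (\<Sum>i<N. r i)
      - (\<Sum>i<N. (s i - theta i s) * (1 - accept i s))"
    by (simp only: sum_subtractf[of _ _ "{..<N}"] sum_distrib_left[symmetric] sumf[unfolded sum_subtractf])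
       (simp add: sum_subtractf algebra_simps)
  finally have eq: "(\<Sum>i<N. (s i - theta i s) * accept i s) - (1 - b) * (\<Sum>i<N. s i - mag s)
      = - (b * (\<Sum>i<N. rho i * s i)) - (\<Sum>i<N. r i) - (\<Sum>i<N. (s i - theta i s) * (1 - accept i s))" by simp
  have D0: "0 \<le> deviation (mag s) s" by (rule deviation_nonneg)
  have e1: "\<bar>b * (\<Sum>i<N. rho i * s i)\<bar> \<le> \<beta> * slack s"
  proof -
    have "(\<Sum>i<N. rho i * s i) = (\<Sum>i<N. rho i * (s i - mag s)) + mag s * (\<Sum>i<N. rho i)"
      by (simp add: right_diff_distrib sum_subtractf sum_distrib_left mult_ac)
    moreover have "\<bar>mag s * (\<Sum>i<N. rho i)\<bar> \<le> 1 * \<bar>\<Sum>i<N. rho i\<bar>"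
      unfolding abs_mult mag_abs using abs_t_le_1 by (intro mult_right_mono) auto
    moreover have "\<bar>\<Sum>i<N. rho i * (s i - mag s)\<bar> \<le> deviation (mag s) s"
      by (simp add: deviation_def sum_nonneg)
    ultimately have "\<bar>\<Sum>i<N. rho i * s i\<bar> \<le> slack s"
      using rho2_nonneg unfolding slack_def by linarith
    then show ?thesis using b01 by (simp add: abs_mult mult_mono)
  qed
  have e2: "\<bar>\<Sum>i<N. r i\<bar> \<le> 4 * \<beta>\<^sup>2 * slack s"
  proof -
    have "\<bar>\<Sum>i<N. r i\<bar> \<le> (\<Sum>i<N. 2 * \<beta>\<^sup>2 * (field i s - mag s)\<^sup>2)"
      by (intro order_trans[OF sum_abs] sum_mono r)
    also have "\<dots> = 2 * \<beta>\<^sup>2 * (\<Sum>i<N. (field i s - mag s)\<^sup>2)" by (simp add: sum_distrib_left)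
    also have "\<dots> \<le> 2 * \<beta>\<^sup>2 * (2 * slack s)"
      using field_dev_le[of s] by (intro mult_left_mono) (auto simp: slack_def)
    finally show ?thesis by simp
  qed
  have e3: "\<bar>\<Sum>i<N. (s i - theta i s) * (1 - accept i s)\<bar> \<le> 8 / t\<^sup>2 * slack s"
  proof (rule sum_one_minus_accept_le[OF Nt s])
    fix i assume "i < N"
    then show "\<bar>s i - theta i s\<bar> \<le> 2" using cube_val[OF s] theta_bounds[of i s] by fastforce
  qed
  have "(\<beta> + 4 * \<beta>\<^sup>2 + 8 / t\<^sup>2) * slack s = \<beta> * slack s + 4 * \<beta>\<^sup>2 * slack s + 8 / t\<^sup>2 * slack s"
    by (simp only: distrib_right)
  then show ?thesis unfolding b_def[symmetric] eq using e1 e2 e3 by linarith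
qed

lemma mag_dev_le: "\<bar>\<Sum>i<N. s i - mag s\<bar> \<le> sqrt N * slack s"
proof -
  let ?S = "\<Sum>i<N. s i - mag s"
  have N0: "0 < sqrt (real N)" using N2 by simp
  have "0 \<le> (\<bar>?S\<bar> / sqrt N - 1)\<^sup>2" by simp
  also have "\<dots> = ?S\<^sup>2 / N - 2 * (\<bar>?S\<bar> / sqrt N) + 1" by (simp add: power2_eq_square algebra_simps)
  finally have "\<bar>?S\<bar> / sqrt N \<le> (?S\<^sup>2 / N + 1) / 2" by simp
  also have "\<dots> \<le> ?S\<^sup>2 / N + 1"
  proof -
    have half_le: "(x + 1) / 2 \<le> x + 1" if "0 \<le> x" for x :: real using that by simp
    show ?thesis by (rule half_le) simp
  qed
  also have "\<dots> \<le> slack s" using rho2_nonneg by (simp add: slack_def deviation_def sum_nonneg)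
  finally show ?thesis using N0 by (simp add: field_simps)
qed

text \<open>The leading term has order \<open>N\<close>, so an error of order \<open>sqrt N\<close>
  is allowed and first-order bounds suffice.\<close>

lemma variance_le:
  assumes Nt: "4 \<le> N * t" and s: "s \<in> cube N"
  shows "\<bar>\<Sum>i<N. (1 - t\<^sup>2) - (1 - s i * theta i s) * accept i s\<bar> \<le> (2 * \<beta> + 1 + 8 / t\<^sup>2) * (sqrt N * slack s)"
proof -
  have N0: "1 \<le> sqrt (real N)" using N2 by simp
  have sl0: "0 \<le> slack s" using rho2_nonneg deviation_nonneg by (simp add: slack_def)
  \<comment> \<open>Without rejection a summand is \<open>s i * theta i s - (mag s)\<^sup>2\<close>,
    which telescopes through \<open>s i * mag s\<close>.\<close>
  have "(\<Sum>i<N. (1 - t\<^sup>2) - (1 - s i * theta i s) * accept i s)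
      = (\<Sum>i<N. s i * (theta i s - mag s) + mag s * (s i - mag s) + (1 - s i * theta i s) * (1 - accept i s))"
    using mag_sq[of s] by (intro sum.cong refl) (simp add: power2_eq_square algebra_simps)
  also have "\<dots> = (\<Sum>i<N. s i * (theta i s - mag s)) + mag s * (\<Sum>i<N. s i - mag s)
      + (\<Sum>i<N. (1 - s i * theta i s) * (1 - accept i s))"
    by (simp only: sum.distrib sum_distrib_left)
  finally have eq: "(\<Sum>i<N. (1 - t\<^sup>2) - (1 - s i * theta i s) * accept i s) = \<dots>" .
  have e1: "\<bar>\<Sum>i<N. s i * (theta i s - mag s)\<bar> \<le> 2 * \<beta> * (sqrt N * slack s)"
  proof -
    have pw: "\<bar>s i * (theta i s - mag s)\<bar> \<le> \<beta> * (sqrt N * (field i s - mag s)\<^sup>2 + 1 / sqrt N)" if "i < N" for i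
    proof -
      let ?z = "field i s - mag s"
      have "\<bar>s i * (theta i s - mag s)\<bar> = \<bar>tanh (\<beta> * field i s) - tanh (\<beta> * mag s)\<bar>"
        using cube_val[OF s that] by (auto simp: abs_mult tanh_mag theta_def)
      also have "\<dots> \<le> \<bar>\<beta> * field i s - \<beta> * mag s\<bar>"
        by (rule tanh_lipschitz)
      also have "\<dots> = \<beta> * \<bar>?z\<bar>" using \<beta> by (simp add: right_diff_distrib[symmetric] abs_mult)
      \<comment> \<open>The weight \<open>sqrt N\<close> balances the two terms: summed over the
        sites, each is at most of order \<open>sqrt N\<close> times the slack.\<close>
      also have "\<bar>?z\<bar> \<le> sqrt N * ?z\<^sup>2 + 1 / sqrt N"
      proof -
        have "0 \<le> (sqrt N * \<bar>?z\<bar> - 1)\<^sup>2" by simp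
        also have "\<dots> = sqrt N * (sqrt N * ?z\<^sup>2 - 2 * \<bar>?z\<bar> + 1 / sqrt N)"
          using N0 by (simp add: power2_eq_square algebra_simps)
        finally have nn: "0 \<le> sqrt N * ?z\<^sup>2 - 2 * \<bar>?z\<bar> + 1 / sqrt N"
          using N0 by (simp add: zero_le_mult_iff)
        have le: "z \<le> A + B" if "0 \<le> A - 2 * z + B" "0 \<le> z" for A B z :: real
          using that by linarith
        show ?thesis by (rule le[OF nn]) simp
      qed
      finally show ?thesis using \<beta> by (simp add: mult_left_mono)
    qed
    have "\<bar>\<Sum>i<N. s i * (theta i s - mag s)\<bar> \<le> (\<Sum>i<N. \<beta> * (sqrt N * (field i s - mag s)\<^sup>2 + 1 / sqrt N))"
      by (intro order_trans[OF sum_abs] sum_mono pw) simp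
    also have "\<dots> = \<beta> * (sqrt N * (\<Sum>i<N. (field i s - mag s)\<^sup>2) + N / sqrt N)"
      by (simp only: sum_distrib_left[symmetric] sum.distrib sum_constant card_lessThan) simp
    also have "N / sqrt N = sqrt N" by (simp add: real_div_sqrt)
    also have "\<beta> * (sqrt N * (\<Sum>i<N. (field i s - mag s)\<^sup>2) + sqrt N)
        = \<beta> * (sqrt N * ((\<Sum>i<N. (field i s - mag s)\<^sup>2) + 1))" by (simp add: algebra_simps)
    also have "\<dots> \<le> \<beta> * (sqrt N * (2 * slack s))"
      using field_dev_le[of s] \<beta> by (intro mult_left_mono) (auto simp: slack_def)
    finally show ?thesis by (simp add: mult_ac)
  qed
  have e2: "\<bar>mag s * (\<Sum>i<N. s i - mag s)\<bar> \<le> 1 * (sqrt N * slack s)"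
    unfolding abs_mult mag_abs using abs_t_le_1 mag_dev_le[of s] by (intro mult_mono) auto
  have e3: "\<bar>\<Sum>i<N. (1 - s i * theta i s) * (1 - accept i s)\<bar> \<le> 8 / t\<^sup>2 * (sqrt N * slack s)"
  proof -
    have "\<bar>\<Sum>i<N. (1 - s i * theta i s) * (1 - accept i s)\<bar> \<le> 8 / t\<^sup>2 * slack s"
    proof (rule sum_one_minus_accept_le[OF Nt s])
      fix i assume "i < N"
      then show "\<bar>1 - s i * theta i s\<bar> \<le> 2" using cube_val[OF s] theta_bounds[of i s] by fastforce
    qed
    also have "\<dots> \<le> 8 / t\<^sup>2 * (sqrt N * slack s)"
      using N0 sl0 mult_right_mono[of 1 "sqrt N" "slack s"] by (intro mult_left_mono) auto
    finally show ?thesis .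
  qed
  have "(2 * \<beta> + 1 + 8 / t\<^sup>2) * (sqrt N * slack s)
      = 2 * \<beta> * (sqrt N * slack s) + 1 * (sqrt N * slack s) + 8 / t\<^sup>2 * (sqrt N * slack s)"
    by (simp only: distrib_right)
  then show ?thesis unfolding eq using e1 e2 e3 by linarith
qed

text \<open>The general Stein bound for the standardised total spin. Its three error sums are the
  variance, the drift, and the drift of \<open>D * \<bar>D\<bar>\<close>.\<close>

lemma ks_bound_cube:
  assumes Nt: "4 \<le> N * t"
  defines "\<kappa> \<equiv> 1 - \<beta> * (1 - t\<^sup>2)" and "Z \<equiv> \<Sum>s\<in>cube N. weight s"
  defines "\<tau> \<equiv> (1 - t\<^sup>2) / \<kappa>"
  defines "K \<equiv> 2 * (2 * \<beta> + 1 + 8 / t\<^sup>2) / (1 - t\<^sup>2) + mills 0 * (\<beta> + 4 * \<beta>\<^sup>2 + 8 / t\<^sup>2) / (\<kappa> * sqrt \<tau>)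
      + 4 * (1 + (\<beta> + 4 * \<beta>\<^sup>2 + 8 / t\<^sup>2)) / (1 - t\<^sup>2)"
  shows "\<bar>\<Sum>s\<in>cube N. weight s / Z * (of_bool ((\<Sum>i<N. s i - mag s) / (sqrt N * sqrt \<tau>) \<le> z) - Phi z)\<bar>
    \<le> K / sqrt N * (\<Sum>s\<in>cube N. weight s / Z * slack s)"
proof -
  define P where "P = (\<lambda>s. weight s / Z)"
  define S where "S = (\<lambda>s. \<Sum>i<N. s i - mag s)"
  define W where "W = (\<lambda>s. S s / (sqrt N * sqrt \<tau>))"
  \<comment> \<open>A uniformly chosen site is resampled and flips out of the phase are suppressed.
    \<open>l\<close> is the regression coefficient of the resulting exchangeable pair, the
    contraction rate per step.\<close>
  define c where "c = (\<lambda>i s. P s * (1 - s i * theta i s) * accept i s / (2 * N))"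
  define l where "l = \<kappa> / N"
  define CA where "CA = \<beta> + 4 * \<beta>\<^sup>2 + 8 / t\<^sup>2"
  define CB where "CB = 2 * \<beta> + 1 + 8 / t\<^sup>2"
  define v where "v = 1 - t\<^sup>2"
  define dr where "dr = (\<lambda>s. \<Sum>i<N. (s i - theta i s) * accept i s)"
  have \<kappa>: "0 < \<kappa>" "\<kappa> \<le> 1" unfolding \<kappa>_def
    using slope_lt_1[OF \<beta> t] \<beta> abs_t_le_1 t by (auto simp: power_le_one)
  have v: "0 < v" using t_lt_1[OF \<beta> t] t by (simp add: v_def power_less_one_iff)
  have \<tau>: "0 < \<tau>" "\<kappa> * \<tau> = v" using \<kappa> v by (auto simp: \<tau>_def v_def)
  have N0: "0 < real N" "1 \<le> sqrt (real N)" using N2 by auto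
  have Z0: "0 < Z" unfolding Z_def using norm_const_pos norm_const_le by linarith
  have P0: "0 \<le> P s" for s using Z0 by (simp add: P_def weight_def)
  have sl0: "0 \<le> slack s" for s using rho2_nonneg deviation_nonneg by (simp add: slack_def)
  have l0: "0 < l" using \<kappa> N0 by (simp add: l_def)
  have CA0: "0 \<le> CA" using \<beta> by (simp add: CA_def)
  have key: "x / (v * N) * (y * (sqrt N * w)) = y / v / sqrt N * (x * w)" for x y w
  proof -
    have "x / (v * N) * (y * (sqrt N * w)) = x * y * w / v * (sqrt N / N)" by simp
    also have "sqrt N / N = 1 / sqrt N" using N0 by (simp add: field_simps)
    finally show ?thesis by simp
  qed
  define w where "w = sqrt N * sqrt \<tau>"
  have w: "w * w = N * \<tau>" "0 < w" using N0 \<tau> by (auto simp: w_def real_sqrt_mult[symmetric])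
  \<comment> \<open>An accepted flip keeps the centre and moves \<open>W\<close> by
    \<open>2 * s i / w\<close>; for a rejected one the rate vanishes, so any \<open>h\<close> is
    allowed.\<close>
  have D: "c i s * h (W s - W (flip i s)) = c i s * h (2 * s i / w)" if "i < N" for i s and h :: "real \<Rightarrow> real"
  proof (cases "mag (flip i s) = mag s")
    case True
    have "S s - S (flip i s) = 2 * s i"
      using sum_flip[OF that, of s] True by (simp add: S_def sum_subtractf)
    then show ?thesis by (simp add: W_def w_def diff_divide_distrib[symmetric])
  qed (simp add: c_def accept_def)
  have cs: "c i s * s i = P s / (2 * N) * ((s i - theta i s) * accept i s)" if "s \<in> cube N" "i < N" for i s
    using cube_val[OF that] by (auto simp: c_def)
  have cD: "(\<Sum>i<N. c i s * (W s - W (flip i s))) = P s * dr s / (N * w)" if s: "s \<in> cube N" for s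
  proof -
    have "c i s * (2 * s i / w) = P s / (N * w) * ((s i - theta i s) * accept i s)" if "i < N" for i
    proof -
      have "c i s * (2 * s i / w) = 2 / w * (c i s * s i)" by simp
      then show ?thesis unfolding cs[OF s that] by simp
    qed
    then have "(\<Sum>i<N. c i s * (W s - W (flip i s))) = (\<Sum>i<N. P s / (N * w) * ((s i - theta i s) * accept i s))"
      using D[of _ s "\<lambda>x. x"] by (intro sum.cong refl) auto
    also have "\<dots> = P s / (N * w) * dr s" by (simp only: dr_def sum_distrib_left)
    finally show ?thesis by simp
  qed
  have cD2: "(\<Sum>i<N. c i s * (W s - W (flip i s))\<^sup>2) = P s * 2 / (N * N * \<tau>) * (\<Sum>i<N. (1 - s i * theta i s) * accept i s)"
    if s: "s \<in> cube N" for s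
    unfolding sum_distrib_left
  proof (intro sum.cong refl)
    fix i assume "i \<in> {..<N}"
    then have i: "i < N" by simp
    have "(2 * s i / w)\<^sup>2 = 4 / (N * \<tau>)" using cube_val[OF s i] by (auto simp: power2_eq_square w)
    then show "c i s * (W s - W (flip i s))\<^sup>2 = P s * 2 / (N * N * \<tau>) * ((1 - s i * theta i s) * accept i s)"
      unfolding D[OF i, of s "\<lambda>x. x\<^sup>2"] unfolding c_def by simp (simp add: mult_ac)
  qed
  \<comment> \<open>All accepted jumps have the same size, so \<open>D * \<bar>D\<bar>\<close> is a
    multiple of \<open>D\<close> and its drift is again \<open>dr\<close>.\<close>
  have cD3: "(\<Sum>i<N. c i s * ((W s - W (flip i s)) * \<bar>W s - W (flip i s)\<bar>)) = P s * 2 / (N * N * \<tau>) * dr s"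
    if s: "s \<in> cube N" for s
    unfolding dr_def sum_distrib_left
  proof (intro sum.cong refl)
    fix i assume "i \<in> {..<N}"
    then have i: "i < N" by simp
    have "2 * s i / w * \<bar>2 * s i / w\<bar> = 4 / (N * \<tau>) * s i"
      using cube_val[OF s i] w(2) by (auto simp: w(1))
    then have e: "c i s * (2 * s i / w * \<bar>2 * s i / w\<bar>) = 4 / (N * \<tau>) * (c i s * s i)"
      by (simp add: mult_ac)
    show "c i s * ((W s - W (flip i s)) * \<bar>W s - W (flip i s)\<bar>)
        = P s * 2 / (N * N * \<tau>) * ((s i - theta i s) * accept i s)"
      unfolding D[OF i, of s "\<lambda>x. x * \<bar>x\<bar>"] e cs[OF s i] by simp (simp add: mult_ac)
  qed
  \<comment> \<open>The leading terms cancel because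
    \<open>\<kappa> * \<tau> = 1 - t\<^sup>2\<close>; this is what determines the limiting
    variance.\<close>
  have B: "\<bar>P s - (\<Sum>i<N. c i s * (W s - W (flip i s))\<^sup>2) / (2 * l)\<bar> \<le> CB / v / sqrt N * (P s * slack s)"
    if s: "s \<in> cube N" for s
  proof -
    have "P s - (\<Sum>i<N. c i s * (W s - W (flip i s))\<^sup>2) / (2 * l)
        = P s / (v * N) * (\<Sum>i<N. v - (1 - s i * theta i s) * accept i s)"
    proof -
      define X where "X = (\<Sum>i<N. (1 - s i * theta i s) * accept i s)"
      have "(\<Sum>i<N. v - (1 - s i * theta i s) * accept i s) = N * v - X"
        unfolding X_def by (simp only: sum_subtractf sum_constant card_lessThan)
      moreover have "P s - P s * 2 / (N * N * \<tau>) * X / (2 * l) = P s / (v * N) * (N * v - X)"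
        unfolding l_def \<tau>(2)[symmetric] using N0 \<kappa>(1) \<tau>(1) by (simp add: field_simps)
      ultimately show ?thesis unfolding cD2[OF s] X_def by simp
    qed
    then have "\<bar>P s - (\<Sum>i<N. c i s * (W s - W (flip i s))\<^sup>2) / (2 * l)\<bar>
        = P s / (v * N) * \<bar>\<Sum>i<N. v - (1 - s i * theta i s) * accept i s\<bar>"
      using v P0[of s] by (simp add: abs_mult)
    also have "\<dots> \<le> P s / (v * N) * (CB * (sqrt N * slack s))"
      unfolding CB_def v_def using v P0[of s] by (intro mult_left_mono variance_le[OF Nt s]) (auto simp: v_def)
    also have "\<dots> = CB / v / sqrt N * (P s * slack s)"
      using key[of "P s" CB "slack s"] by simp
    finally show ?thesis .
  qed
  have drift: "\<bar>dr s - \<kappa> * S s\<bar> \<le> CA * slack s" if s: "s \<in> cube N" for s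
    using drift_le[OF Nt s] by (simp add: dr_def S_def \<kappa>_def CA_def)
  have A: "\<bar>(\<Sum>i<N. c i s * (W s - W (flip i s))) / l - P s * W s\<bar> \<le> CA / (\<kappa> * sqrt \<tau>) / sqrt N * (P s * slack s)"
    if s: "s \<in> cube N" for s
  proof -
    have "(\<Sum>i<N. c i s * (W s - W (flip i s))) / l - P s * W s = P s / (\<kappa> * sqrt \<tau> * sqrt N) * (dr s - \<kappa> * S s)"
      unfolding cD[OF s] l_def unfolding W_def w_def using N0 \<kappa>(1) \<tau>(1) by (simp add: field_simps)
    then have "\<bar>(\<Sum>i<N. c i s * (W s - W (flip i s))) / l - P s * W s\<bar> = P s / (\<kappa> * sqrt \<tau> * sqrt N) * \<bar>dr s - \<kappa> * S s\<bar>"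
      using \<kappa> \<tau> P0[of s] by (simp add: abs_mult)
    also have "\<dots> \<le> P s / (\<kappa> * sqrt \<tau> * sqrt N) * (CA * slack s)"
      using \<kappa> \<tau> P0[of s] by (intro mult_left_mono drift[OF s]) auto
    finally show ?thesis by (simp add: mult_ac)
  qed
  have C: "2 / l * \<bar>\<Sum>i<N. c i s * ((W s - W (flip i s)) * \<bar>W s - W (flip i s)\<bar>)\<bar> \<le> 4 * (1 + CA) / v / sqrt N * (P s * slack s)"
    if s: "s \<in> cube N" for s
  proof -
    have "\<bar>\<kappa> * S s\<bar> \<le> 1 * \<bar>S s\<bar>" unfolding abs_mult using \<kappa> by (intro mult_right_mono) auto
    also have "\<dots> \<le> sqrt N * slack s" unfolding S_def using mag_dev_le[of s] by simp
    finally have "\<bar>\<kappa> * S s\<bar> \<le> sqrt N * slack s" .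
    moreover have "CA * slack s \<le> CA * (sqrt N * slack s)"
      using N0 CA0 sl0[of s] mult_right_mono[of 1 "sqrt N" "slack s"] by (intro mult_left_mono) auto
    ultimately have "\<bar>dr s\<bar> \<le> sqrt N * slack s + CA * (sqrt N * slack s)"
      using drift[OF s] by linarith
    then have d: "\<bar>dr s\<bar> \<le> (1 + CA) * (sqrt N * slack s)" by (simp add: algebra_simps)
    have "2 / l * \<bar>\<Sum>i<N. c i s * ((W s - W (flip i s)) * \<bar>W s - W (flip i s)\<bar>)\<bar> = 4 * P s / (v * N) * \<bar>dr s\<bar>"
      unfolding cD3[OF s] l_def \<tau>(2)[symmetric] using N0 \<kappa>(1) \<tau>(1) P0[of s] by (simp add: abs_mult field_simps)
    also have "\<dots> \<le> 4 * P s / (v * N) * ((1 + CA) * (sqrt N * slack s))"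
      using v P0[of s] by (intro mult_left_mono d) auto
    also have "\<dots> = 4 * (1 + CA) / v / sqrt N * (P s * slack s)"
      using key[of "4 * P s" "1 + CA" "slack s"] by (simp add: mult_ac)
    finally show ?thesis .
  qed
  have "\<bar>\<Sum>s\<in>cube N. P s * (of_bool (W s \<le> z) - Phi z)\<bar> \<le>
     2 * (\<Sum>s\<in>cube N. \<bar>P s - (\<Sum>i<N. c i s * (W s - W (flip i s))\<^sup>2) / (2 * l)\<bar>)
     + mills 0 * (\<Sum>s\<in>cube N. \<bar>(\<Sum>i<N. c i s * (W s - W (flip i s))) / l - P s * W s\<bar>)
     + 2 / l * (\<Sum>s\<in>cube N. \<bar>\<Sum>i<N. c i s * ((W s - W (flip i s)) * \<bar>W s - W (flip i s)\<bar>)\<bar>)"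
  proof (rule stein_kolmogorov_bound)
    fix i s assume i: "i \<in> {..<N}" and s: "s \<in> cube N"
    show "flip i s \<in> cube N" using i s flip_cube by simp
    show "c i (flip i s) = c i s"
      using rate_symmetric[OF s, of i] i Z0 by (simp add: c_def P_def)
    show "0 \<le> c i s"
    proof -
      have "0 \<le> 1 - s i * theta i s" using cube_val[OF s, of i] i theta_bounds[of i s] by auto
      then show ?thesis using P0[of s] by (simp add: c_def accept_def)
    qed
  qed (use l0 in auto)
  also have "\<dots> \<le> 2 * (\<Sum>s\<in>cube N. CB / v / sqrt N * (P s * slack s))
     + mills 0 * (\<Sum>s\<in>cube N. CA / (\<kappa> * sqrt \<tau>) / sqrt N * (P s * slack s))
     + (\<Sum>s\<in>cube N. 4 * (1 + CA) / v / sqrt N * (P s * slack s))"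
    unfolding sum_distrib_left[of "2 / l"]
    by (intro add_mono mult_left_mono sum_mono A B C mills_nonneg) auto
  also have "\<dots> = K / sqrt N * (\<Sum>s\<in>cube N. P s * slack s)"
    unfolding sum_distrib_left[symmetric] K_def CA_def[symmetric] CB_def[symmetric] v_def[symmetric]
    by (simp add: algebra_simps add_divide_distrib)
  finally show ?thesis unfolding P_def W_def S_def .
qed

text \<open>Unit row sums force a nonzero entry. Hence the error term of the theorem is never 0 and
  finitely many \<open>N\<close> can be absorbed into the constant.\<close>

lemma frob2_pos:
  assumes "rho2 = 0"
  shows "0 < frob2"
proof -
  have "rho 0 = 0"
    using assms N2 unfolding rho2_def by (subst (asm) sum_nonneg_eq_0_iff) auto
  then have "(\<Sum>j<N. a 0 j) \<noteq> 0" by (simp add: rho_def)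
  then obtain j where j: "j < N" "a 0 j \<noteq> 0" by (meson lessThan_iff sum.neutral)
  have "0 < (a 0 j)\<^sup>2" using j by simp
  also have "\<dots> \<le> (\<Sum>j<N. (a 0 j)\<^sup>2)" using j by (intro member_le_sum) auto
  also have "\<dots> \<le> frob2" unfolding frob2_def using N2
    by (intro member_le_sum[of 0 "{..<N}" "\<lambda>i. \<Sum>j<N. (a i j)\<^sup>2"]) (auto intro: sum_nonneg)
  finally show ?thesis .
qed

text \<open>\<open>a\<close> maps the constant vector 1 to \<open>1 + rho\<close>, so 1 is nearly in the top eigenspace.\<close>
lemma overlap_le:
  assumes gap: "\<And>k. 0 < k \<Longrightarrow> k < N \<Longrightarrow> d k \<le> 1 - \<gamma>" and \<gamma>: "0 < \<gamma>"
  shows "\<gamma>\<^sup>2 * (N - (\<Sum>i<N. u 0 i)\<^sup>2) \<le> rho2"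
proof -
  let ?e = "\<lambda>k. coord k (\<lambda>_. 1)"
  have ones: "(\<Sum>k<N. ?e k * u k i) = 1" if "i < N" for i using coord_expand[OF that, of "\<lambda>_. 1"] .
  \<comment> \<open>\<open>rho\<close> is \<open>a - 1\<close> applied to the constant vector, so
    its coordinates are those of the constant vector times \<open>d k - 1\<close>.\<close>
  have "rho i = (\<Sum>k<N. (d k - 1) * ?e k * u k i)" if i: "i < N" for i
  proof -
    have "(\<Sum>j<N. a i j) = (\<Sum>j<N. spec d i j * 1)" using i by (intro sum.cong refl) (simp add: a_spec)
    also have "\<dots> = (\<Sum>k<N. d k * ?e k * u k i)" by (rule spec_apply)
    finally have "rho i = (\<Sum>k<N. d k * ?e k * u k i) - (\<Sum>k<N. ?e k * u k i)"
      by (simp add: rho_def ones[OF i])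
    then show ?thesis by (simp add: sum_subtractf[symmetric] algebra_simps)
  qed
  then have "rho2 = (\<Sum>i<N. (\<Sum>k<N. (d k - 1) * ?e k * u k i)\<^sup>2)"
    unfolding rho2_def by (intro sum.cong refl) auto
  also have "\<dots> = (\<Sum>k<N. (d k - 1)\<^sup>2 * (?e k)\<^sup>2)"
    by (simp only: parseval_sub[OF order_refl] power_mult_distrib)
  finally have r: "rho2 = \<dots>" .
  have "real N = (\<Sum>i<N. (1::real)\<^sup>2)" by simp
  also have "\<dots> = (\<Sum>k<N. (?e k)\<^sup>2)" by (rule parseval)
  also have "\<dots> = (?e 0)\<^sup>2 + (\<Sum>k\<in>{..<N} - {0}. (?e k)\<^sup>2)"
    using N2 by (intro sum.remove) auto
  finally have "\<gamma>\<^sup>2 * (N - (?e 0)\<^sup>2) = (\<Sum>k\<in>{..<N} - {0}. \<gamma>\<^sup>2 * (?e k)\<^sup>2)"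
    by (simp add: sum_distrib_left)
  also have "\<dots> \<le> (\<Sum>k\<in>{..<N} - {0}. (d k - 1)\<^sup>2 * (?e k)\<^sup>2)"
  proof (intro sum_mono mult_right_mono)
    fix k assume "k \<in> {..<N} - {0}"
    then have "\<gamma> \<le> 1 - d k" using gap[of k] by auto
    then have "\<gamma>\<^sup>2 \<le> (1 - d k)\<^sup>2" using \<gamma> by (intro power_mono) auto
    then show "\<gamma>\<^sup>2 \<le> (d k - 1)\<^sup>2" by (simp add: power2_commute)
  qed auto
  also have "\<dots> \<le> rho2" unfolding r by (intro sum_mono2) auto
  finally show ?thesis by (simp add: coord_def)
qed

end

text \<open>The constants: \<open>\<gamma>\<close> is the spectral gap, \<open>\<kappa>\<close> the gain in the direction of the magnetisation.\<close>
lemma (in spin_matrix) slack_mean_le: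
  fixes \<gamma> \<kappa> K0 :: real
  assumes half: "\<And>\<kappa> N. 0 < \<kappa> \<Longrightarrow> \<kappa> \<le> K0 \<Longrightarrow> 0 < N \<Longrightarrow> half_mgf_le \<beta> t \<kappa> N"
    and \<kappa>: "0 < \<kappa>" "\<kappa> \<le> K0" "\<kappa> \<le> \<gamma> / 100" and \<gamma>: "0 < \<gamma>" "\<gamma> < 1"
    and d0: "1 / 2 \<le> d 0" "d 0 \<le> 1 + \<kappa> / 16" and gap: "\<And>k. 0 < k \<Longrightarrow> k < N \<Longrightarrow> d k \<le> 1 - \<gamma>"
    and Nt: "4 \<le> N * t" and rho2: "18 * rho2 \<le> \<gamma>\<^sup>2 * N"
  defines "q \<equiv> (1 + \<kappa> / 16) / (\<kappa> / 16)"
  defines "\<eta> \<equiv> 1 / (20 * q * \<beta>)"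
  defines "C \<equiv> ln (1 / sqrt (1 - (1 - \<kappa> / 16))) / \<eta>\<^sup>2 + (16 * (5 * q * \<beta> / 2)\<^sup>2 + 4 * (5 * q * \<beta> / 2) / \<eta>)
      + (5 * q * \<beta> * t)\<^sup>2 + 1"
  shows "(\<Sum>s\<in>cube N. weight s / (\<Sum>s\<in>cube N. weight s) * slack s)
    \<le> (5 + 160 * q * (C + 32)) * (frob2 + rho2 + \<bar>\<Sum>i<N. rho i\<bar>)"
proof -
  let ?Z = "\<Sum>s\<in>cube N. weight s"
  \<comment> \<open>The gain \<kappa>/4 in the top direction is spent in four parts of \<kappa>/16:
    on \<open>d 0\<close> exceeding 1, on \<open>p\<close>, on the quadratic remainder, and on the
    margin that keeps the product below 1.\<close>
  define p where "p = 1 + \<kappa> / 16"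
  have p: "1 < p" "q = p / (p - 1)" using \<kappa> by (auto simp: p_def q_def)
  have q1: "1 < q" using \<kappa> by (simp add: q_def field_simps)
  have qb: "1 < q * \<beta>" using q1 \<beta> by (metis less_1_mult)
  have \<eta>: "0 < \<eta>" "\<eta> \<le> d 0"
  proof -
    show "0 < \<eta>" using qb by (simp add: \<eta>_def mult.assoc)
    have "\<eta> \<le> 1 / 2" using qb by (simp add: \<eta>_def mult.assoc field_simps)
    then show "\<eta> \<le> d 0" using d0 by simp
  qed
  have k200: "\<kappa> \<le> 1 / 100" using \<kappa> \<gamma> by simp
  have overlap: "17 / 18 \<le> (\<Sum>i<N. u 0 i)\<^sup>2 / N"
  proof -
    have "\<gamma>\<^sup>2 * (N - (\<Sum>i<N. u 0 i)\<^sup>2) \<le> \<gamma>\<^sup>2 * (N / 18)"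
      using overlap_le[OF gap \<gamma>(1)] rho2 by simp
    then have "N - (\<Sum>i<N. u 0 i)\<^sup>2 \<le> N / 18" using \<gamma> by (simp only: mult_le_cancel_left_pos zero_less_power)
    then show ?thesis using N2 by (simp add: field_simps)
  qed
  have kk: "\<kappa> * \<kappa> \<le> \<kappa> / 100" using mult_left_mono[OF k200, of \<kappa>] \<kappa> by simp
  have b0: "p * d 0 * (1 - \<kappa> / 4) \<le> 1 - \<kappa> / 16"
  proof -
    have "p * d 0 * (1 - \<kappa> / 4) \<le> p * (1 + \<kappa> / 16) * (1 - \<kappa> / 4)"
      using d0 p k200 by (intro mult_right_mono mult_left_mono) auto
    also have "\<dots> \<le> (1 + 3 / 16 * \<kappa>) * (1 - \<kappa> / 4)"
    proof (rule mult_right_mono)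
      have "p * (1 + \<kappa> / 16) = 1 + 1 / 8 * \<kappa> + 1 / 256 * (\<kappa> * \<kappa>)"
        by (simp add: p_def field_simps)
      then show "p * (1 + \<kappa> / 16) \<le> 1 + 3 / 16 * \<kappa>" using kk \<kappa> by linarith
    qed (use k200 in auto)
    also have "\<dots> \<le> 1 - \<kappa> / 16" using \<kappa> by (simp add: algebra_simps)
    finally show ?thesis .
  qed
  \<comment> \<open>In the other directions the loss, at most 50 \<kappa> including
    \<open>p\<close>, uses up only half of the spectral gap because \<kappa> \<le> \<gamma> /
    100.\<close>
  have bk: "p * d k * (1 + 49 * \<kappa>) \<le> 1 - \<kappa> / 16" if k: "0 < k" "k < N" for k
  proof -
    have "p * d k * (1 + 49 * \<kappa>) \<le> p * (1 - \<gamma>) * (1 + 49 * \<kappa>)"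
      using gap[OF k] p \<kappa> by (intro mult_right_mono mult_left_mono) auto
    also have "\<dots> = (1 - \<gamma>) * (p * (1 + 49 * \<kappa>))" by simp
    also have "\<dots> \<le> (1 - \<gamma>) * (1 + 50 * \<kappa>)"
    proof (rule mult_left_mono)
      have "p * (1 + 49 * \<kappa>) = 1 + 785 / 16 * \<kappa> + 49 / 16 * (\<kappa> * \<kappa>)"
        by (simp add: p_def field_simps)
      then show "p * (1 + 49 * \<kappa>) \<le> 1 + 50 * \<kappa>" using kk \<kappa> by linarith
    qed (use \<gamma> in auto)
    also have "\<dots> \<le> (1 - \<gamma>) * (1 + \<gamma> / 2)" using \<gamma> \<kappa> by (intro mult_left_mono) auto
    also have "\<dots> \<le> 1 - \<gamma> / 2" by (simp add: algebra_simps)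
    also have "\<dots> \<le> 1 - \<kappa> / 16" using \<kappa> by simp
    finally show ?thesis .
  qed
  have \<eta>2: "16 * (5 * q * \<beta> / 2 * \<eta>)\<^sup>2 \<le> 1 / 2"
  proof -
    \<comment> \<open>The choice of \<open>\<eta>\<close> makes this product 1/8, within the range
      required for decoupling.\<close>
    have e: "5 * q * \<beta> / 2 * \<eta> = 1 / 8" using qb \<beta> q1 by (simp add: \<eta>_def field_simps)
    show ?thesis unfolding e by (simp add: power2_eq_square)
  qed
  have S: "(\<Sum>s\<in>half_cube N. bern N t s *
      exp (\<beta> / 2 * energy (\<lambda>i. s i - t) + \<beta> * t * (\<Sum>i<N. rho i * (s i - t)) + 1 / (80 * q) * deviation t s))
    \<le> 8 * exp (C * (frob2 + rho2))"
    unfolding C_def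
    by (rule half_exp_le[OF half[OF \<kappa>(1,2)] \<kappa>(1) \<eta> _ _ overlap b0 bk p \<eta>2])
       (use N2 k200 \<kappa> d0 in auto)
  have C0: "0 \<le> C"
  proof -
    have "0 \<le> ln (1 / sqrt (1 - (1 - \<kappa> / 16)))"
    proof (rule ln_ge_zero)
      define x where "x = 1 - (1 - \<kappa> / 16)"
      have "0 < sqrt x" "sqrt x \<le> 1" using \<kappa> k200 by (simp_all add: x_def del: real_sqrt_divide)
      then show "1 \<le> 1 / sqrt (1 - (1 - \<kappa> / 16))" unfolding x_def[symmetric] by simp
    qed
    moreover have "0 \<le> 4 * (5 * q * \<beta> / 2) / \<eta>" using \<eta> q1 \<beta> by (intro divide_nonneg_pos mult_nonneg_nonneg) auto
    ultimately show ?thesis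
      unfolding C_def using zero_le_power2[of "5 * q * \<beta> / 2"] zero_le_power2[of "5 * q * \<beta> * t"]
      by (intro add_nonneg_nonneg divide_nonneg_nonneg[of _ "\<eta>\<^sup>2"]) (assumption | simp)+
  qed
  have Z0: "0 < ?Z" using norm_const_pos norm_const_le by linarith
  \<comment> \<open>The top eigenvalue alone bounds the error term from below. This absorbs the
    additive constants: 1 into 4 times the error term and 8 into 32 times it.\<close>
  have fr: "1 / 4 \<le> frob2"
  proof -
    have "(1 / 2)\<^sup>2 \<le> (d 0)\<^sup>2" using d0 by (intro power_mono) auto
    also have "\<dots> \<le> frob2" unfolding frob2_eq using N2 by (intro member_le_sum) auto
    finally show ?thesis by (simp add: power2_eq_square)
  qed
  let ?e = "frob2 + rho2 + \<bar>\<Sum>i<N. rho i\<bar>"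
  have e: "1 / 4 \<le> ?e" "frob2 + rho2 \<le> ?e" using fr rho2_nonneg by auto
  have "(\<Sum>s\<in>cube N. weight s / ?Z * slack s) = (\<Sum>s\<in>cube N. weight s * slack s) / ?Z"
    by (simp add: sum_divide_distrib)
  also have "(\<Sum>s\<in>cube N. weight s * slack s)
      = ?Z * (1 + rho2 + \<bar>\<Sum>i<N. rho i\<bar>) + (\<Sum>s\<in>cube N. weight s * deviation (mag s) s)"
  proof -
    have "slack s = (1 + rho2 + \<bar>\<Sum>i<N. rho i\<bar>) + deviation (mag s) s" for s by (simp add: slack_def)
    then show ?thesis by (simp only: distrib_left[of "weight _"] sum.distrib sum_distrib_right)
  qed
  also have "\<dots> / ?Z = 1 + rho2 + \<bar>\<Sum>i<N. rho i\<bar> + (\<Sum>s\<in>cube N. weight s * deviation (mag s) s) / ?Z"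
    using Z0 by (simp add: add_divide_distrib)
  also have "\<dots> \<le> 1 + rho2 + \<bar>\<Sum>i<N. rho i\<bar> + 2 * (C * (frob2 + rho2) + 8) / (1 / (80 * q))"
  proof -
    have "(\<Sum>s\<in>cube N. weight s * deviation (mag s) s) / ?Z
        \<le> (2 * (C * (frob2 + rho2) + 8) / (1 / (80 * q)) * ?Z) / ?Z"
      using C0 frob2_nonneg rho2_nonneg q1 Z0 by (intro divide_right_mono moment_le[OF S]) auto
    then show ?thesis using Z0 by simp
  qed
  also have "2 * (C * (frob2 + rho2) + 8) / (1 / (80 * q)) = 160 * q * (C * (frob2 + rho2) + 8)" by simp
  also have "\<dots> \<le> 160 * q * (C * ?e + 32 * ?e)"
  proof (rule mult_left_mono)
    have "C * (frob2 + rho2) \<le> C * ?e" using e(2) C0 by (rule mult_left_mono)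
    moreover have "8 \<le> 32 * ?e" using mult_left_mono[OF e(1), of 32] by simp
    ultimately show "C * (frob2 + rho2) + 8 \<le> C * ?e + 32 * ?e" by linarith
  qed (use q1 in auto)
  also have "1 + rho2 + \<bar>\<Sum>i<N. rho i\<bar> + 160 * q * (C * ?e + 32 * ?e) \<le> 5 * ?e + 160 * q * (C * ?e + 32 * ?e)"
    using e fr rho2_nonneg by simp
  finally show ?thesis by (simp add: algebra_simps)
qed

section \<open>Kolmogorov distance\<close>

lemma sum_spin_configs: "(\<Sum>\<sigma>\<in>spin_configs N. f \<sigma>) = (\<Sum>s\<in>cube N. f (Matrix.vec N s))"
proof (rule sum.reindex_bij_witness[of _ "\<lambda>s. Matrix.vec N s" "\<lambda>\<sigma>. restrict (vec_index \<sigma>) {..<N}"])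
  fix \<sigma> assume \<sigma>: "\<sigma> \<in> spin_configs N"
  show eq: "Matrix.vec N (restrict (vec_index \<sigma>) {..<N}) = \<sigma>"
    using \<sigma> by (intro eq_vecI) (auto simp: spin_configs_def)
  show "restrict (vec_index \<sigma>) {..<N} \<in> cube N" using \<sigma> by (auto simp: cube_def spin_configs_def)
  show "f (Matrix.vec N (restrict (vec_index \<sigma>) {..<N})) = f \<sigma>" by (simp add: eq)
next
  fix s assume s: "s \<in> cube N"
  show "restrict (vec_index (Matrix.vec N s)) {..<N} = s"
    using s by (auto simp: cube_def PiE_iff extensional_def fun_eq_iff)
  show "Matrix.vec N s \<in> spin_configs N" using cube_val[OF s] by (auto simp: spin_configs_def)
qed

lemma prob_ising:
  assumes "dim_row A = N"
  shows "measure (measure_pmf (ising_pmf A \<beta> B)) {\<sigma>. R \<sigma>}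
    = (\<Sum>\<sigma>\<in>spin_configs N. ising_weight A \<beta> B \<sigma> / ising_partition A \<beta> B * of_bool (R \<sigma>))"
proof -
  have "measure (measure_pmf (ising_pmf A \<beta> B)) {\<sigma>. R \<sigma>}
      = measure (measure_pmf (ising_pmf A \<beta> B)) {\<sigma>\<in>spin_configs N. R \<sigma>}"
    using assms by (intro measure_prob_cong_0) (auto simp: pmf_ising_pmf)
  also have "\<dots> = (\<Sum>\<sigma>\<in>{\<sigma>\<in>spin_configs N. R \<sigma>}. ising_weight A \<beta> B \<sigma> / ising_partition A \<beta> B)"
    using assms finite_spin_configs[of N]
    by (subst measure_measure_pmf_finite) (auto simp: pmf_ising_pmf intro!: sum.cong)
  finally show ?thesis
    unfolding sum.inter_filter[OF finite_spin_configs] by (auto intro!: sum.cong)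
qed

lemma prob_normal_le:
  fixes Z :: "'z \<Rightarrow> real"
  assumes Z: "distributed Q lborel Z (normal_density 0 (sqrt \<tau>))" and Q: "prob_space Q" and \<tau>: "0 < \<tau>"
  shows "measure Q {\<omega> \<in> space Q. Z \<omega> \<le> x} = Phi (x / sqrt \<tau>)"
proof -
  interpret prob_space Q by (rule Q)
  let ?Y = "\<lambda>\<omega>. (Z \<omega> - 0) / sqrt \<tau>"
  have Y: "distributed Q lborel ?Y std_normal_density"
    using Z \<tau> by (subst (asm) normal_standard_normal_convert) auto
  have "{\<omega> \<in> space Q. Z \<omega> \<le> x} = ?Y -` {..x / sqrt \<tau>} \<inter> space Q"
    using \<tau> by (auto simp: divide_le_cancel)
  then have "measure Q {\<omega> \<in> space Q. Z \<omega> \<le> x} = measure (distr Q lborel ?Y) {..x / sqrt \<tau>}"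
    using distributed_measurable[OF Y] by (subst measure_distr) auto
  also have "distr Q lborel ?Y = std_normal_distribution"
    using distributed_distr_eq_density[OF Y] .
  finally show ?thesis by (simp add: Phi_def cdf_def)
qed

lemma d_KS_le:
  assumes "\<And>x. \<bar>measure P {\<omega> \<in> space P. X \<omega> \<le> x} - measure Q {\<omega> \<in> space Q. Y \<omega> \<le> x}\<bar> \<le> b"
  shows "d_KS P X Q Y \<le> b"
  unfolding d_KS_def by (rule cSUP_least) (use assms in auto)

lemma d_KS_le_1:
  assumes "prob_space P" "prob_space Q"
  shows "d_KS P X Q Y \<le> 1"
proof (rule d_KS_le)
  fix x
  have "measure P S \<in> {0..1}" "measure Q T \<in> {0..1}" for S T
    using assms by (auto simp: prob_space.prob_le_1)
  then show "\<bar>measure P {\<omega> \<in> space P. X \<omega> \<le> x} - measure Q {\<omega> \<in> space Q. Y \<omega> \<le> x}\<bar> \<le> 1"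
    by (smt (verit) atLeastAtMost_iff)
qed

context spin_matrix begin

lemma ising_weight_vec:
  assumes A: "A \<in> carrier_mat N N" "\<And>i j. i < N \<Longrightarrow> j < N \<Longrightarrow> A $$ (i, j) = a i j"
  shows "ising_weight A \<beta> 0 (Matrix.vec N s) = weight s"
proof -
  have "scalar_prod (Matrix.vec N s) (A *\<^sub>v Matrix.vec N s) = (\<Sum>i<N. s i * (\<Sum>j<N. a i j * s j))"
    using A by (simp add: scalar_prod_def atLeast0LessThan)
  then show ?thesis
    by (simp add: ising_weight_def weight_def energy_def sum_distrib_left mult_ac)
qed

lemma ising_vec_sum:
  assumes A: "A \<in> carrier_mat N N" "\<And>i j. i < N \<Longrightarrow> j < N \<Longrightarrow> A $$ (i, j) = a i j"
  shows "measure (measure_pmf (ising_pmf A \<beta> 0))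
      {\<sigma> \<in> space (measure_pmf (ising_pmf A \<beta> 0)). sqrt (real N) * (spin_mean \<sigma> - center t \<sigma>) \<le> x}
    = (\<Sum>s\<in>cube N. weight s / (\<Sum>s\<in>cube N. weight s) * of_bool ((\<Sum>i<N. s i - mag s) / sqrt N \<le> x))"
proof -
  have N0: "0 < real N" using N2 by simp
  have Z: "ising_partition A \<beta> 0 = (\<Sum>s\<in>cube N. weight s)"
    using A by (simp add: ising_partition_def sum_spin_configs ising_weight_vec[OF A])
  have X: "sqrt (real N) * (spin_mean (Matrix.vec N s) - center t (Matrix.vec N s)) = (\<Sum>i<N. s i - mag s) / sqrt N" for s
  proof -
    have m: "spin_mean (Matrix.vec N s) = sum s {..<N} / N" by (simp add: spin_mean_def)
    then have "center t (Matrix.vec N s) = mag s" using N0 by (simp add: center_def mag_def zero_le_divide_iff)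
    with m have "spin_mean (Matrix.vec N s) - center t (Matrix.vec N s) = (\<Sum>i<N. s i - mag s) / N"
      using N0 by (simp add: sum_subtractf diff_divide_distrib)
    moreover have "sqrt N / N = 1 / sqrt N" using N0 by (simp add: field_simps)
    ultimately show ?thesis by (metis times_divide_eq_left times_divide_eq_right mult.commute mult_1_right)
  qed
  show ?thesis
    using A by (simp add: prob_ising[where N = N] sum_spin_configs X Z ising_weight_vec[OF A])
qed

lemma ks_diff_le:
  assumes A: "A \<in> carrier_mat N N" "\<And>i j. i < N \<Longrightarrow> j < N \<Longrightarrow> A $$ (i, j) = a i j"
    and \<tau>: "\<tau> = (1 - t\<^sup>2) / (1 - \<beta> * (1 - t\<^sup>2))"
    and Q: "prob_space Q" and Z: "distributed Q lborel Z (normal_density 0 (sqrt \<tau>))"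
    and le: "\<And>z. \<bar>\<Sum>s\<in>cube N. weight s / (\<Sum>s\<in>cube N. weight s)
        * (of_bool ((\<Sum>i<N. s i - mag s) / (sqrt N * sqrt \<tau>) \<le> z) - Phi z)\<bar> \<le> b"
  shows "d_KS (measure_pmf (ising_pmf A \<beta> 0)) (\<lambda>\<sigma>. sqrt (real N) * (spin_mean \<sigma> - center t \<sigma>)) Q Z \<le> b"
proof (rule d_KS_le)
  fix x
  let ?Z = "\<Sum>s\<in>cube N. weight s"
  have Z0: "?Z \<noteq> 0" using norm_const_pos norm_const_le by linarith
  have \<tau>0: "0 < \<tau>"
    unfolding \<tau> using slope_lt_1[OF \<beta> t] t_lt_1[OF \<beta> t] t by (simp add: power_less_one_iff)
  have N0: "0 < sqrt (real N)" using N2 by simp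
  have eq: "(\<Sum>i<N. s i - mag s) / (sqrt N * sqrt \<tau>) \<le> x / sqrt \<tau> \<longleftrightarrow> (\<Sum>i<N. s i - mag s) / sqrt N \<le> x" for s
  proof -
    have "(\<Sum>i<N. s i - mag s) / (sqrt N * sqrt \<tau>) = ((\<Sum>i<N. s i - mag s) / sqrt N) / sqrt \<tau>" by simp
    then show ?thesis using \<tau>0 by (simp only: divide_le_cancel) simp
  qed
  have "(\<Sum>s\<in>cube N. weight s / ?Z * Phi (x / sqrt \<tau>)) = Phi (x / sqrt \<tau>)"
    using Z0 by (simp add: sum_distrib_right[symmetric] sum_divide_distrib[symmetric])
  moreover have "(\<Sum>s\<in>cube N. weight s / ?Z * (of_bool ((\<Sum>i<N. s i - mag s) / (sqrt N * sqrt \<tau>) \<le> x / sqrt \<tau>) - Phi (x / sqrt \<tau>)))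
    = (\<Sum>s\<in>cube N. weight s / ?Z * of_bool ((\<Sum>i<N. s i - mag s) / sqrt N \<le> x) - weight s / ?Z * Phi (x / sqrt \<tau>))"
    by (simp only: right_diff_distrib eq)
  moreover have "\<dots> = (\<Sum>s\<in>cube N. weight s / ?Z * of_bool ((\<Sum>i<N. s i - mag s) / sqrt N \<le> x))
      - (\<Sum>s\<in>cube N. weight s / ?Z * Phi (x / sqrt \<tau>))"
    by (rule sum_subtractf)
  ultimately have "(\<Sum>s\<in>cube N. weight s / ?Z * (of_bool ((\<Sum>i<N. s i - mag s) / (sqrt N * sqrt \<tau>) \<le> x / sqrt \<tau>) - Phi (x / sqrt \<tau>)))
    = (\<Sum>s\<in>cube N. weight s / ?Z * of_bool ((\<Sum>i<N. s i - mag s) / sqrt N \<le> x)) - Phi (x / sqrt \<tau>)"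
    by (simp only:)
  with le[of "x / sqrt \<tau>"]
  have "\<bar>(\<Sum>s\<in>cube N. weight s / ?Z * of_bool ((\<Sum>i<N. s i - mag s) / sqrt N \<le> x)) - Phi (x / sqrt \<tau>)\<bar> \<le> b"
    by (simp only:)
  moreover note ising_vec_sum[OF A, of x, symmetric] prob_normal_le[OF Z Q \<tau>0, of x, symmetric]
  ultimately show "\<bar>measure (measure_pmf (ising_pmf A \<beta> 0))
      {\<sigma> \<in> space (measure_pmf (ising_pmf A \<beta> 0)). sqrt (real N) * (spin_mean \<sigma> - center t \<sigma>) \<le> x}
      - measure Q {\<omega> \<in> space Q. Z \<omega> \<le> x}\<bar> \<le> b"
    by (simp only:)
qed

end

text \<open>Named outside the locale so that independence of \<open>N\<close> is visible;
  \<open>moment_const\<close> likewise depends only on \<beta>, \<open>t\<close> and the gain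
  \<kappa>.\<close>

definition stein_const :: "real \<Rightarrow> real \<Rightarrow> real" where
  "stein_const \<beta> t = 2 * (2 * \<beta> + 1 + 8 / t\<^sup>2) / (1 - t\<^sup>2)
     + mills 0 * (\<beta> + 4 * \<beta>\<^sup>2 + 8 / t\<^sup>2)
         / ((1 - \<beta> * (1 - t\<^sup>2)) * sqrt ((1 - t\<^sup>2) / (1 - \<beta> * (1 - t\<^sup>2))))
     + 4 * (1 + (\<beta> + 4 * \<beta>\<^sup>2 + 8 / t\<^sup>2)) / (1 - t\<^sup>2)"

definition moment_const :: "real \<Rightarrow> real \<Rightarrow> real \<Rightarrow> real" where
  "moment_const \<beta> t \<kappa> = (let q = (1 + \<kappa> / 16) / (\<kappa> / 16); \<eta> = 1 / (20 * q * \<beta>);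
      C = ln (1 / sqrt (1 - (1 - \<kappa> / 16))) / \<eta>\<^sup>2 + (16 * (5 * q * \<beta> / 2)\<^sup>2 + 4 * (5 * q * \<beta> / 2) / \<eta>)
        + (5 * q * \<beta> * t)\<^sup>2 + 1
    in 5 + 160 * q * (C + 32))"

lemma (in spin_matrix) stein_const_nonneg: "0 \<le> stein_const \<beta> t"
proof -
  have k: "0 < 1 - \<beta> * (1 - t\<^sup>2)" using slope_lt_1[OF \<beta> t] by simp
  have v: "0 < 1 - t\<^sup>2" using t_lt_1[OF \<beta> t] t by (simp add: power_less_one_iff)
  have c: "0 \<le> 8 / t\<^sup>2" "0 \<le> 4 * \<beta>\<^sup>2" "0 \<le> \<beta>" using \<beta> by auto
  show ?thesis unfolding stein_const_def
    by (intro add_nonneg_nonneg divide_nonneg_nonneg mult_nonneg_nonneg mills_nonneg real_sqrt_ge_zero)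
       (use k v c in auto)
qed

lemma (in spin_matrix) d_KS_le_of_gap:
  fixes \<gamma> \<kappa> K0 :: real
  assumes A: "A \<in> carrier_mat N N" "\<And>i j. i < N \<Longrightarrow> j < N \<Longrightarrow> A $$ (i, j) = a i j"
    and \<tau>: "\<tau> = (1 - t\<^sup>2) / (1 - \<beta> * (1 - t\<^sup>2))"
    and Q: "prob_space Q" and Z: "distributed Q lborel Z (normal_density 0 (sqrt \<tau>))"
    and half: "\<And>\<kappa> N. 0 < \<kappa> \<Longrightarrow> \<kappa> \<le> K0 \<Longrightarrow> 0 < N \<Longrightarrow> half_mgf_le \<beta> t \<kappa> N"
    and \<kappa>: "0 < \<kappa>" "\<kappa> \<le> K0" "\<kappa> \<le> \<gamma> / 100" and \<gamma>: "0 < \<gamma>" "\<gamma> < 1"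
    and d0: "1 / 2 \<le> d 0" "d 0 \<le> 1 + \<kappa> / 16" and gap: "\<And>k. 0 < k \<Longrightarrow> k < N \<Longrightarrow> d k \<le> 1 - \<gamma>"
    and Nt: "4 \<le> N * t" and rho2: "18 * rho2 \<le> \<gamma>\<^sup>2 * N"
  shows "d_KS (measure_pmf (ising_pmf A \<beta> 0)) (\<lambda>\<sigma>. sqrt (real N) * (spin_mean \<sigma> - center t \<sigma>)) Q Z
    \<le> stein_const \<beta> t * moment_const \<beta> t \<kappa> * (1 / sqrt N * (frob2 + rho2 + \<bar>\<Sum>i<N. rho i\<bar>))"
proof (rule ks_diff_le[OF A \<tau> Q Z])
  fix z
  have "\<bar>\<Sum>s\<in>cube N. weight s / (\<Sum>s\<in>cube N. weight s)
        * (of_bool ((\<Sum>i<N. s i - mag s) / (sqrt N * sqrt \<tau>) \<le> z) - Phi z)\<bar>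
    \<le> stein_const \<beta> t / sqrt N * (\<Sum>s\<in>cube N. weight s / (\<Sum>s\<in>cube N. weight s) * slack s)"
    unfolding stein_const_def \<tau> by (rule ks_bound_cube[OF Nt])
  also have "\<dots> \<le> stein_const \<beta> t / sqrt N * (moment_const \<beta> t \<kappa> * (frob2 + rho2 + \<bar>\<Sum>i<N. rho i\<bar>))"
    unfolding moment_const_def Let_def
    by (intro mult_left_mono slack_mean_le[OF half \<kappa> \<gamma> d0 gap Nt rho2] divide_nonneg_nonneg stein_const_nonneg)
       auto
  finally show "\<bar>\<Sum>s\<in>cube N. weight s / (\<Sum>s\<in>cube N. weight s)
        * (of_bool ((\<Sum>i<N. s i - mag s) / (sqrt N * sqrt \<tau>) \<le> z) - Phi z)\<bar>
    \<le> stein_const \<beta> t * moment_const \<beta> t \<kappa> * (1 / sqrt N * (frob2 + rho2 + \<bar>\<Sum>i<N. rho i\<bar>))"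
    by simp
qed

lemma spin_matrix_of_coupling:
  assumes A: "coupling_matrix N A" and N: "2 \<le> N" and \<beta>: "1 < \<beta>" and t: "0 < t" "t = tanh (\<beta> * t)"
  obtains u d where "spin_matrix N (\<lambda>i j. A $$ (i, j)) u d \<beta> t" "\<And>k. k < N \<Longrightarrow> d k = eigval A (Suc k)"
proof -
  have c: "A \<in> carrier_mat N N" and sym: "\<And>i j. i < N \<Longrightarrow> j < N \<Longrightarrow> A $$ (i, j) = A $$ (j, i)"
    using A by (auto simp: coupling_matrix_def)
  show thesis
  proof (rule spectral_decomposition[OF c sym])
    fix u :: "nat \<Rightarrow> nat \<Rightarrow> real" and d :: "nat \<Rightarrow> real"
    assume ud: "\<And>k l. k < N \<Longrightarrow> l < N \<Longrightarrow> (\<Sum>i<N. u k i * u l i) = of_bool (k = l)"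
      "\<And>i j. i < N \<Longrightarrow> j < N \<Longrightarrow> (\<Sum>k<N. u k i * u k j) = of_bool (i = j)"
      "\<And>i j. i < N \<Longrightarrow> j < N \<Longrightarrow> A $$ (i, j) = (\<Sum>k<N. d k * u k i * u k j)"
      "\<And>k. k < N \<Longrightarrow> d k = eigval A (Suc k)"
      "\<And>k l. k \<le> l \<Longrightarrow> l < N \<Longrightarrow> d l \<le> d k"
    have nn: "0 \<le> A $$ (i, j)" "A $$ (i, i) = 0" if "i < N" "j < N" for i j
      using A that by (auto simp: coupling_matrix_def)
    have "spin_matrix N (\<lambda>i j. A $$ (i, j)) u d \<beta> t"
      by (rule spin_matrix.intro) (fact N sym nn ud \<beta> t | rule nn(2), assumption, assumption)+
    then show thesis using ud(4) by (rule that)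
  qed
qed

definition error_term :: "nat \<Rightarrow> real mat \<Rightarrow> real" where
  "error_term N A = (frobenius_norm A)\<^sup>2 + (\<Sum>i<N. (row_sum A i - 1)\<^sup>2) + \<bar>\<Sum>i<N. (row_sum A i - 1)\<bar>"

lemma (in spin_matrix) error_term_eq:
  assumes A: "A \<in> carrier_mat N N" "\<And>i j. i < N \<Longrightarrow> j < N \<Longrightarrow> A $$ (i, j) = a i j"
  shows "error_term N A = frob2 + rho2 + \<bar>\<Sum>i<N. rho i\<bar>"
proof -
  have "row_sum A i - 1 = rho i" if "i < N" for i
    using A that by (simp add: row_sum_def rho_def)
  moreover have "(frobenius_norm A)\<^sup>2 = frob2"
    using A by (simp add: frobenius_norm_def frob2_def sum_nonneg)
  ultimately show ?thesis by (simp add: error_term_def rho2_def)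
qed

theorem theorem1p2:
  fixes \<beta> B t \<tau> :: real
    and A :: "nat \<Rightarrow> real mat"
    and Q :: "'z measure"
    and Z :: "'z \<Rightarrow> real"
  assumes Theta2: "(\<beta>, B) \<in> Theta2"
    and t: "t = pos_root \<beta>"
    and coupling: "\<And>N. N \<ge> 2 \<Longrightarrow> coupling_matrix N (A N)"
    and row_sums: "(\<lambda>N. MAX i\<in>{..<N}. row_sum (A N) i) \<lesssim>\<^sub>N (\<lambda>N. 1)"
    and eigval_1: "(\<lambda>N. eigval (A N) 1) \<longlonglongrightarrow> 1"
    and eigval_2: "limsup (\<lambda>N. ereal (eigval (A N) 2 / eigval (A N) 1)) < 1"
    and \<tau>: "\<tau> = (1 - t\<^sup>2) / (1 - \<beta> * (1 - t\<^sup>2))"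
    and Q: "prob_space Q"
    and Z: "distributed Q lborel Z (normal_density 0 (sqrt \<tau>))"
  shows "(\<lambda>N. d_KS (measure_pmf (ising_pmf (A N) \<beta> B))
                   (\<lambda>\<sigma>. sqrt (real N) * (spin_mean \<sigma> - center t \<sigma>)) Q Z)
         \<lesssim>\<^sub>N (\<lambda>N. 1 / sqrt (real N) *
                  ((frobenius_norm (A N))\<^sup>2
                   + (\<Sum>i<N. (row_sum (A N) i - 1)\<^sup>2)
                   + \<bar>\<Sum>i<N. (row_sum (A N) i - 1)\<bar>))"
proof -
  have \<beta>: "1 < \<beta>" and B: "B = 0" using Theta2 by (auto simp: Theta2_def)
  have t': "0 < t" "t = tanh (\<beta> * t)"
    using theI'[OF ex1_pos_root[OF \<beta>]] unfolding t pos_root_def by auto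
  obtain K0 where K0: "K0 > 0" and half: "\<And>\<kappa> N. 0 < \<kappa> \<Longrightarrow> \<kappa> \<le> K0 \<Longrightarrow> 0 < N \<Longrightarrow> half_mgf_le \<beta> t \<kappa> N"
    using half_cube_exp_le[OF \<beta> t'] by blast
  obtain r0 where r0: "limsup (\<lambda>N. ereal (eigval (A N) 2 / eigval (A N) 1)) < ereal r0" "ereal r0 < 1"
    using ereal_dense2[OF eigval_2] by auto
  \<comment> \<open>\<open>r0\<close> may be negative; the maximum makes \<open>r\<close> positive,
    so that it can multiply the bound on the top eigenvalue.\<close>
  define r where "r = max r0 (1 / 2)"
  have r: "1 / 2 \<le> r" "r < 1" "r0 \<le> r" using r0(2) by (auto simp: r_def)
  \<comment> \<open>Half of the gap \<open>1 - r\<close>. The other half covers the excess of the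
    top eigenvalue over 1, since the hypothesis bounds only a ratio of eigenvalues.\<close>
  define \<gamma> where "\<gamma> = (1 - r) / 2"
  have \<gamma>: "0 < \<gamma>" "\<gamma> < 1" using r by (auto simp: \<gamma>_def)
  define \<kappa> where "\<kappa> = min K0 (\<gamma> / 100)"
  have \<kappa>: "0 < \<kappa>" "\<kappa> \<le> K0" "\<kappa> \<le> \<gamma> / 100" using K0 \<gamma> by (auto simp: \<kappa>_def)
  define dks where "dks = (\<lambda>N. d_KS (measure_pmf (ising_pmf (A N) \<beta> B))
                   (\<lambda>\<sigma>. sqrt (real N) * (spin_mean \<sigma> - center t \<sigma>)) Q Z)"
  define er where "er = (\<lambda>N. error_term N (A N))"
  have dks1: "dks N \<le> 1" for N unfolding dks_def using Q by (intro d_KS_le_1 prob_space_measure_pmf)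
  have er0: "0 \<le> er N" for N unfolding er_def error_term_def by (intro add_nonneg_nonneg sum_nonneg) auto
  have er_pos: "0 < er N" if N: "2 \<le> N" for N
  proof -
    obtain u d where "spin_matrix N (\<lambda>i j. A N $$ (i, j)) u d \<beta> t"
      using spin_matrix_of_coupling[OF coupling[OF N] N \<beta> t'] by metis
    then interpret spin_matrix N "\<lambda>i j. A N $$ (i, j)" u d \<beta> t .
    have "er N = frob2 + rho2 + \<bar>\<Sum>i<N. rho i\<bar>"
      unfolding er_def using coupling[OF N] by (intro error_term_eq) (auto simp: coupling_matrix_def)
    then show ?thesis using frob2_pos frob2_nonneg rho2_nonneg by (cases "rho2 = 0") auto
  qed
  define K where "K = \<bar>stein_const \<beta> t * moment_const \<beta> t \<kappa>\<bar> + 1"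
  have "eventually (\<lambda>N. eigval (A N) 1 < 1 + \<kappa> / 16) sequentially"
    "eventually (\<lambda>N. 1 / 2 < eigval (A N) 1) sequentially"
    by (rule order_tendstoD[OF eigval_1]; use \<kappa> in simp)+
  moreover have "eventually (\<lambda>N. eigval (A N) 2 / eigval (A N) 1 < r0) sequentially"
    using Limsup_lessD[OF r0(1)] by simp
  moreover have "eventually (\<lambda>N. 4 / t \<le> real N) sequentially" "eventually (\<lambda>N. 18 / \<gamma>\<^sup>2 \<le> sqrt (real N)) sequentially"
    using filterlim_real_sequentially filterlim_compose[OF sqrt_at_top filterlim_real_sequentially]
    by (auto simp: filterlim_at_top)
  ultimately have "eventually (\<lambda>N. eigval (A N) 1 < 1 + \<kappa> / 16 \<and> 1 / 2 < eigval (A N) 1 \<and>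
      eigval (A N) 2 / eigval (A N) 1 < r0 \<and> 4 / t \<le> real N \<and> 18 / \<gamma>\<^sup>2 \<le> sqrt (real N)) sequentially"
    by (intro eventually_conj)
  then obtain N0 where N0: "\<And>N. N \<ge> N0 \<Longrightarrow> eigval (A N) 1 < 1 + \<kappa> / 16 \<and> 1 / 2 < eigval (A N) 1 \<and>
      eigval (A N) 2 / eigval (A N) 1 < r0 \<and> 4 / t \<le> real N \<and> 18 / \<gamma>\<^sup>2 \<le> sqrt (real N)"
    by (auto simp: eventually_sequentially)
  \<comment> \<open>If the error term exceeds \<open>sqrt N\<close>, the trivial bound 1 suffices.
    Otherwise \<open>rho2 \<le> sqrt N\<close>, which for large \<open>N\<close> is small enough to
    force the overlap of the top eigenvector with the constant vector.\<close>
  have large: "dks N \<le> K * (1 / sqrt N * er N)" if N: "2 \<le> N" "N0 \<le> N" for N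
  proof (cases "sqrt N < er N")
    case True
    then have "1 \<le> 1 / sqrt N * er N" using N by (simp add: field_simps)
    then have "1 * 1 \<le> K * (1 / sqrt N * er N)" by (intro mult_mono) (auto simp: K_def)
    with dks1[of N] show ?thesis by linarith
  next
    case False
    obtain u d where sp: "spin_matrix N (\<lambda>i j. A N $$ (i, j)) u d \<beta> t"
      and d: "\<And>k. k < N \<Longrightarrow> d k = eigval (A N) (Suc k)"
      using spin_matrix_of_coupling[OF coupling[OF N(1)] N(1) \<beta> t'] by metis
    interpret spin_matrix N "\<lambda>i j. A N $$ (i, j)" u d \<beta> t by (rule sp)
    have AN: "A N \<in> carrier_mat N N" using coupling[OF N(1)] by (simp add: coupling_matrix_def)
    have er: "er N = frob2 + rho2 + \<bar>\<Sum>i<N. rho i\<bar>"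
      unfolding er_def using AN by (intro error_term_eq) auto
    have e1: "eigval (A N) 1 = d 0" "eigval (A N) 2 = d 1" using d[of 0] d[of 1] N by (auto simp: numeral_2_eq_2)
    note ev = N0[OF N(2), unfolded e1]
    have gap: "d k \<le> 1 - \<gamma>" if k: "0 < k" "k < N" for k
    proof -
      have "d k \<le> d 1" using k by (intro d_mono) auto
      also have "d 1 \<le> r0 * d 0"
      proof -
        have "0 < d 0" "d 1 / d 0 < r0" using ev by auto
        then show ?thesis by (simp only: pos_divide_less_eq less_imp_le)
      qed
      also have "\<dots> \<le> r * d 0" using ev r by (intro mult_right_mono) auto
      also have "\<dots> \<le> r * (1 + \<kappa> / 16)" using ev r by (intro mult_left_mono) auto
      also have "\<dots> \<le> r + 1 * (\<kappa> / 16)" using r \<kappa> mult_right_mono[of r 1 "\<kappa> / 16"] by (simp add: algebra_simps)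
      also have "\<dots> \<le> 1 - \<gamma>"
      proof -
        have "\<gamma> + \<gamma> = 1 - r" unfolding \<gamma>_def by (rule field_sum_of_halves)
        then show ?thesis using \<kappa> \<gamma> by linarith
      qed
      finally show ?thesis .
    qed
    have Nt: "4 \<le> N * t" using ev t' by (simp add: field_simps)
    have rho2: "18 * rho2 \<le> \<gamma>\<^sup>2 * N"
    proof -
      have "rho2 \<le> sqrt N" using False frob2_nonneg unfolding er by linarith
      then have "18 * rho2 \<le> 18 * sqrt N" by simp
      also have "18 \<le> \<gamma>\<^sup>2 * sqrt N" using ev \<gamma> by (simp add: field_simps)
      then have "18 * sqrt N \<le> \<gamma>\<^sup>2 * sqrt N * sqrt N" by (intro mult_right_mono) auto
      finally show ?thesis by (simp add: mult.assoc)
    qed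
    have "dks N \<le> stein_const \<beta> t * moment_const \<beta> t \<kappa> * (1 / sqrt N * er N)"
      unfolding dks_def B er
      by (rule d_KS_le_of_gap[OF AN refl \<tau> Q Z half \<kappa> \<gamma> _ _ gap Nt rho2]) (use ev in auto)
    also have "\<dots> \<le> K * (1 / sqrt N * er N)"
      using er0[of N] by (intro mult_right_mono) (auto simp: K_def)
    finally show ?thesis .
  qed
  \<comment> \<open>For each \<open>N\<close> below \<open>N0\<close> the summand
    \<open>sqrt N / er N\<close> turns the right side into at least 1, by \<open>er_pos\<close>; all
    other summands are nonnegative.\<close>
  define K' where "K' = K + (\<Sum>N<N0. sqrt N / er N)"
  have "dks N \<le> K' * (1 / sqrt N * er N)" if N: "2 \<le> N" for N
  proof (cases "N0 \<le> N")
    case True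
    have "K \<le> K'" unfolding K'_def using er0 by (simp add: sum_nonneg)
    then have "K * (1 / sqrt N * er N) \<le> K' * (1 / sqrt N * er N)"
      using er0[of N] by (intro mult_right_mono) auto
    with large[OF N True] show ?thesis by linarith
  next
    case False
    have "sqrt N / er N \<le> (\<Sum>N<N0. sqrt N / er N)"
      using False er0 by (intro member_le_sum) auto
    also have "\<dots> \<le> K'" by (simp add: K'_def K_def)
    finally have "sqrt N / er N * (1 / sqrt N * er N) \<le> K' * (1 / sqrt N * er N)"
      using er0[of N] by (intro mult_right_mono) auto
    moreover have "sqrt N / er N * (1 / sqrt N * er N) = 1" using er_pos[OF N] N by simp
    ultimately show ?thesis using dks1[of N] by linarith
  qed
  then show ?thesis unfolding lesssim_def dks_def er_def error_term_def by blast
qed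

end
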